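(* Let $n\ge 2$ and let $B_1\subset\mathbb{R}^n$ be the open unit ball centered at the origin. Let $\vec b:B_1\to\mathbb{R}^n$ and $c:B_1\to\mathbb{R}$ satisfy $\|\vec b\|_{C^1(B_1)}+\|c\|_{L^\infty(B_1)}\le M$ for some constant $M$. Let $u\in L^1_{\rm loc}(B_1\setminus\{0\})$ be a nonnegative function satisfying $$-\Delta u+\vec b\cdot\nabla u+c\,u\ge 0\quad\text{in }\mathcal{D}'(B_1\setminus\{0\}).$$ Then $u\in L^1_{\rm loc}(B_1)$, and there exist a constant $a\ge 0$ and a nonnegative Radon measure $\mu$ on $B_1$ with $\mu(\{0\})=0$ such that $$-\Delta u+\vec b\cdot\nabla u+c\,u=\mu+a\,\delta_0\quad\text{in }\mathcal{D}'(B_1).$$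
   Context: $\delta_0$ is the Dirac delta distribution at the origin. For an open set $U$ and $u\in L^1_{\rm loc}(U)$, the expression $-\Delta u+\vec b\cdot\nabla u+cu$ denotes the distribution $\varphi\mapsto\int_U u\,[-\Delta\varphi-\mathrm{div}(\vec b\,\varphi)+c\,\varphi]\,dx$ for $\varphi\in C_c^\infty(U)$. An inequality "$\ge 0$ in $\mathcal{D}'(U)$" means that this is nonnegative for every nonnegative $\varphi\in C_c^\infty(U)$. *)

theory Defs
  imports "HOL-Analysis.Analysis" "HOL-Probability.Essential_Supremum"
begin

definition partial_deriv :: "'n \<Rightarrow> (real ^ 'n \<Rightarrow> real) \<Rightarrow> real ^ 'n \<Rightarrow> real" where
  "partial_deriv i f x = frechet_derivative f (at x) (axis i 1)"

definition laplacian :: "(real ^ 'n \<Rightarrow> real) \<Rightarrow> real ^ 'n \<Rightarrow> real" where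
  "laplacian f x = (\<Sum>i\<in>UNIV. partial_deriv i (partial_deriv i f) x)"

definition divergence :: "(real ^ 'n \<Rightarrow> real ^ 'n) \<Rightarrow> real ^ 'n \<Rightarrow> real" where
  "divergence F x = (\<Sum>i\<in>UNIV. partial_deriv i (\<lambda>y. F y $ i) x)"

text \<open>Only meant for open sets, where differentiability on the set is differentiability
  at each of its points.\<close>

primrec Ck_on :: "nat \<Rightarrow> (real ^ 'n \<Rightarrow> real) \<Rightarrow> (real ^ 'n) set \<Rightarrow> bool" where
  "Ck_on 0 f U \<longleftrightarrow> continuous_on U f"
| "Ck_on (Suc k) f U \<longleftrightarrow> f differentiable_on U \<and> (\<forall>i. Ck_on k (partial_deriv i f) U)"

text \<open>The space of compactly supported smooth functions on an open set, each function being
  represented by its extension by zero to the whole space.\<close>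

definition test_functions :: "(real ^ 'n) set \<Rightarrow> (real ^ 'n \<Rightarrow> real) set" where
  "test_functions U = {\<phi>. (\<forall>k. Ck_on k \<phi> UNIV) \<and>
     compact (closure {x. \<phi> x \<noteq> 0}) \<and> closure {x. \<phi> x \<noteq> 0} \<subseteq> U}"

definition L1_loc :: "(real ^ 'n) set \<Rightarrow> (real ^ 'n \<Rightarrow> real) set" where
  "L1_loc U = {u. \<forall>K. compact K \<and> K \<subseteq> U \<longrightarrow> u absolutely_integrable_on K}"

definition C1_norm :: "(real ^ 'n) set \<Rightarrow> (real ^ 'n \<Rightarrow> real ^ 'n) \<Rightarrow> ereal" where
  "C1_norm U b = (SUP x\<in>U. ereal (norm (b x))) + (SUP x\<in>U. ereal (onorm (frechet_derivative b (at x))))"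

definition Linf_norm :: "(real ^ 'n) set \<Rightarrow> (real ^ 'n \<Rightarrow> real) \<Rightarrow> ereal" where
  "Linf_norm U c = esssup (lebesgue_on U) (\<lambda>x. ereal \<bar>c x\<bar>)"

text \<open>The distribution \<open>-\<Delta>u + b\<cdot>\<nabla>u + cu\<close> on \<open>U\<close>, as a functional on test functions.\<close>

definition elliptic_dist ::
  "(real ^ 'n) set \<Rightarrow> (real ^ 'n \<Rightarrow> real ^ 'n) \<Rightarrow> (real ^ 'n \<Rightarrow> real) \<Rightarrow> (real ^ 'n \<Rightarrow> real)
    \<Rightarrow> (real ^ 'n \<Rightarrow> real) \<Rightarrow> real" where
  "elliptic_dist U b c u \<phi> =
     (LINT x:U|lebesgue. u x * (- laplacian \<phi> x - divergence (\<lambda>y. \<phi> y *\<^sub>R b y) x + c x * \<phi> x))"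

definition dist_nonneg :: "(real ^ 'n) set \<Rightarrow> ((real ^ 'n \<Rightarrow> real) \<Rightarrow> real) \<Rightarrow> bool" where
  "dist_nonneg U T \<longleftrightarrow> (\<forall>\<phi>\<in>test_functions U. (\<forall>x. 0 \<le> \<phi> x) \<longrightarrow> 0 \<le> T \<phi>)"

definition dist_eq ::
  "(real ^ 'n) set \<Rightarrow> ((real ^ 'n \<Rightarrow> real) \<Rightarrow> real) \<Rightarrow> ((real ^ 'n \<Rightarrow> real) \<Rightarrow> real) \<Rightarrow> bool" where
  "dist_eq U S T \<longleftrightarrow> (\<forall>\<phi>\<in>test_functions U. S \<phi> = T \<phi>)"

definition dirac :: "real ^ 'n \<Rightarrow> (real ^ 'n \<Rightarrow> real) \<Rightarrow> real" where
  "dirac p \<phi> = \<phi> p"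

definition radon_measure_on :: "(real ^ 'n) set \<Rightarrow> (real ^ 'n) measure \<Rightarrow> bool" where
  "radon_measure_on U \<mu> \<longleftrightarrow> sets \<mu> = sets (restrict_space borel U) \<and>
     (\<forall>K. compact K \<and> K \<subseteq> U \<longrightarrow> emeasure \<mu> K < \<infinity>) \<and>
     (\<forall>A\<in>sets \<mu>. emeasure \<mu> A = (SUP K\<in>{K. compact K \<and> K \<subseteq> A}. emeasure \<mu> K))"

end

theory Submission
  imports Defs
begin

text \<open>
  Moving the derivatives to the test function turns the hypothesis into
  \<open>\<integral> u L\<phi> \<ge> 0\<close> for nonnegative test functions supported away from the origin, where
  \<open>L\<phi> = -\<Delta>\<phi> - b\<cdot>\<nabla>\<phi> + d\<phi>\<close> and \<open>d = c - div b\<close> is locally bounded. The point is to admit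
  test functions that do not vanish near the origin. They are multiplied by radial cutoffs
  \<open>W = E(f)\<close>, where \<open>E(s) = exp(-1/s)\<close> for positive \<open>s\<close> and zero otherwise, and
  \<open>f = (1 + \<kappa>\<bar>x\<bar> + \<epsilon> ln \<bar>x\<bar>)/4\<close>. For each positive \<open>\<epsilon>\<close> such a \<open>W\<close> vanishes near the origin, and
  it is subharmonic on the unit ball, because \<open>E\<close> is increasing and convex on \<open>s \<le> 1/2\<close> and
  \<open>f\<close> is subharmonic in every dimension at least two. So the Laplacian of the cutoff, the most
  singular of the error terms, always has the favourable sign.

  With \<open>\<kappa> = 1\<close> the term \<open>\<bar>x\<bar>\<close> makes \<open>\<Delta>f\<close> as large as \<open>1/\<bar>x\<bar>\<close>, which beats the drift and the
  zeroth order term near the origin: \<open>LW \<le> -C/\<bar>x\<bar>\<close> wherever \<open>f\<close> is bounded below by a positive constant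
  (\<open>adjoint_op_barrier_le\<close>). Testing with \<open>W\<close> times a fixed cutoff and letting \<open>\<epsilon>\<close> tend to zero
  shows that not only \<open>u\<close> but even \<open>u/\<bar>x\<bar>\<close> is integrable near the origin
  (\<open>weighted_integrals_bounded\<close>, \<open>u_integrable\<close>).

  With \<open>\<kappa> = 0\<close> the cutoffs converge to a positive constant, and the only errors in
  \<open>L(\<phi>W)\<close> of the wrong sign come from \<open>\<nabla>W\<close>, which is \<open>O(\<epsilon>/\<bar>x\<bar>)\<close>. The weighted
  integrability makes them disappear in the limit, so \<open>\<integral> u L\<phi> \<ge> 0\<close> for all nonnegative test
  functions on the whole ball (\<open>supersolution_across_origin\<close>).

  A positive functional on test functions is integration against a Borel measure that is finite on
  compact sets (\<open>riesz_representation\<close>). The mass of this measure at the origin is the constant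
  \<open>a\<close>, and the rest of it is \<open>\<mu>\<close>.
\<close>

section \<open>Calculus of partial derivatives\<close>

lemma partial_deriv_eqI:
  "(f has_derivative f') (at x) \<Longrightarrow> partial_deriv i f x = f' (axis i 1)"
  unfolding partial_deriv_def by (metis frechet_derivative_at)

text \<open>The values agree even where \<open>f\<close> is not differentiable: \<open>frechet_derivative\<close> is a choice
  from the set of derivatives, and that set depends only on the germ of the function.\<close>
lemma partial_deriv_cong:
  assumes "open U" "x \<in> U" "\<And>y. y \<in> U \<Longrightarrow> f y = g y"
  shows "partial_deriv i f x = partial_deriv i g x"
proof -
  have "(f has_derivative f') (at x) \<longleftrightarrow> (g has_derivative f') (at x)" for f'
    using assms has_derivative_transform_within_open[of f f' x UNIV U g]
      has_derivative_transform_within_open[of g f' x UNIV U f] by (metis)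
  then show ?thesis
    unfolding partial_deriv_def frechet_derivative_def by simp
qed

lemma differentiable_at_cong:
  assumes "open U" "x \<in> U" "\<And>y. y \<in> U \<Longrightarrow> f y = g y"
  shows "f differentiable (at x) \<longleftrightarrow> g differentiable (at x)"
  using assms has_derivative_transform_within_open[of f _ x UNIV U g]
    has_derivative_transform_within_open[of g _ x UNIV U f]
  unfolding differentiable_def by (metis)

lemma partial_deriv_const [simp]: "partial_deriv i (\<lambda>x. a) x = 0"
  by (rule partial_deriv_eqI[of "\<lambda>x. a" "\<lambda>h. 0", simplified])

lemma partial_deriv_component: "partial_deriv i (\<lambda>x. x $ j) x = (if i = j then 1 else 0)"
proof -
  have "((\<lambda>x. x $ j) has_derivative (\<lambda>x. x $ j)) (at x)"
    by (intro bounded_linear_imp_has_derivative bounded_linear_vec_nth)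
  from partial_deriv_eqI[OF this] show ?thesis by (simp add: axis_def)
qed

lemma partial_deriv_add:
  assumes "f differentiable (at x)" "g differentiable (at x)"
  shows "partial_deriv i (\<lambda>y. f y + g y) x = partial_deriv i f x + partial_deriv i g x"
proof -
  from assms obtain f' g' where d: "(f has_derivative f') (at x)" "(g has_derivative g') (at x)"
    unfolding differentiable_def by blast
  show ?thesis
    using partial_deriv_eqI[OF d(1)] partial_deriv_eqI[OF d(2)]
      partial_deriv_eqI[OF has_derivative_add[OF d]] by simp
qed

lemma partial_deriv_mult:
  assumes "f differentiable (at x)" "g differentiable (at x)"
  shows "partial_deriv i (\<lambda>y. f y * g y) x = f x * partial_deriv i g x + partial_deriv i f x * g x"
proof -
  from assms obtain f' g' where d: "(f has_derivative f') (at x)" "(g has_derivative g') (at x)"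
    unfolding differentiable_def by blast
  show ?thesis
    using partial_deriv_eqI[OF d(1)] partial_deriv_eqI[OF d(2)]
      partial_deriv_eqI[OF has_derivative_mult[OF d]] by simp
qed

lemma differentiable_compose_real:
  fixes g :: "real \<Rightarrow> real"
  assumes "f differentiable (at x)" "(g has_real_derivative g') (at (f x))"
  shows "(\<lambda>y. g (f y)) differentiable (at x)"
  using assms differentiable_chain_at[of f x g]
  by (auto simp: o_def differentiable_def has_field_derivative_def)

lemma partial_deriv_compose:
  fixes g :: "real \<Rightarrow> real"
  assumes "f differentiable (at x)" "(g has_real_derivative g') (at (f x))"
  shows "partial_deriv i (\<lambda>y. g (f y)) x = g' * partial_deriv i f x"
proof -
  from assms(1) obtain f' where d: "(f has_derivative f') (at x)"
    unfolding differentiable_def by blast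
  have "((\<lambda>y. g (f y)) has_derivative (\<lambda>h. g' * f' h)) (at x)"
    using has_derivative_compose[OF d, of g "(*) g'"] assms(2)
    by (simp add: has_field_derivative_def)
  from partial_deriv_eqI[OF this] partial_deriv_eqI[OF d] show ?thesis by simp
qed

lemma partial_deriv_norm:
  fixes x :: "real ^ 'n"
  assumes "x \<noteq> 0"
  shows "partial_deriv i norm x = x $ i / norm x"
  using partial_deriv_eqI[OF has_derivative_norm[OF assms]]
  by (simp add: inner_axis' sgn_div_norm inner_commute[of _ "sgn x"] divide_inverse mult.commute)

section \<open>Smooth functions\<close>

lemma Ck_on_imp_continuous: "Ck_on k f U \<Longrightarrow> continuous_on U f"
  by (cases k) (auto intro: differentiable_imp_continuous_on)

lemma Ck_on_cong:
  assumes "open U" "\<And>x. x \<in> U \<Longrightarrow> f x = g x"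
  shows "Ck_on k f U \<longleftrightarrow> Ck_on k g U"
  using assms(2)
proof (induction k arbitrary: f g)
  case 0
  then show ?case by (simp cong: continuous_on_cong)
next
  case (Suc k)
  have "f differentiable_on U \<longleftrightarrow> g differentiable_on U"
    using differentiable_at_cong[OF assms(1) _ Suc.prems]
    by (auto simp: differentiable_on_eq_differentiable_at[OF assms(1)])
  moreover have "Ck_on k (partial_deriv i f) U \<longleftrightarrow> Ck_on k (partial_deriv i g) U" for i
    by (rule Suc.IH, rule partial_deriv_cong[OF assms(1) _ Suc.prems])
  ultimately show ?case by simp
qed

lemma Ck_on_SucI:
  assumes "open U" "\<And>x. x \<in> U \<Longrightarrow> f differentiable (at x)"
    and "\<And>i x. x \<in> U \<Longrightarrow> partial_deriv i f x = h i x" "\<And>i. Ck_on k (h i) U"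
  shows "Ck_on (Suc k) f U"
  using assms Ck_on_cong[OF assms(1), of "partial_deriv _ f" "h _" k]
  by (auto simp: differentiable_on_eq_differentiable_at)

lemma Ck_on_SucD:
  assumes "Ck_on (Suc k) f U" "open U"
  shows "x \<in> U \<Longrightarrow> f differentiable (at x)" "Ck_on k (partial_deriv i f) U"
  using assms by (auto simp: differentiable_on_eq_differentiable_at)

lemma Ck_on_Suc_imp: "Ck_on (Suc k) f U \<Longrightarrow> Ck_on k f U"
proof (induction k arbitrary: f)
  case 0
  then show ?case by (auto intro: differentiable_imp_continuous_on)
next
  case (Suc k)
  then show ?case by (metis Ck_on.simps(2))
qed

lemma Ck_on_subset: "Ck_on k f U \<Longrightarrow> V \<subseteq> U \<Longrightarrow> Ck_on k f V"
  by (induction k arbitrary: f) (auto intro: continuous_on_subset differentiable_on_subset)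

lemma Ck_on_Un:
  assumes "open U" "open V" "Ck_on k f U" "Ck_on k f V"
  shows "Ck_on k f (U \<union> V)"
  using assms(3,4)
proof (induction k arbitrary: f)
  case 0
  then show ?case using assms by (simp add: continuous_on_open_Un)
next
  case (Suc k)
  then show ?case
    using assms(1,2) by (auto simp: differentiable_on_eq_differentiable_at open_Un)
qed

lemma Ck_on_const: "Ck_on k (\<lambda>x. a) U"
  by (induction k arbitrary: a) (auto simp: partial_deriv_const[abs_def])

lemma Ck_on_add:
  assumes "open U" "Ck_on k f U" "Ck_on k g U"
  shows "Ck_on k (\<lambda>x. f x + g x) U"
  using assms(2,3)
proof (induction k arbitrary: f g)
  case 0
  then show ?case by (simp add: continuous_on_add)
next
  case (Suc k)
  note f = Ck_on_SucD[OF Suc.prems(1) assms(1)]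
  note g = Ck_on_SucD[OF Suc.prems(2) assms(1)]
  show ?case
  proof (rule Ck_on_SucI[OF assms(1)])
    show "(\<lambda>x. f x + g x) differentiable at x" if "x \<in> U" for x
      using that f(1) g(1) by (intro differentiable_add)
    show "partial_deriv i (\<lambda>x. f x + g x) x = partial_deriv i f x + partial_deriv i g x"
      if "x \<in> U" for x i
      using that f(1) g(1) by (intro partial_deriv_add)
    show "Ck_on k (\<lambda>x. partial_deriv i f x + partial_deriv i g x) U" for i
      by (intro Suc.IH f g)
  qed
qed

lemma Ck_on_mult:
  assumes "open U" "Ck_on k f U" "Ck_on k g U"
  shows "Ck_on k (\<lambda>x. f x * g x) U"
  using assms(2,3)
proof (induction k arbitrary: f g)
  case 0
  then show ?case by (simp add: continuous_on_mult)
next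
  case (Suc k)
  note f = Ck_on_SucD[OF Suc.prems(1) assms(1)] Ck_on_Suc_imp[OF Suc.prems(1)]
  note g = Ck_on_SucD[OF Suc.prems(2) assms(1)] Ck_on_Suc_imp[OF Suc.prems(2)]
  show ?case
  proof (rule Ck_on_SucI[OF assms(1)])
    show "(\<lambda>x. f x * g x) differentiable at x" if "x \<in> U" for x
      using that f(1) g(1) by (intro differentiable_mult)
    show "partial_deriv i (\<lambda>x. f x * g x) x = f x * partial_deriv i g x + partial_deriv i f x * g x"
      if "x \<in> U" for x i
      using that f(1) g(1) by (intro partial_deriv_mult)
    show "Ck_on k (\<lambda>x. f x * partial_deriv i g x + partial_deriv i f x * g x) U" for i
      by (intro Ck_on_add Suc.IH f g assms(1))
  qed
qed

text \<open>The derivative of \<open>1/f\<close> is a polynomial in \<open>1/f\<close> and the derivative of \<open>f\<close>, so each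
  order of smoothness of \<open>1/f\<close> follows from the previous one.\<close>
lemma Ck_on_inverse:
  assumes "open U" "Ck_on k f U" "\<And>x. x \<in> U \<Longrightarrow> f x \<noteq> 0"
  shows "Ck_on k (\<lambda>x. inverse (f x)) U"
  using assms(2)
proof (induction k)
  case 0
  then show ?case using assms by (simp add: continuous_on_inverse)
next
  case (Suc k)
  have d: "(inverse has_real_derivative - (inverse (f x) * inverse (f x))) (at (f x))"
    if "x \<in> U" for x
    using DERIV_inverse[of "f x" UNIV] assms(3)[OF that] by (simp add: power2_eq_square)
  have IH: "Ck_on k (\<lambda>x. inverse (f x)) U"
    by (rule Suc.IH[OF Ck_on_Suc_imp[OF Suc.prems]])
  show ?case
  proof (rule Ck_on_SucI[where h = "\<lambda>i x. ((-1) * (inverse (f x) * inverse (f x))) * partial_deriv i f x", OF assms(1)])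
    fix x assume x: "x \<in> U"
    note fd = Ck_on_SucD(1)[OF Suc.prems assms(1) x]
    show "(\<lambda>x. inverse (f x)) differentiable at x"
      using differentiable_compose_real[OF fd d[OF x]] .
    show "partial_deriv i (\<lambda>x. inverse (f x)) x = ((-1) * (inverse (f x) * inverse (f x))) * partial_deriv i f x" for i
      using partial_deriv_compose[OF fd d[OF x]] by simp
  next
    show "Ck_on k (\<lambda>x. ((-1) * (inverse (f x) * inverse (f x))) * partial_deriv i f x) U" for i
      using IH Ck_on_SucD(2)[OF Suc.prems assms(1)]
      by (intro Ck_on_mult assms(1) Ck_on_const) auto
  qed
qed

lemma Ck_on_component: "Ck_on k (\<lambda>x::real^'n. x $ j) UNIV"
proof (cases k)
  case 0
  then show ?thesis by (auto intro!: continuous_intros)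
next
  case (Suc m)
  have "Ck_on (Suc m) (\<lambda>x::real^'n. x $ j) UNIV"
    by (rule Ck_on_SucI[where h = "\<lambda>i x. if i = j then 1 else 0"])
      (auto simp: Ck_on_const partial_deriv_component intro: bounded_linear_vec_nth
        bounded_linear_imp_differentiable)
  then show ?thesis using Suc by simp
qed

lemma Ck_on_norm: "Ck_on k (norm :: real ^ 'n \<Rightarrow> real) (- {0})"
proof (induction k)
  case 0
  then show ?case by (auto intro!: continuous_intros)
next
  case (Suc k)
  have "Ck_on k (\<lambda>x::real^'n. inverse (norm x)) (- {0})"
    using Suc by (intro Ck_on_inverse) auto
  then have "Ck_on k (\<lambda>x. x $ i * inverse (norm x)) (- {0::real^'n})" for i
    by (intro Ck_on_mult Ck_on_subset[OF Ck_on_component]) auto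
  then show ?case
    by (intro Ck_on_SucI[where h = "\<lambda>i x. x $ i * inverse (norm x)"])
      (auto simp: partial_deriv_norm differentiable_norm_at divide_inverse)
qed

lemma Ck_on_ln_norm: "Ck_on k (\<lambda>x::real^'n. ln (norm x)) (- {0})"
proof (cases k)
  case 0
  then show ?thesis by (auto intro!: continuous_intros)
next
  case (Suc m)
  have d: "(ln has_real_derivative inverse (norm x)) (at (norm x))" if "x \<noteq> 0" for x :: "real^'n"
    using that by (simp add: DERIV_ln)
  have "Ck_on (Suc m) (\<lambda>x::real^'n. ln (norm x)) (- {0})"
  proof (rule Ck_on_SucI[where h = "\<lambda>i x. inverse (norm x) * (x $ i * inverse (norm x))"])
    fix x :: "real^'n" assume "x \<in> - {0}"
    then have x: "x \<noteq> 0" by simp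
    show "(\<lambda>x. ln (norm x)) differentiable at x"
      using differentiable_compose_real[OF differentiable_norm_at[OF x] d[OF x]] .
    show "partial_deriv i (\<lambda>x. ln (norm x)) x = inverse (norm x) * (x $ i * inverse (norm x))" for i
      using partial_deriv_compose[OF differentiable_norm_at[OF x] d[OF x]] partial_deriv_norm[OF x]
      by (simp add: divide_inverse)
  qed (auto intro!: Ck_on_mult Ck_on_inverse Ck_on_subset[OF Ck_on_component] Ck_on_norm)
  then show ?thesis using Suc by simp
qed

section \<open>The flat exponential\<close>

text \<open>The functions \<open>exp (-1/s) / s^m\<close> on the positive half line, extended by zero. The case
  \<open>m = 0\<close> is the usual smooth function that is flat at the origin; the negative powers are
  included because the derivative of a member of the family is a combination of two others.\<close>
definition flat_exp :: "nat \<Rightarrow> real \<Rightarrow> real" where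
  "flat_exp m s = (if s \<le> 0 then 0 else exp (- (1 / s)) / s ^ m)"

lemma flat_exp_nonneg: "0 \<le> flat_exp m s"
  by (simp add: flat_exp_def)

lemma flat_exp_pos: "0 < s \<Longrightarrow> 0 < flat_exp m s"
  by (simp add: flat_exp_def)

lemma flat_exp_tendsto_0: "(flat_exp m \<longlongrightarrow> 0) (at_right 0)"
proof -
  have "((\<lambda>h. inverse h ^ m / exp (inverse h)) \<longlongrightarrow> (0::real)) (at_right 0)"
    by (rule filterlim_compose[OF tendsto_power_div_exp_0 filterlim_inverse_at_top_right])
  moreover have "eventually (\<lambda>h. inverse h ^ m / exp (inverse h) = flat_exp m h) (at_right 0)"
    unfolding eventually_at_right_field
    by (intro exI[of _ 1]) (auto simp: flat_exp_def exp_minus divide_simps)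
  ultimately show ?thesis by (rule Lim_transform_eventually)
qed

lemma flat_exp_has_derivative:
  "(flat_exp m has_real_derivative flat_exp (m + 2) s - real m * flat_exp (m + 1) s) (at s)"
proof -
  consider "s < 0" | "s = 0" | "s > 0" by linarith
  then show ?thesis
  proof cases
    case 1
    have "((\<lambda>s. 0) has_real_derivative 0) (at s)" by simp
    then have "(flat_exp m has_real_derivative 0) (at s)"
      by (rule has_field_derivative_transform_within_open[where S = "{..<0}"])
        (use 1 in \<open>auto simp: flat_exp_def\<close>)
    then show ?thesis using 1 by (simp add: flat_exp_def)
  next
    case 2
    have "((\<lambda>h. flat_exp m h / h) \<longlongrightarrow> 0) (at_left 0)"
      by (rule tendsto_eventually)
        (auto simp: eventually_at_left_field flat_exp_def intro!: exI[of _ "-1"])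
    moreover have "eventually (\<lambda>h. flat_exp (m + 1) h = flat_exp m h / h) (at_right 0)"
      by (auto simp: eventually_at_right_field flat_exp_def intro!: exI[of _ 1])
    then have "((\<lambda>h. flat_exp m h / h) \<longlongrightarrow> 0) (at_right 0)"
      by (rule Lim_transform_eventually[OF flat_exp_tendsto_0])
    ultimately have "((\<lambda>h. flat_exp m h / h) \<longlongrightarrow> 0) (at 0)"
      by (simp add: filterlim_at_split)
    then show ?thesis using 2 by (simp add: DERIV_def flat_exp_def)
  next
    case 3
    have e: "((\<lambda>s. exp (- (1 / s))) has_real_derivative exp (- (1 / s)) * (1 / s\<^sup>2)) (at s)"
      using 3 by (auto intro!: derivative_eq_intros simp: power2_eq_square)
    have "((\<lambda>s. exp (- (1 / s)) / s ^ m) has_real_derivative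
        flat_exp (m + 2) s - real m * flat_exp (m + 1) s) (at s)"
    proof (cases m)
      case 0
      show ?thesis using e 3 0 by (simp add: flat_exp_def power2_eq_square)
    next
      case (Suc k)
      have p: "((\<lambda>s. s ^ m) has_real_derivative real m * s ^ k) (at s)"
        using DERIV_pow[of m s UNIV] Suc by simp
      define A where "A = s ^ k"
      define E where "E = exp (- (1 / s))"
      have A: "0 < A" "s ^ m = s * A" "s ^ (m + 2) = s * s * s * A" "s ^ (m + 1) = s * s * A"
        using 3 Suc by (simp_all add: A_def)
      have "(E * (1 / s\<^sup>2) * (s * A) - E * (real m * A)) / (s * A * (s * A))
          = E / (s * s * s * A) - real m * (E / (s * s * A))"
        using 3 A(1) by (simp add: divide_simps power2_eq_square) (simp add: algebra_simps)
      then show ?thesis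
        using DERIV_divide[OF e p] 3 A by (simp add: flat_exp_def A_def[symmetric] E_def[symmetric] mult.assoc)
    qed
    then show ?thesis
      by (rule has_field_derivative_transform_within_open[where S = "{0<..}"])
        (use 3 in \<open>auto simp: flat_exp_def\<close>)
  qed
qed

lemma Ck_on_flat_exp:
  assumes "open U" "Ck_on k f U"
  shows "Ck_on k (\<lambda>x. flat_exp m (f x)) U"
  using assms(2)
proof (induction k arbitrary: m)
  case 0
  have "continuous_on UNIV (flat_exp m)"
    using flat_exp_has_derivative DERIV_isCont by (intro continuous_at_imp_continuous_on) blast
  then show ?case
    using 0 continuous_on_compose2[of UNIV "flat_exp m" U f] by simp
next
  case (Suc k)
  note c = Ck_on_SucD[OF Suc.prems assms(1)]
  have "Ck_on k f U" using Suc.prems by (rule Ck_on_Suc_imp)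
  note IH = Suc.IH[OF this]
  show ?case
  proof (rule Ck_on_SucI[OF assms(1)])
    show "(\<lambda>x. flat_exp m (f x)) differentiable at x" if "x \<in> U" for x
      using differentiable_compose_real[OF c(1)[OF that] flat_exp_has_derivative] .
    show "partial_deriv i (\<lambda>x. flat_exp m (f x)) x
       = (flat_exp (m + 2) (f x) + (- real m) * flat_exp (m + 1) (f x)) * partial_deriv i f x"
      if "x \<in> U" for x i
      using partial_deriv_compose[OF c(1)[OF that] flat_exp_has_derivative] by simp
    show "Ck_on k (\<lambda>x. (flat_exp (m + 2) (f x) + (- real m) * flat_exp (m + 1) (f x))
       * partial_deriv i f x) U" for i
      by (intro Ck_on_mult Ck_on_add Ck_on_const IH c(2) assms(1))
  qed
qed

text \<open>Used for the derivative of \<open>exp (-1/s)\<close>, to bound the gradients of the cutoffs built from it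
  uniformly in their parameters.\<close>
lemma flat_exp_bounded: "\<exists>C. \<forall>s\<le>1. flat_exp m s \<le> C"
proof -
  have "continuous_on {0..1} (flat_exp m)"
    using flat_exp_has_derivative DERIV_isCont by (intro continuous_at_imp_continuous_on) blast
  then have "bounded (flat_exp m ` {0..1})"
    by (intro compact_imp_bounded compact_continuous_image) auto
  then obtain C where C: "\<forall>y\<in>flat_exp m ` {0..1}. norm y \<le> C" unfolding bounded_iff by blast
  have "flat_exp m s \<le> C" if "s \<le> 1" for s
  proof (cases "s \<le> 0")
    case True
    then have "flat_exp m s = flat_exp m 0" by (simp add: flat_exp_def)
    moreover have "norm (flat_exp m 0) \<le> C" by (intro C[rule_format] imageI) auto
    ultimately show ?thesis by simp
  next
    case False
    then have "norm (flat_exp m s) \<le> C" using C that by (intro C[rule_format] imageI) auto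
    then show ?thesis by simp
  qed
  then show ?thesis by blast
qed

section \<open>Smooth cutoff functions\<close>

definition smooth_step :: "real \<Rightarrow> real" where
  "smooth_step s = flat_exp 0 s * inverse (flat_exp 0 s + flat_exp 0 (1 - s))"

lemma smooth_step_denom_pos: "0 < flat_exp 0 s + flat_exp 0 (1 - s)"
  using flat_exp_pos[of s 0] flat_exp_pos[of "1 - s" 0] flat_exp_nonneg[of 0 s] flat_exp_nonneg[of 0 "1 - s"]
  by (cases "s > 0") auto

lemma smooth_step_eq_0: "s \<le> 0 \<Longrightarrow> smooth_step s = 0"
  by (simp add: smooth_step_def flat_exp_def)

lemma smooth_step_eq_1: "1 \<le> s \<Longrightarrow> smooth_step s = 1"
  by (simp add: smooth_step_def flat_exp_def)

lemma smooth_step_nonneg: "0 \<le> smooth_step s"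
  using smooth_step_denom_pos[of s] flat_exp_nonneg[of 0 s] by (simp add: smooth_step_def)

lemma smooth_step_le_1: "smooth_step s \<le> 1"
  using smooth_step_denom_pos[of s] flat_exp_nonneg[of 0 "1 - s"]
  by (simp add: smooth_step_def divide_inverse[symmetric])

lemma Ck_on_smooth_step:
  assumes "open U" "Ck_on k f U"
  shows "Ck_on k (\<lambda>x. smooth_step (f x)) U"
proof -
  have "Ck_on k (\<lambda>x. 1 + (-1) * f x) U"
    by (intro Ck_on_add Ck_on_mult Ck_on_const assms)
  then have "Ck_on k (\<lambda>x. flat_exp 0 (f x) * inverse (flat_exp 0 (f x) + flat_exp 0 (1 + (-1) * f x))) U"
    using smooth_step_denom_pos
    by (intro Ck_on_add Ck_on_mult Ck_on_inverse Ck_on_flat_exp Ck_on_const assms) (auto simp: less_imp_neq[symmetric])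
  then show ?thesis by (simp add: smooth_step_def)
qed

lemma Ck_on_sum:
  assumes "open U" "finite I" "\<And>j. j \<in> I \<Longrightarrow> Ck_on k (f j) U"
  shows "Ck_on k (\<lambda>x. \<Sum>j\<in>I. f j x) U"
  using assms(2,3)
  by (induction I rule: finite_induct) (auto intro!: Ck_on_add assms(1) simp: Ck_on_const)

lemma Ck_on_norm_diff_sq: "Ck_on k (\<lambda>y::real^'n. (norm (y - x))\<^sup>2) UNIV"
proof -
  have "(norm (y - x))\<^sup>2 = (\<Sum>i\<in>UNIV. (y $ i + - x $ i) * (y $ i + - x $ i))" for y
    by (simp add: power2_norm_eq_inner inner_vec_def)
  moreover have "Ck_on k (\<lambda>y. \<Sum>i\<in>UNIV. (y $ i + - x $ i) * (y $ i + - x $ i)) UNIV"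
    by (intro Ck_on_sum Ck_on_mult Ck_on_add Ck_on_const Ck_on_component) auto
  ultimately show ?thesis by simp
qed

lemma test_functionsI:
  assumes "\<And>k. Ck_on k \<phi> UNIV" "compact K" "K \<subseteq> U" "\<And>x. x \<notin> K \<Longrightarrow> \<phi> x = 0"
  shows "\<phi> \<in> test_functions U"
proof -
  have "closure {x. \<phi> x \<noteq> 0} \<subseteq> K"
    using assms(2,4) by (intro closure_minimal compact_imp_closed) auto
  moreover from this have "compact (closure {x. \<phi> x \<noteq> 0})"
    using compact_Int_closed[OF assms(2) closed_closure] by (metis inf.absorb2)
  ultimately show ?thesis using assms unfolding test_functions_def by auto
qed

lemma test_functionsE:
  assumes "\<phi> \<in> test_functions U"
  obtains K where "compact K" "K \<subseteq> U" "\<And>x. x \<notin> K \<Longrightarrow> \<phi> x = 0" "\<And>k. Ck_on k \<phi> UNIV"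
  using assms that[of "closure {x. \<phi> x \<noteq> 0}"] closure_subset[of "{x. \<phi> x \<noteq> 0}"]
  unfolding test_functions_def by blast

lemma test_functions_smooth: "\<phi> \<in> test_functions U \<Longrightarrow> Ck_on k \<phi> UNIV"
  by (simp add: test_functions_def)

lemma test_functions_outside:
  assumes "\<phi> \<in> test_functions U" "x \<notin> U"
  shows "\<phi> x = 0"
proof (rule ccontr)
  assume "\<phi> x \<noteq> 0"
  then have "x \<in> closure {x. \<phi> x \<noteq> 0}"
    by (intro subsetD[OF closure_subset]) simp
  then show False using assms by (auto simp: test_functions_def)
qed

lemma test_functions_mono: "\<phi> \<in> test_functions U \<Longrightarrow> U \<subseteq> V \<Longrightarrow> \<phi> \<in> test_functions V"
  by (auto simp: test_functions_def)

lemma test_functions_add: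
  assumes "\<phi> \<in> test_functions U" "\<psi> \<in> test_functions U"
  shows "(\<lambda>x. \<phi> x + \<psi> x) \<in> test_functions U"
proof -
  obtain K where K: "compact K" "K \<subseteq> U" "\<And>x. x \<notin> K \<Longrightarrow> \<phi> x = 0" "\<And>k. Ck_on k \<phi> UNIV"
    using assms(1) by (elim test_functionsE) blast
  obtain L where L: "compact L" "L \<subseteq> U" "\<And>x. x \<notin> L \<Longrightarrow> \<psi> x = 0" "\<And>k. Ck_on k \<psi> UNIV"
    using assms(2) by (elim test_functionsE) blast
  show ?thesis
    by (rule test_functionsI[where K = "K \<union> L"]) (use K L in \<open>auto intro!: Ck_on_add\<close>)
qed

lemma test_functions_smooth_mult:
  assumes "\<phi> \<in> test_functions U" "\<And>k. Ck_on k w UNIV"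
  shows "(\<lambda>x. w x * \<phi> x) \<in> test_functions U"
proof -
  obtain K where K: "compact K" "K \<subseteq> U" "\<And>x. x \<notin> K \<Longrightarrow> \<phi> x = 0" "\<And>k. Ck_on k \<phi> UNIV"
    using assms(1) by (elim test_functionsE) blast
  show ?thesis
    by (rule test_functionsI[where K = K]) (use K assms(2) in \<open>auto intro!: Ck_on_mult\<close>)
qed

lemma test_functions_cmult:
  "\<phi> \<in> test_functions U \<Longrightarrow> (\<lambda>x. a * \<phi> x) \<in> test_functions U"
  by (rule test_functions_smooth_mult) (simp_all add: Ck_on_const)

lemma test_functions_sum:
  assumes "finite I" "\<And>j. j \<in> I \<Longrightarrow> f j \<in> test_functions U"
  shows "(\<lambda>x. \<Sum>j\<in>I. f j x) \<in> test_functions U"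
  using assms
proof (induction I rule: finite_induct)
  case empty
  show ?case by (rule test_functionsI[where K = "{}"]) (auto simp: Ck_on_const)
qed (auto intro: test_functions_add)

text \<open>Finitely many balls contained in \<open>V\<close> have concentric balls covering \<open>K\<close>, each with a bump
  equal to one on the smaller ball. The sum of the bumps is at least one on the cover, and a second
  smooth step flattens it to one there.\<close>
lemma smooth_cutoff_exists:
  fixes K V :: "(real ^ 'n) set"
  assumes "compact K" "open V" "K \<subseteq> V"
  obtains \<zeta> N where "\<zeta> \<in> test_functions V" "\<And>x. 0 \<le> \<zeta> x" "\<And>x. \<zeta> x \<le> 1"
    "open N" "K \<subseteq> N" "\<And>x. x \<in> N \<Longrightarrow> \<zeta> x = 1"
proof -
  have "\<forall>x\<in>K. \<exists>r>0. cball x r \<subseteq> V"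
    using assms open_contains_cball by (metis subsetD)
  then obtain r where r: "\<And>x. x \<in> K \<Longrightarrow> 0 < r x" "\<And>x. x \<in> K \<Longrightarrow> cball x (r x) \<subseteq> V"
    by metis
  obtain F where F: "F \<subseteq> K" "finite F" "K \<subseteq> (\<Union>x\<in>F. ball x (r x / 2))"
  proof (rule compactE_image[OF assms(1), of K "\<lambda>x. ball x (r x / 2)"])
    show "K \<subseteq> (\<Union>x\<in>K. ball x (r x / 2))"
      using r(1) by (auto intro!: bexI)
  qed auto
  define s where "s x y = 2 + (- 2 / (r x)\<^sup>2) * (norm (y - x))\<^sup>2" for x y
  define \<zeta> where "\<zeta> y = smooth_step (\<Sum>x\<in>F. smooth_step (s x y))" for y
  have far: "smooth_step (s x y) = 0" if "x \<in> F" "y \<notin> cball x (r x)" for x y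
  proof -
    have rx: "0 < r x" using r(1) F(1) that(1) by blast
    have "r x \<le> norm (y - x)" using that(2) by (simp add: dist_norm norm_minus_commute)
    then have "(r x)\<^sup>2 \<le> (norm (y - x))\<^sup>2" using rx by (intro power_mono) auto
    then show ?thesis using rx by (intro smooth_step_eq_0) (simp add: s_def field_simps)
  qed
  have near: "smooth_step (s x y) = 1" if "x \<in> F" "y \<in> ball x (r x / 2)" for x y
  proof -
    have rx: "0 < r x" using r(1) F(1) that(1) by blast
    have "norm (y - x) \<le> r x / 2" using that(2) by (simp add: dist_norm norm_minus_commute)
    then have "(norm (y - x))\<^sup>2 \<le> (r x / 2)\<^sup>2" by (intro power_mono) auto
    then have "4 * (norm (y - x))\<^sup>2 \<le> (r x)\<^sup>2" by (simp add: power_divide)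
    moreover have "0 < (r x)\<^sup>2" using rx by simp
    moreover have "2 * (norm (y - x))\<^sup>2 \<le> 4 * (norm (y - x))\<^sup>2" by simp
    ultimately have "(2 / (r x)\<^sup>2) * (norm (y - x))\<^sup>2 \<le> 1"
      by (simp only: pos_divide_le_eq times_divide_eq_left)
    then show ?thesis
      by (intro smooth_step_eq_1) (simp add: s_def)
  qed
  show thesis
  proof (rule that[of \<zeta> "\<Union>x\<in>F. ball x (r x / 2)"])
    show "\<zeta> \<in> test_functions V"
    proof (rule test_functionsI[where K = "\<Union>x\<in>F. cball x (r x)"])
      show "Ck_on k \<zeta> UNIV" for k
        unfolding \<zeta>_def[abs_def] s_def
        by (intro Ck_on_smooth_step Ck_on_sum Ck_on_add Ck_on_mult Ck_on_const Ck_on_norm_diff_sq F)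
          auto
      show "compact (\<Union>x\<in>F. cball x (r x))" using F by (intro compact_UN) auto
      show "(\<Union>x\<in>F. cball x (r x)) \<subseteq> V" using r F by blast
      show "\<zeta> y = 0" if "y \<notin> (\<Union>x\<in>F. cball x (r x))" for y
        unfolding \<zeta>_def using far that by (intro smooth_step_eq_0) auto
    qed
    show "\<zeta> y = 1" if y: "y \<in> (\<Union>x\<in>F. ball x (r x / 2))" for y
    proof -
      from y obtain x where x: "x \<in> F" "y \<in> ball x (r x / 2)" by blast
      have "smooth_step (s x y) \<le> (\<Sum>x\<in>F. smooth_step (s x y))"
        using F x(1) smooth_step_nonneg by (intro member_le_sum) auto
      then show ?thesis unfolding \<zeta>_def using near[OF x] by (intro smooth_step_eq_1) simp
    qed
  qed (use F in \<open>auto simp: \<zeta>_def smooth_step_nonneg smooth_step_le_1\<close>)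
qed

section \<open>The Riesz representation of positive functionals on test functions\<close>

locale positive_functional =
  fixes U :: "(real ^ 'n) set" and T :: "(real ^ 'n \<Rightarrow> real) \<Rightarrow> real"
  assumes open_U: "open U"
    and T_add: "\<And>\<phi> \<psi>. \<phi> \<in> test_functions U \<Longrightarrow> \<psi> \<in> test_functions U \<Longrightarrow> T (\<lambda>x. \<phi> x + \<psi> x) = T \<phi> + T \<psi>"
    and T_cmult: "\<And>a \<phi>. \<phi> \<in> test_functions U \<Longrightarrow> T (\<lambda>x. a * \<phi> x) = a * T \<phi>"
    and T_nonneg: "\<And>\<phi>. \<phi> \<in> test_functions U \<Longrightarrow> (\<And>x. 0 \<le> \<phi> x) \<Longrightarrow> 0 \<le> T \<phi>"
begin

lemma T_mono:
  assumes "\<phi> \<in> test_functions U" "\<psi> \<in> test_functions U" "\<And>x. \<phi> x \<le> \<psi> x"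
  shows "T \<phi> \<le> T \<psi>"
proof -
  have m: "(\<lambda>x. (-1) * \<phi> x) \<in> test_functions U"
    by (rule test_functions_cmult[OF assms(1)])
  have "0 \<le> T (\<lambda>x. \<psi> x + (-1) * \<phi> x)"
    using assms(3) by (intro T_nonneg test_functions_add[OF assms(2) m]) simp
  also have "\<dots> = T \<psi> - T \<phi>"
    using T_add[OF assms(2) m] T_cmult[OF assms(1), of "-1"] by simp
  finally show ?thesis by simp
qed

lemma T_zero: "T (\<lambda>x. 0) = 0"
proof -
  have "(\<lambda>x. 0) \<in> test_functions U"
    by (rule test_functionsI[where K = "{}"]) (auto simp: Ck_on_const)
  from T_cmult[OF this, of 0] show ?thesis by simp
qed

lemma T_sum:
  assumes "finite I" "\<And>j. j \<in> I \<Longrightarrow> f j \<in> test_functions U"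
  shows "T (\<lambda>x. \<Sum>j\<in>I. f j x) = (\<Sum>j\<in>I. T (f j))"
  using assms
proof (induction I rule: finite_induct)
  case empty
  then show ?case by (simp add: T_zero)
next
  case (insert a I)
  have "T (\<lambda>x. f a x + (\<Sum>j\<in>I. f j x)) = T (f a) + T (\<lambda>x. \<Sum>j\<in>I. f j x)"
    using insert by (intro T_add test_functions_sum) auto
  then show ?case using insert by simp
qed

definition below :: "(real ^ 'n) set \<Rightarrow> (real ^ 'n \<Rightarrow> real) set" where
  "below V = {\<phi> \<in> test_functions (V \<inter> U). \<forall>x. 0 \<le> \<phi> x \<and> \<phi> x \<le> 1}"

text \<open>On open sets this is the value that a measure representing \<open>T\<close> has to take, by inner
  approximation of the indicator.\<close>
definition content :: "(real ^ 'n) set \<Rightarrow> ennreal" where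
  "content V = (SUP \<phi>\<in>below V. ennreal (T \<phi>))"

definition outer :: "(real ^ 'n) set \<Rightarrow> ennreal" where
  "outer A = (INF V\<in>{V. open V \<and> A \<subseteq> V}. content V)"

lemma below_test: "\<phi> \<in> below V \<Longrightarrow> \<phi> \<in> test_functions U"
  unfolding below_def by (auto intro: test_functions_mono[where U = "V \<inter> U"])

lemma zero_below: "(\<lambda>x. 0) \<in> below V"
  unfolding below_def by (auto intro!: test_functionsI[where K = "{}"] simp: Ck_on_const)

lemma content_upper: "\<phi> \<in> below V \<Longrightarrow> ennreal (T \<phi>) \<le> content V"
  unfolding content_def by (rule SUP_upper)

lemma below_mono: "V \<subseteq> W \<Longrightarrow> below V \<subseteq> below W"
  unfolding below_def by (auto intro: test_functions_mono[where U = "V \<inter> U"])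

lemma content_mono: "V \<subseteq> W \<Longrightarrow> content V \<le> content W"
  unfolding content_def by (intro SUP_subset_mono below_mono) auto

lemma content_empty: "content {} = 0"
proof -
  have "\<phi> = (\<lambda>x. 0)" if "\<phi> \<in> below {}" for \<phi>
    using that test_functions_outside[of \<phi> "{}"] by (auto simp: below_def fun_eq_iff)
  with zero_below[of "{}"] have "below {} = {\<lambda>x. 0}" by blast
  then show ?thesis by (simp add: content_def T_zero)
qed

text \<open>A test function \<open>\<phi>\<close> below \<open>V \<union> W\<close> is split with a cutoff \<open>\<zeta>\<close> supported in \<open>V\<close> and equal
  to one near the part of the support of \<open>\<phi>\<close> outside \<open>W\<close>: then \<open>\<zeta>\<phi>\<close> is below \<open>V\<close> and
  \<open>(1 - \<zeta>)\<phi>\<close> is below \<open>W\<close>.\<close>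
lemma content_Un:
  assumes "open V" "open W"
  shows "content (V \<union> W) \<le> content V + content W"
  unfolding content_def[of "V \<union> W"]
proof (rule SUP_least)
  fix \<phi> assume \<phi>: "\<phi> \<in> below (V \<union> W)"
  then have \<phi>t: "\<phi> \<in> test_functions ((V \<union> W) \<inter> U)" and \<phi>01: "\<And>x. 0 \<le> \<phi> x" "\<And>x. \<phi> x \<le> 1"
    by (auto simp: below_def)
  obtain K where K: "compact K" "K \<subseteq> (V \<union> W) \<inter> U" "\<And>x. x \<notin> K \<Longrightarrow> \<phi> x = 0" "\<And>k. Ck_on k \<phi> UNIV"
    using \<phi>t by (elim test_functionsE) blast
  have "compact (K - W)" using K(1) assms(2) by (rule compact_diff)
  moreover have "K - W \<subseteq> V \<inter> U" using K(2) by auto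
  ultimately obtain \<zeta> N where z: "\<zeta> \<in> test_functions (V \<inter> U)" "\<And>x. 0 \<le> \<zeta> x" "\<And>x. \<zeta> x \<le> 1"
    "open N" "K - W \<subseteq> N" "\<And>x. x \<in> N \<Longrightarrow> \<zeta> x = 1"
    using smooth_cutoff_exists[of "K - W" "V \<inter> U"] assms(1) open_U by blast
  have zs: "Ck_on k (\<lambda>x. 1 + (-1) * \<zeta> x) UNIV" for k
    by (intro Ck_on_add Ck_on_mult Ck_on_const test_functions_smooth[OF z(1)]) auto
  define \<phi>1 where "\<phi>1 x = \<phi> x * \<zeta> x" for x
  define \<phi>2 where "\<phi>2 x = (1 + (-1) * \<zeta> x) * \<phi> x" for x
  have "\<phi>1 \<in> test_functions (V \<inter> U)"
    unfolding \<phi>1_def[abs_def] using z(1) K(4) by (rule test_functions_smooth_mult)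
  then have 1: "\<phi>1 \<in> below V"
    using \<phi>01 z(2,3) by (auto simp: below_def \<phi>1_def mult_le_one)
  have "\<phi>2 \<in> test_functions (W \<inter> U)"
  proof (rule test_functionsI[where K = "K - N"])
    show "Ck_on k \<phi>2 UNIV" for k
      unfolding \<phi>2_def[abs_def] using zs K(4) by (intro Ck_on_mult) auto
    show "compact (K - N)" using K(1) z(4) by (rule compact_diff)
    show "K - N \<subseteq> W \<inter> U" using K(2) z(5) by blast
    show "\<phi>2 x = 0" if "x \<notin> K - N" for x using that K(3) z(6) by (auto simp: \<phi>2_def)
  qed
  then have 2: "\<phi>2 \<in> below W"
    using \<phi>01 z(2,3) by (auto simp: below_def \<phi>2_def mult_le_one)
  have "T \<phi> = T (\<lambda>x. \<phi>1 x + \<phi>2 x)"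
    by (rule arg_cong[of _ _ T]) (auto simp: \<phi>1_def \<phi>2_def algebra_simps)
  also have "\<dots> = T \<phi>1 + T \<phi>2" using 1 2 by (intro T_add below_test)
  finally have "ennreal (T \<phi>) = ennreal (T \<phi>1) + ennreal (T \<phi>2)"
    using T_nonneg[OF below_test[OF 1]] T_nonneg[OF below_test[OF 2]] 1 2
    by (auto simp: below_def ennreal_plus)
  also have "\<dots> \<le> content V + content W"
    by (intro add_mono content_upper 1 2)
  finally show "ennreal (T \<phi>) \<le> content V + content W" .
qed

text \<open>The compact support of a test function is covered by finitely many of the sets, which reduces the claim to finite unions.\<close>
lemma content_UN:
  fixes V :: "nat \<Rightarrow> (real ^ 'n) set"
  assumes "\<And>i. open (V i)"
  shows "content (\<Union>i. V i) \<le> (\<Sum>i. content (V i))"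
  unfolding content_def[of "\<Union>i. V i"]
proof (rule SUP_least)
  fix \<phi> assume "\<phi> \<in> below (\<Union>i. V i)"
  then have \<phi>t: "\<phi> \<in> test_functions ((\<Union>i. V i) \<inter> U)" and \<phi>01: "\<And>x. 0 \<le> \<phi> x" "\<And>x. \<phi> x \<le> 1"
    by (auto simp: below_def)
  obtain K where K: "compact K" "K \<subseteq> (\<Union>i. V i) \<inter> U" "\<And>x. x \<notin> K \<Longrightarrow> \<phi> x = 0" "\<And>k. Ck_on k \<phi> UNIV"
    using \<phi>t by (elim test_functionsE) blast
  obtain I where I: "finite I" "K \<subseteq> (\<Union>i\<in>I. V i)"
  proof (rule compactE_image[OF K(1), of UNIV V])
    show "K \<subseteq> (\<Union>i. V i)" using K(2) by simp
  qed (use assms in auto)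
  obtain n where n: "I \<subseteq> {..<n}"
    using I(1) unfolding finite_nat_iff_bounded by (elim exE)
  have "\<phi> \<in> test_functions ((\<Union>i<n. V i) \<inter> U)"
  proof (rule test_functionsI[OF K(4,1)])
    have "(\<Union>i\<in>I. V i) \<subseteq> (\<Union>i<n. V i)" using n by (rule UN_mono) simp
    with I(2) have "K \<subseteq> (\<Union>i<n. V i)" by (rule order_trans)
    then show "K \<subseteq> (\<Union>i<n. V i) \<inter> U" using K(2) by simp
  qed (use K(3) in auto)
  then have "ennreal (T \<phi>) \<le> content (\<Union>i<n. V i)"
    using \<phi>01 by (intro content_upper) (auto simp: below_def)
  also have "\<dots> \<le> (\<Sum>i<n. content (V i))"
  proof (induction n)
    case (Suc n)
    have "content (\<Union>i<Suc n. V i) \<le> content (\<Union>i<n. V i) + content (V n)"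
      unfolding lessThan_Suc UN_insert Un_commute[of "V n"] by (intro content_Un open_UN ballI assms)
    also have "\<dots> \<le> (\<Sum>i<n. content (V i)) + content (V n)"
      by (rule add_right_mono[OF Suc.IH])
    finally show ?case by simp
  qed (simp add: content_empty)
  also have "\<dots> \<le> (\<Sum>i. content (V i))"
    by (intro sum_le_suminf summableI) simp_all
  finally show "ennreal (T \<phi>) \<le> (\<Sum>i. content (V i))" .
qed

lemma outer_le_content: "open V \<Longrightarrow> A \<subseteq> V \<Longrightarrow> outer A \<le> content V"
  unfolding outer_def by (rule INF_lower) auto

lemma outer_open: "open V \<Longrightarrow> outer V = content V"
  unfolding outer_def by (intro antisym INF_lower INF_greatest content_mono) simp_all

lemma outer_mono: "A \<subseteq> B \<Longrightarrow> outer A \<le> outer B"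
  unfolding outer_def by (rule INF_superset_mono) auto

lemma outer_measure_outer: "outer_measure_space (Pow UNIV) outer"
proof -
  have "outer {} = 0" by (simp add: outer_open content_empty)
  moreover have "outer (\<Union>i. A i) \<le> (\<Sum>i. outer (A i))" for A :: "nat \<Rightarrow> (real ^ 'n) set"
  proof (rule ennreal_le_epsilon)
    fix e :: real assume e: "0 < e" and fin: "(\<Sum>i. outer (A i)) < top"
    have "\<exists>V. open V \<and> A i \<subseteq> V \<and> content V \<le> outer (A i) + e * (1/2) ^ Suc i" for i
    proof -
      have "outer (A i) \<noteq> \<infinity>"
        using fin by (auto simp: less_top dest!: ennreal_suminf_lessD)
      then obtain V where "V \<in> {V. open V \<and> A i \<subseteq> V}" "content V < outer (A i) + e * (1/2) ^ Suc i"
        using INF_approx_ennreal[of "e * (1/2) ^ Suc i" "outer (A i)"] e outer_def by force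
      then show ?thesis by (auto intro: less_imp_le)
    qed
    then obtain V where V: "\<And>i. open (V i)" "\<And>i. A i \<subseteq> V i"
      "\<And>i. content (V i) \<le> outer (A i) + e * (1/2) ^ Suc i"
      by metis
    have "outer (\<Union>i. A i) \<le> content (\<Union>i. V i)"
      using V(1,2) by (intro outer_le_content) blast+
    also have "\<dots> \<le> (\<Sum>i. content (V i))" by (rule content_UN[OF V(1)])
    also have "\<dots> \<le> (\<Sum>i. outer (A i) + e * (1/2) ^ Suc i)"
      using V(3) by (intro suminf_le) auto
    also have "\<dots> = (\<Sum>n. outer (A n)) + (\<Sum>n. ennreal e * ennreal ((1/2) ^ Suc n))"
      using e by (subst suminf_add[symmetric])
                       (auto simp del: ennreal_suminf_cmult simp add: ennreal_mult[symmetric])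
    also have "\<dots> = (\<Sum>n. outer (A n)) + e"
      unfolding ennreal_suminf_cmult
      by (subst suminf_ennreal_eq[OF zero_le_power power_half_series]) auto
    finally show "outer (\<Union>i. A i) \<le> (\<Sum>i. outer (A i)) + e" .
  qed
  ultimately show ?thesis
    unfolding outer_measure_space_def positive_def increasing_def countably_subadditive_def
    by (intro conjI ballI allI impI outer_mono) assumption+
qed

text \<open>If \<open>\<phi>\<close> is almost optimal for the part of an open set inside \<open>V\<close> and \<open>\<psi>\<close> is almost optimal
  for the complement of the support of \<open>\<phi>\<close>, then the supports are disjoint and \<open>\<phi> + \<psi>\<close> is
  still bounded by one. This is what makes open sets Caratheodory measurable.\<close>
lemma outer_split_open:
  assumes V: "open V"
  shows "outer (V \<inter> A) + outer (A - V) \<le> outer A"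
  unfolding outer_def[of A]
proof (rule INF_greatest)
  fix O' assume "O' \<in> {V. open V \<and> A \<subseteq> V}"
  then have O': "open O'" "A \<subseteq> O'" by auto
  have "outer (V \<inter> A) + outer (A - V) \<le> content (V \<inter> O') + outer (O' - V)"
    using V O' by (intro add_mono outer_le_content outer_mono) auto
  also have "\<dots> = (SUP \<phi>\<in>below (V \<inter> O'). ennreal (T \<phi>) + outer (O' - V))"
    unfolding content_def using zero_below by (intro ennreal_SUP_add_left[symmetric]) auto
  also have "\<dots> \<le> content O'"
  proof (rule SUP_least)
    fix \<phi> assume \<phi>: "\<phi> \<in> below (V \<inter> O')"
    then have \<phi>t: "\<phi> \<in> test_functions (V \<inter> O' \<inter> U)" and \<phi>01: "\<And>x. 0 \<le> \<phi> x" "\<And>x. \<phi> x \<le> 1"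
      by (auto simp: below_def)
    obtain K where K: "compact K" "K \<subseteq> V \<inter> O' \<inter> U" "\<And>x. x \<notin> K \<Longrightarrow> \<phi> x = 0" "\<And>k. Ck_on k \<phi> UNIV"
      using \<phi>t by (elim test_functionsE) blast
    have "outer (O' - V) \<le> content (O' - K)"
      using K(1,2) O'(1) by (intro outer_le_content open_Diff compact_imp_closed) auto
    then have "ennreal (T \<phi>) + outer (O' - V) \<le> content (O' - K) + ennreal (T \<phi>)"
      by (simp add: add.commute add_left_mono)
    also have "\<dots> = (SUP \<psi>\<in>below (O' - K). ennreal (T \<psi>) + ennreal (T \<phi>))"
      unfolding content_def using zero_below by (intro ennreal_SUP_add_left[symmetric]) auto
    also have "\<dots> \<le> content O'"
    proof (rule SUP_least)
      fix \<psi> assume \<psi>: "\<psi> \<in> below (O' - K)"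
      then have \<psi>t: "\<psi> \<in> test_functions ((O' - K) \<inter> U)" and \<psi>01: "\<And>x. 0 \<le> \<psi> x" "\<And>x. \<psi> x \<le> 1"
        by (auto simp: below_def)
      have "\<psi> x = 0" if "x \<in> K" for x
        using that by (intro test_functions_outside[OF \<psi>t]) simp
      then have le: "\<psi> x + \<phi> x \<le> 1" for x
        using K(3) \<phi>01 \<psi>01 by (cases "x \<in> K") auto
      have "(\<lambda>x. \<psi> x + \<phi> x) \<in> test_functions (O' \<inter> U)"
        using \<psi>t \<phi>t by (intro test_functions_add) (auto elim: test_functions_mono)
      then have "(\<lambda>x. \<psi> x + \<phi> x) \<in> below O'"
        using le \<phi>01 \<psi>01 by (auto simp: below_def)
      from content_upper[OF this] show "ennreal (T \<psi>) + ennreal (T \<phi>) \<le> content O'"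
        using T_add[OF below_test[OF \<psi>] below_test[OF \<phi>]] T_nonneg[OF below_test[OF \<psi>]]
          T_nonneg[OF below_test[OF \<phi>]] \<phi>01 \<psi>01
        by (simp add: ennreal_plus)
    qed
    finally show "ennreal (T \<phi>) + outer (O' - V) \<le> content O'" .
  qed
  finally show "outer (V \<inter> A) + outer (A - V) \<le> content O'" .
qed

lemma borel_measure_exists:
  obtains \<nu> where "sets \<nu> = sets borel" "\<And>V. open V \<Longrightarrow> emeasure \<nu> V = content V"
proof -
  define L where "L = lambda_system UNIV (Pow UNIV) outer"
  interpret P: sigma_algebra UNIV "Pow UNIV :: (real ^ 'n) set set" by (rule sigma_algebra_Pow)
  have ms: "measure_space UNIV L outer"
    unfolding L_def by (rule P.caratheodory_lemma[OF outer_measure_outer])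
  have "V \<in> L" if V: "open V" for V
  proof -
    have "outer (V \<inter> A) + outer (A - V) = outer A" for A
    proof (rule antisym[OF outer_split_open[OF V]])
      have "subadditive (Pow UNIV) outer"
        using P.countably_subadditive_subadditive[of outer] outer_measure_outer
        by (auto simp: outer_measure_space_def)
      then have "outer ((V \<inter> A) \<union> (A - V)) \<le> outer (V \<inter> A) + outer (A - V)"
        by (rule subadditiveD) auto
      moreover have "(V \<inter> A) \<union> (A - V) = A" by blast
      ultimately show "outer A \<le> outer (V \<inter> A) + outer (A - V)" by simp
    qed
    moreover have "(UNIV - V) \<inter> A = A - V" for A by blast
    ultimately show ?thesis by (simp add: L_def lambda_system_def)
  qed
  then have "{S. open S} \<subseteq> L" by blast
  moreover have sL: "sigma_algebra UNIV L" using ms by (simp add: measure_space_def)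
  ultimately have sub: "sets borel \<subseteq> L"
    using sigma_algebra.sigma_sets_subset[OF sL] by (simp add: borel_def)
  define \<nu> where "\<nu> = measure_of UNIV (sets borel) outer"
  have "measure_space UNIV (sets borel) outer"
    using ms sub sets.sigma_algebra_axioms[of "borel :: (real ^ 'n) measure"]
    by (auto simp: measure_space_def positive_def countably_additive_def)
  have s: "sets \<nu> = sets borel"
    unfolding \<nu>_def by (metis sets.sets_measure_of_eq space_borel)
  moreover have "emeasure \<nu> V = content V" if "open V" for V
  proof -
    have "emeasure \<nu> V = outer V"
      unfolding \<nu>_def
      by (rule emeasure_measure_of_sigma)
        (use \<open>measure_space UNIV (sets borel) outer\<close> that in \<open>auto simp: measure_space_def\<close>)
    then show ?thesis using outer_open[OF that] by simp
  qed
  ultimately show thesis by (rule that)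
qed

lemma content_le:
  assumes "\<psi> \<in> test_functions U" "\<And>x. 0 \<le> \<psi> x" "\<And>x. x \<in> V \<Longrightarrow> 1 \<le> \<psi> x"
  shows "content V \<le> ennreal (T \<psi>)"
  unfolding content_def
proof (rule SUP_least)
  fix \<phi> assume \<phi>: "\<phi> \<in> below V"
  then have \<phi>01: "\<And>x. \<phi> x \<le> 1" and \<phi>t: "\<phi> \<in> test_functions (V \<inter> U)" by (auto simp: below_def)
  have "\<phi> x \<le> \<psi> x" for x
  proof (cases "x \<in> V")
    case False
    then have "\<phi> x = 0"
      by (intro test_functions_outside[OF \<phi>t]) simp
    then show ?thesis using assms(2) by simp
  qed (use assms(3) \<phi>01 in \<open>force intro: order_trans\<close>)
  then show "ennreal (T \<phi>) \<le> ennreal (T \<psi>)"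
    by (intro ennreal_leI T_mono below_test[OF \<phi>] assms(1))
qed

end

text \<open>Any layers that switch from zero to one while \<open>t\<close> crosses the unit interval with number
  \<open>k\<close> add up to \<open>t\<close>, up to an error of one; this covers smooth steps and indicators alike.\<close>
lemma sum_steps_bounds:
  fixes a :: "nat \<Rightarrow> real"
  assumes "0 \<le> t" "t \<le> real N" "\<And>k. 0 \<le> a k" "\<And>k. a k \<le> 1"
    "\<And>k. t \<le> real k \<Longrightarrow> a k = 0" "\<And>k. real k + 1 \<le> t \<Longrightarrow> a k = 1"
  shows "t - 1 \<le> (\<Sum>k<N. a k)" "(\<Sum>k<N. a k) \<le> t + 1"
proof -
  define n where "n = nat \<lfloor>t\<rfloor>"
  have n: "real n \<le> t" "t < real n + 1" using assms(1) by (auto simp: n_def)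
  then have nN: "n \<le> N" using assms(2) by linarith
  have "t - 1 \<le> real n" using n by simp
  also have "\<dots> = (\<Sum>k<n. a k)" using assms(6) n by (subst sum.cong[of _ _ _ "\<lambda>_. 1"]) auto
  also have "\<dots> \<le> (\<Sum>k<N. a k)" using assms(3) nN by (intro sum_mono2) auto
  finally show "t - 1 \<le> (\<Sum>k<N. a k)" .
  have "(\<Sum>k<N. a k) = (\<Sum>k\<in>{..<N} \<inter> {..n}. a k)"
  proof (rule sum.mono_neutral_right)
    show "\<forall>k\<in>{..<N} - {..<N} \<inter> {..n}. a k = 0"
      using n(2) by (intro ballI assms(5)) auto
  qed auto
  also have "\<dots> \<le> (\<Sum>k\<le>n. a k)" using assms(3) by (intro sum_mono2) auto
  also have "\<dots> \<le> (\<Sum>k\<le>n. 1)" using assms(4) by (intro sum_mono) auto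
  also have "\<dots> \<le> t + 1" using n by simp
  finally show "(\<Sum>k<N. a k) \<le> t + 1" .
qed

context positive_functional
begin

text \<open>Let \<open>F k\<close> be the set where \<open>\<phi>\<close> exceeds \<open>k e\<close>. Both \<open>\<phi>\<close> is within \<open>e\<close> of the sum of
  \<open>e\<close> times the indicators of the \<open>F k\<close>, and within \<open>e\<close> of the sum of \<open>e\<close> times smooth
  layers \<open>h k\<close> supported in \<open>F k\<close> and equal to one on \<open>F (k + 1)\<close>. Hence \<open>T (h k)\<close> lies between
  the measures of \<open>F (k + 1)\<close> and \<open>F k\<close>, and the two sums differ by at most one term.\<close>
lemma integral_eq_nonneg:
  assumes \<nu>: "sets \<nu> = sets borel" "\<forall>V. open V \<longrightarrow> emeasure \<nu> V = content V"
    and \<phi>: "\<phi> \<in> test_functions U" "\<And>x. 0 \<le> \<phi> x"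
  shows "integrable \<nu> \<phi>" "(\<integral>x. \<phi> x \<partial>\<nu>) = T \<phi>"
proof -
  have sp: "space \<nu> = UNIV" using sets_eq_imp_space_eq[OF \<nu>(1)] by simp
  have cont: "continuous_on UNIV \<phi>"
    using test_functions_smooth[OF \<phi>(1), of 0] by simp
  have open_level: "open {x. a < \<phi> x}" for a
    using open_Collect_less[OF continuous_on_const cont] by simp
  obtain K where K: "compact K" "K \<subseteq> U" "\<And>x. x \<notin> K \<Longrightarrow> \<phi> x = 0" "\<And>k. Ck_on k \<phi> UNIV"
    using \<phi>(1) by (elim test_functionsE) blast
  obtain \<zeta> N0 where z: "\<zeta> \<in> test_functions U" "\<And>x. 0 \<le> \<zeta> x" "\<And>x. \<zeta> x \<le> 1"
    "open N0" "K \<subseteq> N0" "\<And>x. x \<in> N0 \<Longrightarrow> \<zeta> x = 1"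
    using smooth_cutoff_exists[OF K(1) open_U K(2)] by blast
  have z1: "\<zeta> x = 1" if "\<phi> x \<noteq> 0" for x using K(3) z(5,6) that by blast
  have "compact (\<phi> ` K)"
    using K(1) cont by (intro compact_continuous_image) (auto intro: continuous_on_subset)
  then obtain C where C: "\<And>x. x \<in> K \<Longrightarrow> \<phi> x \<le> C"
    using compact_imp_bounded bounded_real by (metis abs_le_D1 imageI)
  have C': "\<phi> x \<le> max C 0" for x
    using C[of x] K(3)[of x] by (cases "x \<in> K") auto
  define G where "G = {x. 0 < \<phi> x}"
  have "content G \<le> ennreal (T \<zeta>)"
    using z(1,2) z1 by (intro content_le) (auto simp: G_def)
  then have G_fin: "emeasure \<nu> G \<le> ennreal (T \<zeta>)" using \<nu>(2) open_level by (simp add: G_def)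
  have meas: "\<phi> \<in> borel_measurable \<nu>"
    using borel_measurable_continuous_onI[OF cont] \<nu>(1) by (simp cong: measurable_cong_sets)
  have fin: "emeasure \<nu> {x. a < \<phi> x} < \<infinity>" if "0 \<le> a" for a
  proof -
    have "emeasure \<nu> {x. a < \<phi> x} \<le> emeasure \<nu> G"
      using that open_level \<nu>(1) by (intro emeasure_mono) (auto simp: G_def)
    then show ?thesis using G_fin by (auto simp: order.strict_iff_order top_unique)
  qed
  have Gm: "G \<in> sets \<nu>" using open_level \<nu>(1) by (simp add: G_def)
  show int: "integrable \<nu> \<phi>"
  proof (rule integrableI_bounded_set[where A = G and B = "max C 0"])
    show "emeasure \<nu> G < \<infinity>" using fin[of 0] by (simp add: G_def)
    show "AE x in \<nu>. x \<in> G \<longrightarrow> norm (\<phi> x) \<le> max C 0" using C' \<phi>(2) by simp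
    show "AE x in \<nu>. x \<notin> G \<longrightarrow> \<phi> x = 0"
    proof (rule AE_I2, rule impI)
      fix x assume "x \<notin> G"
      then show "\<phi> x = 0" using \<phi>(2)[of x] by (simp add: G_def)
    qed
  qed (use Gm meas in auto)
  have close: "\<bar>(\<integral>x. \<phi> x \<partial>\<nu>) - T \<phi>\<bar> \<le> e * (3 * T \<zeta>)" if e: "0 < e" for e
  proof -
    obtain N :: nat where N: "max C 0 / e \<le> real N" using real_arch_simple by blast
    have t: "0 \<le> \<phi> x / e" "\<phi> x / e \<le> real N" for x
      using \<phi>(2)[of x] e divide_right_mono[OF C'[of x], of e] N by auto
    define F where "F k = {x. real k * e < \<phi> x}" for k :: nat
    \<comment> \<open>The step starts only at half a layer, so that the support stays inside the open set
      \<open>F k\<close>.\<close>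
    define h where "h k x = smooth_step (2 / e * \<phi> x + (- 2 * real k - 1))" for k :: nat and x
    have h0: "h k x = 0" if "\<phi> x / e \<le> real k + 1/2" for k x
      unfolding h_def using that e by (intro smooth_step_eq_0) (simp add: field_simps)
    have h1: "h k x = 1" if "real k + 1 \<le> \<phi> x / e" for k x
      unfolding h_def using that e by (intro smooth_step_eq_1) (simp add: field_simps)
    have h01: "0 \<le> h k x" "h k x \<le> 1" for k x
      by (simp_all add: h_def smooth_step_nonneg smooth_step_le_1)
    have hsupp: "h k \<in> test_functions (F k \<inter> U)" for k
    proof (rule test_functionsI[where K = "K \<inter> {x. (real k + 1/2) * e \<le> \<phi> x}"])
      show "Ck_on j (h k) UNIV" for j
        unfolding h_def[abs_def]
        by (intro Ck_on_smooth_step Ck_on_add Ck_on_mult Ck_on_const K(4)) auto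
      show "compact (K \<inter> {x. (real k + 1/2) * e \<le> \<phi> x})"
        using K(1) closed_Collect_le[OF continuous_on_const cont] by (rule compact_Int_closed)
      show "K \<inter> {x. (real k + 1/2) * e \<le> \<phi> x} \<subseteq> F k \<inter> U"
        using K(2) e by (auto simp: F_def algebra_simps)
      show "h k x = 0" if "x \<notin> K \<inter> {x. (real k + 1/2) * e \<le> \<phi> x}" for x
      proof (cases "x \<in> K")
        case True
        then show ?thesis using that e by (intro h0) (auto simp: field_simps)
      next
        case False
        then show ?thesis using K(3) by (intro h0) auto
      qed
    qed
    have ht: "h k \<in> test_functions U" for k using test_functions_mono[OF hsupp Int_lower2] .
    have Fo: "open (F k)" for k unfolding F_def by (rule open_level)
    have Fm: "F k \<in> sets \<nu>" for k using Fo \<nu>(1) by simp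
    have Ff: "emeasure \<nu> (F k) < \<infinity>" for k unfolding F_def using e by (intro fin) simp
    define g where "g k = measure \<nu> (F k)" for k
    have g: "content (F k) = ennreal (g k)" for k
      using emeasure_eq_ennreal_measure[of \<nu> "F k"] Ff[of k] \<nu>(2)[rule_format, OF Fo, of k]
      by (auto simp: g_def less_top)
    have Th0: "0 \<le> T (h k)" for k using ht h01 by (intro T_nonneg)
    have upper: "T (h k) \<le> g k" for k
    proof -
      have "ennreal (T (h k)) \<le> content (F k)"
        using hsupp h01 by (intro content_upper) (auto simp: below_def)
      then show ?thesis using g Th0 by (simp add: g_def)
    qed
    have lower: "g (Suc k) \<le> T (h k)" for k
    proof -
      have "content (F (Suc k)) \<le> ennreal (T (h k))"
      proof (rule content_le[OF ht h01(1)])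
        show "1 \<le> h k x" if "x \<in> F (Suc k)" for x
        proof -
          have "real k + 1 \<le> \<phi> x / e" using that e by (simp add: F_def field_simps)
          then show ?thesis by (simp add: h1)
        qed
      qed
      then show ?thesis using g Th0 by simp
    qed
    have F0: "F 0 = G" by (simp add: F_def G_def)
    have g0: "g 0 \<le> T \<zeta>"
    proof -
      have "ennreal (g 0) \<le> ennreal (T \<zeta>)"
        using G_fin g[of 0] \<nu>(2)[rule_format, OF Fo, of 0] F0 by simp
      then show ?thesis using T_nonneg[OF z(1,2)] by simp
    qed
    have b: "\<phi> x / e - 1 \<le> (\<Sum>k<N. h k x)" "(\<Sum>k<N. h k x) \<le> \<phi> x / e + 1" for x
      by (rule sum_steps_bounds; use t h01 h0 h1 in auto)+
    have c: "\<phi> x / e - 1 \<le> (\<Sum>k<N. indicator (F k) x)" "(\<Sum>k<N. indicator (F k) x) \<le> \<phi> x / e + 1" for x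
      by (rule sum_steps_bounds; use t e in \<open>auto simp: F_def field_simps indicator_def\<close>)+
    have zero: "(\<Sum>k<N. h k x) = 0" "(\<Sum>k<N. indicator (F k) x :: real) = 0" if "\<phi> x = 0" for x
      using that e h0[of x] by (auto simp: F_def indicator_def mult_less_0_iff intro!: sum.neutral)
    have S: "(\<lambda>x. \<Sum>k<N. h k x) \<in> test_functions U" using ht by (intro test_functions_sum) auto
    have eS: "(\<lambda>x. e * (\<Sum>k<N. h k x)) \<in> test_functions U" by (rule test_functions_cmult[OF S])
    have ez: "(\<lambda>x. e * \<zeta> x) \<in> test_functions U" by (rule test_functions_cmult[OF z(1)])
    have TS: "T (\<lambda>x. e * (\<Sum>k<N. h k x)) = e * (\<Sum>k<N. T (h k))"
      using T_cmult[OF S] T_sum[of "{..<N}" h] ht by simp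
    have "T \<phi> \<le> T (\<lambda>x. e * (\<Sum>k<N. h k x) + e * \<zeta> x)"
    proof (rule T_mono[OF \<phi>(1) test_functions_add[OF eS ez]])
      fix x
      show "\<phi> x \<le> e * (\<Sum>k<N. h k x) + e * \<zeta> x"
        using b(1)[of x] z1[of x] z(2)[of x] zero(1)[of x] e by (cases "\<phi> x = 0") (auto simp: field_simps)
    qed
    then have T1: "T \<phi> \<le> e * (\<Sum>k<N. T (h k)) + e * T \<zeta>"
      using T_add[OF eS ez] TS T_cmult[OF z(1)] by simp
    have "T (\<lambda>x. e * (\<Sum>k<N. h k x)) \<le> T (\<lambda>x. \<phi> x + e * \<zeta> x)"
    proof (rule T_mono[OF eS test_functions_add[OF \<phi>(1) ez]])
      fix x
      show "e * (\<Sum>k<N. h k x) \<le> \<phi> x + e * \<zeta> x"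
        using b(2)[of x] z1[of x] z(2)[of x] zero(1)[of x] e by (cases "\<phi> x = 0") (auto simp: field_simps)
    qed
    then have T2: "e * (\<Sum>k<N. T (h k)) \<le> T \<phi> + e * T \<zeta>"
      using T_add[OF \<phi>(1) ez] TS T_cmult[OF z(1)] by simp
    have intF: "integrable \<nu> (indicator (F k) :: _ \<Rightarrow> real)" for k
      using Fm Ff by (simp add: integrable_indicator_iff)
    have intI: "(\<integral>x. e * (\<Sum>k<N. indicator (F k) x) \<partial>\<nu>) = e * (\<Sum>k<N. g k)"
      using intF Fm sp by (simp add: g_def)
    have intG: "(\<integral>x. e * indicator G x \<partial>\<nu>) = e * g 0" "integrable \<nu> (\<lambda>x. e * indicator G x)"
      using intF[of 0] Gm F0 sp by (simp_all add: g_def)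
    have intS: "integrable \<nu> (\<lambda>x. e * (\<Sum>k<N. indicator (F k) x))"
      using intF by simp
    have "(\<integral>x. \<phi> x \<partial>\<nu>) \<le> (\<integral>x. e * (\<Sum>k<N. indicator (F k) x) + e * indicator G x \<partial>\<nu>)"
    proof (rule integral_mono[OF int])
      show "integrable \<nu> (\<lambda>x. e * (\<Sum>k<N. indicator (F k) x) + e * indicator G x)"
        using intS intG(2) by (rule Bochner_Integration.integrable_add)
      fix x
      show "\<phi> x \<le> e * (\<Sum>k<N. indicator (F k) x) + e * indicator G x"
        using c(1)[of x] zero(2)[of x] e \<phi>(2)[of x]
        by (cases "\<phi> x = 0") (auto simp: field_simps G_def indicator_def)
    qed
    then have I1: "(\<integral>x. \<phi> x \<partial>\<nu>) \<le> e * (\<Sum>k<N. g k) + e * g 0"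
      unfolding Bochner_Integration.integral_add[OF intS intG(2)] intI intG(1) .
    have "(\<integral>x. e * (\<Sum>k<N. indicator (F k) x) \<partial>\<nu>) \<le> (\<integral>x. \<phi> x + e * indicator G x \<partial>\<nu>)"
    proof (rule integral_mono[OF intS])
      show "integrable \<nu> (\<lambda>x. \<phi> x + e * indicator G x)"
        using int intG(2) by (rule Bochner_Integration.integrable_add)
      fix x
      show "e * (\<Sum>k<N. indicator (F k) x) \<le> \<phi> x + e * indicator G x"
        using c(2)[of x] zero(2)[of x] e \<phi>(2)[of x]
        by (cases "\<phi> x = 0") (auto simp: field_simps G_def indicator_def)
    qed
    then have I2: "e * (\<Sum>k<N. g k) \<le> (\<integral>x. \<phi> x \<partial>\<nu>) + e * g 0"
      unfolding Bochner_Integration.integral_add[OF int intG(2)] intI intG(1) .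
    have "(\<Sum>k<N. T (h k)) \<le> (\<Sum>k<N. g k)" using upper by (intro sum_mono)
    then have s1: "e * (\<Sum>k<N. T (h k)) \<le> e * (\<Sum>k<N. g k)" using e by simp
    have "(\<Sum>k<N. g k) \<le> (\<Sum>k<Suc N. g k)" by (simp add: g_def)
    also have "\<dots> = g 0 + (\<Sum>k<N. g (Suc k))" by (rule sum.lessThan_Suc_shift)
    also have "\<dots> \<le> g 0 + (\<Sum>k<N. T (h k))" using lower by (intro add_left_mono sum_mono)
    finally have s2: "e * (\<Sum>k<N. g k) \<le> e * g 0 + e * (\<Sum>k<N. T (h k))"
      using e by (simp add: distrib_left[symmetric])
    have "e * g 0 \<le> e * T \<zeta>" using g0 e by simp
    then show ?thesis using T1 T2 I1 I2 s1 s2 by linarith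
  qed
  have "\<bar>(\<integral>x. \<phi> x \<partial>\<nu>) - T \<phi>\<bar> \<le> 0"
  proof (rule field_le_epsilon)
    fix d :: real assume d: "0 < d"
    have z0: "0 \<le> T \<zeta>" using T_nonneg[OF z(1,2)] .
    have "\<bar>(\<integral>x. \<phi> x \<partial>\<nu>) - T \<phi>\<bar> \<le> d / (3 * T \<zeta> + 1) * (3 * T \<zeta>)"
      using d z0 by (intro close) simp
    also have "\<dots> \<le> 0 + d" using d z0 by (simp add: field_simps)
    finally show "\<bar>(\<integral>x. \<phi> x \<partial>\<nu>) - T \<phi>\<bar> \<le> 0 + d" .
  qed
  then show "(\<integral>x. \<phi> x \<partial>\<nu>) = T \<phi>" by simp
qed

text \<open>Signed test functions reduce to nonnegative ones by adding a large multiple of a cutoff that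
  equals one on the support.\<close>
theorem riesz_representation:
  obtains \<nu> where "sets \<nu> = sets borel" "\<And>K. compact K \<Longrightarrow> K \<subseteq> U \<Longrightarrow> emeasure \<nu> K < \<infinity>"
    "\<And>\<phi>. \<phi> \<in> test_functions U \<Longrightarrow> integrable \<nu> \<phi>"
    "\<And>\<phi>. \<phi> \<in> test_functions U \<Longrightarrow> (\<integral>x. \<phi> x \<partial>\<nu>) = T \<phi>"
proof -
  obtain \<nu> where \<nu>: "sets \<nu> = sets borel" "\<forall>V. open V \<longrightarrow> emeasure \<nu> V = content V"
    using borel_measure_exists by blast
  note pos = integral_eq_nonneg[OF \<nu>]
  have "emeasure \<nu> K < \<infinity>" if K: "compact K" "K \<subseteq> U" for K
  proof -
    obtain \<zeta> N where z: "\<zeta> \<in> test_functions U" "\<And>x. 0 \<le> \<zeta> x" "\<And>x. \<zeta> x \<le> 1"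
      "open N" "K \<subseteq> N" "\<And>x. x \<in> N \<Longrightarrow> \<zeta> x = 1"
      using smooth_cutoff_exists[OF K(1) open_U K(2)] by blast
    have "emeasure \<nu> K \<le> emeasure \<nu> N" using z \<nu>(1) by (intro emeasure_mono) auto
    also have "\<dots> \<le> ennreal (T \<zeta>)" using z \<nu>(2) by (auto intro!: content_le)
    finally show ?thesis by (auto simp: order.strict_iff_order top_unique)
  qed
  moreover have "integrable \<nu> \<phi> \<and> (\<integral>x. \<phi> x \<partial>\<nu>) = T \<phi>" if \<phi>: "\<phi> \<in> test_functions U" for \<phi>
  proof -
    obtain K where K: "compact K" "K \<subseteq> U" "\<And>x. x \<notin> K \<Longrightarrow> \<phi> x = 0" "\<And>k. Ck_on k \<phi> UNIV"
      using \<phi> by (elim test_functionsE) blast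
    obtain \<zeta> N where z: "\<zeta> \<in> test_functions U" "\<And>x. 0 \<le> \<zeta> x" "\<And>x. \<zeta> x \<le> 1"
      "open N" "K \<subseteq> N" "\<And>x. x \<in> N \<Longrightarrow> \<zeta> x = 1"
      using smooth_cutoff_exists[OF K(1) open_U K(2)] by blast
    have "continuous_on K \<phi>" using K(4)[of 0] by (auto intro: continuous_on_subset)
    then obtain C where C: "\<And>x. x \<in> K \<Longrightarrow> \<bar>\<phi> x\<bar> \<le> C"
      using compact_imp_bounded[OF compact_continuous_image[OF _ K(1)], of \<phi>]
      by (metis bounded_real imageI)
    define \<zeta>' where "\<zeta>' x = max C 0 * \<zeta> x" for x
    have z': "\<zeta>' \<in> test_functions U"
      unfolding \<zeta>'_def[abs_def] by (rule test_functions_cmult[OF z(1)])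
    have nn: "0 \<le> \<zeta>' x" "0 \<le> \<phi> x + \<zeta>' x" for x
      using C[of x] z(2)[of x] z(5,6) K(3)[of x] by (cases "x \<in> K"; force simp: \<zeta>'_def)+
    note t = test_functions_add[OF \<phi> z']
    have "integrable \<nu> (\<lambda>x. (\<phi> x + \<zeta>' x) - \<zeta>' x)"
      by (intro Bochner_Integration.integrable_diff pos(1)[OF t nn(2)] pos(1)[OF z' nn(1)])
    moreover have "(\<integral>x. (\<phi> x + \<zeta>' x) - \<zeta>' x \<partial>\<nu>) = T (\<lambda>x. \<phi> x + \<zeta>' x) - T \<zeta>'"
      using pos(2)[OF t nn(2)] pos(2)[OF z' nn(1)]
      by (subst Bochner_Integration.integral_diff[OF pos(1)[OF t nn(2)] pos(1)[OF z' nn(1)]]) simp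
    ultimately show ?thesis using T_add[OF \<phi> z'] by simp
  qed
  ultimately show thesis using \<nu>(1) that by blast
qed

end

section \<open>Laplacians of products and compositions\<close>

lemma laplacian_cong:
  assumes "open V" "x \<in> V" "\<And>y. y \<in> V \<Longrightarrow> f y = g y"
  shows "laplacian f x = laplacian g x"
  unfolding laplacian_def
  by (intro sum.cong refl partial_deriv_cong[OF assms(1,2)] partial_deriv_cong[OF assms(1)])
    (use assms in auto)

lemma laplacian_mult:
  assumes V: "open V" "x \<in> V" and f: "Ck_on 2 f V" and g: "Ck_on 2 g V"
  shows "laplacian (\<lambda>y. f y * g y) x = f x * laplacian g x + laplacian f x * g x
    + 2 * (\<Sum>i\<in>UNIV. partial_deriv i f x * partial_deriv i g x)"
proof -
  have f2: "Ck_on (Suc (Suc 0)) f V" and g2: "Ck_on (Suc (Suc 0)) g V"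
    using f g by (simp_all add: numeral_2_eq_2 del: Ck_on.simps)
  note f1 = Ck_on_SucD[OF f2 V(1)] and g1 = Ck_on_SucD[OF g2 V(1)]
  note f0 = Ck_on_SucD(1)[OF f1(2) V] and g0 = Ck_on_SucD(1)[OF g1(2) V]
  have "partial_deriv i (partial_deriv i (\<lambda>y. f y * g y)) x
      = f x * partial_deriv i (partial_deriv i g) x + partial_deriv i (partial_deriv i f) x * g x
      + 2 * (partial_deriv i f x * partial_deriv i g x)" for i
  proof -
    have "partial_deriv i (partial_deriv i (\<lambda>y. f y * g y)) x
        = partial_deriv i (\<lambda>y. f y * partial_deriv i g y + partial_deriv i f y * g y) x"
      by (rule partial_deriv_cong[OF V]) (intro partial_deriv_mult f1 g1)
    also have "\<dots> = partial_deriv i (\<lambda>y. f y * partial_deriv i g y) x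
        + partial_deriv i (\<lambda>y. partial_deriv i f y * g y) x"
      by (intro partial_deriv_add differentiable_mult f1(1)[OF V(2)] g1(1)[OF V(2)] f0 g0)
    also have "\<dots> = f x * partial_deriv i (partial_deriv i g) x + partial_deriv i (partial_deriv i f) x * g x
      + 2 * (partial_deriv i f x * partial_deriv i g x)"
      by (simp add: partial_deriv_mult f1(1)[OF V(2)] g1(1)[OF V(2)] f0 g0)
    finally show ?thesis .
  qed
  then show ?thesis
    by (simp add: laplacian_def sum.distrib sum_distrib_left sum_distrib_right)
qed

lemma laplacian_compose:
  assumes V: "open V" "x \<in> V" and f: "Ck_on 2 f V"
    and g: "\<And>s. (g has_real_derivative g1 s) (at s)" "\<And>s. (g1 has_real_derivative g2 s) (at s)"
  shows "laplacian (\<lambda>y. g (f y)) x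
    = g2 (f x) * (\<Sum>i\<in>UNIV. (partial_deriv i f x)\<^sup>2) + g1 (f x) * laplacian f x"
proof -
  have f2: "Ck_on (Suc (Suc 0)) f V"
    using f by (simp add: numeral_2_eq_2 del: Ck_on.simps)
  note f1 = Ck_on_SucD[OF f2 V(1)]
  note f0 = Ck_on_SucD(1)[OF f1(2) V]
  have "partial_deriv i (partial_deriv i (\<lambda>y. g (f y))) x
      = g2 (f x) * (partial_deriv i f x)\<^sup>2 + g1 (f x) * partial_deriv i (partial_deriv i f) x" for i
  proof -
    have "partial_deriv i (partial_deriv i (\<lambda>y. g (f y))) x
        = partial_deriv i (\<lambda>y. g1 (f y) * partial_deriv i f y) x"
      by (rule partial_deriv_cong[OF V]) (intro partial_deriv_compose f1(1) g(1))
    also have "\<dots> = g1 (f x) * partial_deriv i (partial_deriv i f) x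
        + partial_deriv i (\<lambda>y. g1 (f y)) x * partial_deriv i f x"
      by (intro partial_deriv_mult differentiable_compose_real[OF f1(1)[OF V(2)] g(2)] f0)
    also have "partial_deriv i (\<lambda>y. g1 (f y)) x = g2 (f x) * partial_deriv i f x"
      by (rule partial_deriv_compose[OF f1(1)[OF V(2)] g(2)])
    finally show ?thesis by (simp add: power2_eq_square)
  qed
  then show ?thesis
    by (simp add: laplacian_def sum.distrib sum_distrib_left)
qed

section \<open>Logarithmic barriers\<close>

text \<open>The logarithm drives the profile to minus infinity at the origin, at a rate set by \<open>\<epsilon>\<close>. The
  factor \<open>1/4\<close> keeps its values on the unit ball below \<open>1/2\<close>, where \<open>exp (-1/s)\<close> is convex.\<close>
definition log_profile :: "real \<Rightarrow> real \<Rightarrow> real ^ 'n \<Rightarrow> real" where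
  "log_profile \<kappa> \<epsilon> x = (1 + \<kappa> * norm x + \<epsilon> * ln (norm x)) / 4"

text \<open>The gradient of \<open>log_profile\<close> at \<open>x\<close> is this number times \<open>x\<close>.\<close>
definition log_slope :: "real \<Rightarrow> real \<Rightarrow> real ^ 'n \<Rightarrow> real" where
  "log_slope \<kappa> \<epsilon> x = (\<kappa> / norm x + \<epsilon> / (norm x)\<^sup>2) / 4"

text \<open>The value at the origin is set separately because \<open>ln 0 = 0\<close> would give a positive one; with
  this value the function vanishes identically near the origin.\<close>
definition barrier :: "real \<Rightarrow> real \<Rightarrow> real ^ 'n \<Rightarrow> real" where
  "barrier \<kappa> \<epsilon> x = (if x = 0 then 0 else flat_exp 0 (log_profile \<kappa> \<epsilon> x))"

lemma open_punctured: "open (- {0 :: real ^ 'n})" by (rule open_Compl) simp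

lemma sum_component_sq: "(\<Sum>i\<in>UNIV. x $ i * x $ i) = (norm x)\<^sup>2" for x :: "real ^ 'n"
  by (simp add: power2_norm_eq_inner inner_vec_def)

lemma Ck_on_log_profile: "Ck_on k (log_profile \<kappa> \<epsilon>) (- {0 :: real ^ 'n})"
proof -
  have "Ck_on k (\<lambda>x::real^'n. (1 + \<kappa> * norm x + \<epsilon> * ln (norm x)) * (1/4)) (- {0})"
    by (intro Ck_on_add Ck_on_mult Ck_on_const Ck_on_norm Ck_on_ln_norm open_punctured)
  then show ?thesis by (simp add: log_profile_def[abs_def])
qed

lemma partial_deriv_log_profile:
  fixes x :: "real ^ 'n"
  assumes "x \<noteq> 0"
  shows "partial_deriv i (log_profile \<kappa> \<epsilon>) x = x $ i * log_slope \<kappa> \<epsilon> x"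
proof -
  have "((\<lambda>y. (1 + \<kappa> * y + \<epsilon> * ln y) / 4) has_real_derivative (\<kappa> + \<epsilon> / r) / 4) (at r)"
    if "0 < r" for r
    using that by (auto intro!: derivative_eq_intros)
  from this[of "norm x"] have d: "((\<lambda>y. (1 + \<kappa> * y + \<epsilon> * ln y) / 4) has_real_derivative
      (\<kappa> + \<epsilon> / norm x) / 4) (at (norm x))"
    using assms by simp
  have "partial_deriv i (log_profile \<kappa> \<epsilon>) x = (\<kappa> + \<epsilon> / norm x) / 4 * (x $ i / norm x)"
    using partial_deriv_compose[OF differentiable_norm_at[OF assms] d, of i]
    unfolding log_profile_def[abs_def] partial_deriv_norm[OF assms] .
  also have "\<dots> = x $ i * log_slope \<kappa> \<epsilon> x"
  proof -
    have "(\<kappa> + \<epsilon> * y) / 4 * (a * y) = a * ((\<kappa> * y + \<epsilon> * y\<^sup>2) / 4)" for a y :: real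
      by (simp add: algebra_simps power2_eq_square)
    from this[of "inverse (norm x)" "x $ i"] show ?thesis
      by (simp only: log_slope_def divide_inverse power_inverse)
  qed
  finally show ?thesis .
qed

lemma partial_deriv_log_slope:
  fixes x :: "real ^ 'n"
  assumes "x \<noteq> 0"
  shows "log_slope \<kappa> \<epsilon> differentiable (at x)"
    "partial_deriv i (log_slope \<kappa> \<epsilon>) x = x $ i * (- (\<kappa> / norm x ^ 3 + 2 * \<epsilon> / norm x ^ 4) / 4)"
proof -
  have "((\<lambda>y. (\<kappa> * inverse y + \<epsilon> * (inverse y * inverse y)) / 4) has_real_derivative
      - (\<kappa> * inverse r ^ 2 + 2 * \<epsilon> * inverse r ^ 3) / 4) (at r)" if "0 < r" for r :: real
  proof -
    have 1: "(inverse has_real_derivative - (inverse r ^ 2)) (at r)"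
      using DERIV_inverse[of r UNIV] that by (simp add: numeral_2_eq_2)
    have 2: "((\<lambda>y. (\<kappa> * inverse y + \<epsilon> * (inverse y * inverse y)) / 4) has_real_derivative
       (\<kappa> * - (inverse r ^ 2) + \<epsilon> * (- (inverse r ^ 2) * inverse r + - (inverse r ^ 2) * inverse r)) / 4) (at r)"
      by (intro DERIV_cdivide DERIV_add DERIV_cmult DERIV_mult 1)
    have 3: "(\<kappa> * - (y ^ 2) + \<epsilon> * (- (y ^ 2) * y + - (y ^ 2) * y)) / 4 = - (\<kappa> * y ^ 2 + 2 * \<epsilon> * y ^ 3) / 4" for y :: real
      by (simp add: algebra_simps power2_eq_square power3_eq_cube)
    show ?thesis using 2 unfolding 3 .
  qed
  from this[of "norm x"] have d: "((\<lambda>y. (\<kappa> * inverse y + \<epsilon> * (inverse y * inverse y)) / 4) has_real_derivative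
      - (\<kappa> * inverse (norm x) ^ 2 + 2 * \<epsilon> * inverse (norm x) ^ 3) / 4) (at (norm x))"
    using assms by simp
  have s: "log_slope \<kappa> \<epsilon> = (\<lambda>y. (\<kappa> * inverse (norm y) + \<epsilon> * (inverse (norm y) * inverse (norm y))) / 4)"
    by (rule ext) (simp only: log_slope_def divide_inverse power2_eq_square inverse_mult_distrib)
  show "log_slope \<kappa> \<epsilon> differentiable (at x)"
    unfolding s by (rule differentiable_compose_real[OF differentiable_norm_at[OF assms] d])
  have "partial_deriv i (log_slope \<kappa> \<epsilon>) x
      = - (\<kappa> * inverse (norm x) ^ 2 + 2 * \<epsilon> * inverse (norm x) ^ 3) / 4 * (x $ i / norm x)"
    using partial_deriv_compose[OF differentiable_norm_at[OF assms] d, of i]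
    unfolding s partial_deriv_norm[OF assms] .
  also have "\<dots> = x $ i * (- (\<kappa> / norm x ^ 3 + 2 * \<epsilon> / norm x ^ 4) / 4)"
  proof -
    have "- (\<kappa> * y ^ 2 + 2 * \<epsilon> * y ^ 3) / 4 * (a * y) = a * (- (\<kappa> * y ^ 3 + 2 * \<epsilon> * y ^ 4) / 4)"
      for a y :: real
      by (simp add: algebra_simps power2_eq_square power3_eq_cube power4_eq_xxxx)
    from this[of "inverse (norm x)" "x $ i"] show ?thesis
      by (simp only: divide_inverse power_inverse)
  qed
  finally show "partial_deriv i (log_slope \<kappa> \<epsilon>) x = x $ i * (- (\<kappa> / norm x ^ 3 + 2 * \<epsilon> / norm x ^ 4) / 4)" .
qed

lemma laplacian_log_profile:
  fixes x :: "real ^ 'n"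
  assumes "x \<noteq> 0"
  shows "laplacian (log_profile \<kappa> \<epsilon>) x
    = ((real CARD('n) - 1) * \<kappa> / norm x + (real CARD('n) - 2) * \<epsilon> / (norm x)\<^sup>2) / 4"
proof -
  have r: "0 < norm x" using assms by simp
  define q where "q = - (\<kappa> / norm x ^ 3 + 2 * \<epsilon> / norm x ^ 4) / 4"
  have "partial_deriv i (partial_deriv i (log_profile \<kappa> \<epsilon>)) x = x $ i * x $ i * q + log_slope \<kappa> \<epsilon> x" for i
  proof -
    have "partial_deriv i (partial_deriv i (log_profile \<kappa> \<epsilon>)) x
        = partial_deriv i (\<lambda>y. y $ i * log_slope \<kappa> \<epsilon> y) x"
      by (rule partial_deriv_cong[OF open_punctured]) (use assms in \<open>auto simp: partial_deriv_log_profile\<close>)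
    also have "\<dots> = x $ i * partial_deriv i (log_slope \<kappa> \<epsilon>) x + partial_deriv i (\<lambda>y. y $ i) x * log_slope \<kappa> \<epsilon> x"
      by (intro partial_deriv_mult partial_deriv_log_slope(1)[OF assms])
        (intro bounded_linear_imp_differentiable bounded_linear_vec_nth)
    finally show ?thesis
      by (simp add: partial_deriv_component partial_deriv_log_slope(2)[OF assms] q_def)
  qed
  then have "laplacian (log_profile \<kappa> \<epsilon>) x = (norm x)\<^sup>2 * q + real CARD('n) * log_slope \<kappa> \<epsilon> x"
    by (simp add: laplacian_def sum.distrib sum_distrib_right[symmetric] sum_component_sq)
  also have "(norm x)\<^sup>2 * q = - (\<kappa> / norm x + 2 * \<epsilon> / (norm x)\<^sup>2) / 4"
    using r by (simp add: q_def divide_simps power2_eq_square power3_eq_cube power4_eq_xxxx)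
  finally have "laplacian (log_profile \<kappa> \<epsilon>) x
    = - (\<kappa> / norm x + 2 * \<epsilon> / (norm x)\<^sup>2) / 4 + real CARD('n) * log_slope \<kappa> \<epsilon> x" .
  moreover define a where "a = \<kappa> / norm x"
  moreover define e where "e = \<epsilon> / (norm x)\<^sup>2"
  ultimately have "laplacian (log_profile \<kappa> \<epsilon>) x = - (a + 2 * e) / 4 + real CARD('n) * ((a + e) / 4)"
    by (simp add: log_slope_def)
  also have "\<dots> = ((real CARD('n) - 1) * a + (real CARD('n) - 2) * e) / 4"
    by algebra
  finally show ?thesis by (simp add: a_def e_def)
qed

lemma barrier_eq_0:
  fixes x :: "real ^ 'n"
  assumes "\<kappa> \<le> 1" "0 < \<epsilon>" "norm x < exp (- 2 / \<epsilon>)"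
  shows "barrier \<kappa> \<epsilon> x = 0"
proof (cases "x = 0")
  case False
  then have r: "0 < norm x" by simp
  have "ln (norm x) < - 2 / \<epsilon>"
    using assms(3) r by (metis exp_ln exp_less_cancel_iff)
  then have "\<epsilon> * ln (norm x) < - 2" using assms(2) by (simp add: field_simps)
  moreover have "exp (- 2 / \<epsilon>) \<le> 1" using assms(2) by simp
  then have "norm x \<le> 1" using assms(3) by (meson less_imp_le order_less_le_trans)
  moreover have "\<kappa> * norm x \<le> 1 * norm x" using r assms(1) by (intro mult_right_mono) auto
  ultimately show ?thesis by (simp add: barrier_def flat_exp_def log_profile_def)
qed (simp add: barrier_def)

lemma Ck_on_barrier_punctured: "Ck_on k (barrier \<kappa> \<epsilon>) (- {0 :: real ^ 'n})"
proof -
  have "Ck_on k (\<lambda>x::real^'n. flat_exp 0 (log_profile \<kappa> \<epsilon> x)) (- {0})"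
    by (intro Ck_on_flat_exp Ck_on_log_profile open_punctured)
  then show ?thesis
    by (subst Ck_on_cong[OF open_punctured, where g = "\<lambda>x. flat_exp 0 (log_profile \<kappa> \<epsilon> x)"])
      (auto simp: barrier_def)
qed

lemma Ck_on_barrier:
  assumes "\<kappa> \<le> 1" "0 < \<epsilon>"
  shows "Ck_on k (barrier \<kappa> \<epsilon> :: real ^ 'n \<Rightarrow> real) UNIV"
proof -
  have "Ck_on k (barrier \<kappa> \<epsilon>) (ball (0 :: real ^ 'n) (exp (- 2 / \<epsilon>)))"
    by (subst Ck_on_cong[where g = "\<lambda>x. 0"]) (auto simp: barrier_eq_0[OF assms] Ck_on_const)
  then have "Ck_on k (barrier \<kappa> \<epsilon>) (- {0 :: real ^ 'n} \<union> ball 0 (exp (- 2 / \<epsilon>)))"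
    by (intro Ck_on_Un Ck_on_barrier_punctured open_punctured open_ball)
  moreover have "- {0 :: real ^ 'n} \<union> ball 0 (exp (- 2 / \<epsilon>)) = UNIV" by auto
  ultimately show ?thesis by simp
qed

lemma barrier_bounds: "0 \<le> barrier \<kappa> \<epsilon> x" "barrier \<kappa> \<epsilon> x \<le> 1"
  by (auto simp: barrier_def flat_exp_def)

lemma partial_deriv_barrier:
  fixes x :: "real ^ 'n"
  assumes "x \<noteq> 0"
  shows "partial_deriv i (barrier \<kappa> \<epsilon>) x
    = flat_exp 2 (log_profile \<kappa> \<epsilon> x) * (x $ i * log_slope \<kappa> \<epsilon> x)"
proof -
  have "partial_deriv i (barrier \<kappa> \<epsilon>) x = partial_deriv i (\<lambda>x. flat_exp 0 (log_profile \<kappa> \<epsilon> x)) x"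
    by (rule partial_deriv_cong[OF open_punctured]) (use assms in \<open>auto simp: barrier_def\<close>)
  also have "\<dots> = flat_exp 2 (log_profile \<kappa> \<epsilon> x) * partial_deriv i (log_profile \<kappa> \<epsilon>) x"
  proof (rule partial_deriv_compose)
    show "log_profile \<kappa> \<epsilon> differentiable (at x)"
      by (rule Ck_on_SucD(1)[OF Ck_on_log_profile[of "Suc 0"] open_punctured]) (use assms in simp)
    show "(flat_exp 0 has_real_derivative flat_exp 2 (log_profile \<kappa> \<epsilon> x)) (at (log_profile \<kappa> \<epsilon> x))"
      using flat_exp_has_derivative[of 0 "log_profile \<kappa> \<epsilon> x"] by (simp add: numeral_2_eq_2)
  qed
  finally show ?thesis by (simp add: partial_deriv_log_profile[OF assms])
qed

text \<open>The second derivative \<open>flat_exp 4 - 2 flat_exp 3\<close> of \<open>exp (-1/s)\<close> is nonnegative for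
  \<open>s \<le> 1/2\<close>, so the gradient term in the Laplacian of the composition can be dropped.\<close>
lemma laplacian_barrier_ge:
  fixes x :: "real ^ 'n"
  assumes "x \<noteq> 0" "log_profile \<kappa> \<epsilon> x \<le> 1 / 2"
  shows "flat_exp 2 (log_profile \<kappa> \<epsilon> x) * laplacian (log_profile \<kappa> \<epsilon>) x \<le> laplacian (barrier \<kappa> \<epsilon>) x"
proof -
  define s where "s = log_profile \<kappa> \<epsilon> x"
  have d0: "(flat_exp 0 has_real_derivative flat_exp 2 s) (at s)" for s
    using flat_exp_has_derivative[of 0 s] by (simp add: numeral_2_eq_2)
  have d1: "(flat_exp 2 has_real_derivative flat_exp 4 s - 2 * flat_exp 3 s) (at s)" for s
    using flat_exp_has_derivative[of 2 s] by simp
  have "0 \<le> flat_exp 4 s - 2 * flat_exp 3 s"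
  proof (cases "s \<le> 0")
    case False
    then have "flat_exp 4 s - 2 * flat_exp 3 s = flat_exp 4 s * (1 - 2 * s)"
      by (simp add: flat_exp_def field_simps power4_eq_xxxx power3_eq_cube)
    then show ?thesis using assms(2) flat_exp_nonneg[of 4 s] by (simp add: s_def)
  qed (simp add: flat_exp_def)
  then have "0 \<le> (flat_exp 4 s - 2 * flat_exp 3 s) * (\<Sum>i\<in>UNIV. (partial_deriv i (log_profile \<kappa> \<epsilon>) x)\<^sup>2)"
    by (intro mult_nonneg_nonneg sum_nonneg) auto
  moreover have "laplacian (barrier \<kappa> \<epsilon>) x = laplacian (\<lambda>x. flat_exp 0 (log_profile \<kappa> \<epsilon> x)) x"
    by (rule laplacian_cong[OF open_punctured]) (use assms in \<open>auto simp: barrier_def\<close>)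
  moreover have "\<dots> = (flat_exp 4 s - 2 * flat_exp 3 s) * (\<Sum>i\<in>UNIV. (partial_deriv i (log_profile \<kappa> \<epsilon>) x)\<^sup>2)
      + flat_exp 2 s * laplacian (log_profile \<kappa> \<epsilon>) x"
    unfolding s_def
    by (rule laplacian_compose[OF open_punctured _ Ck_on_log_profile d0 d1]) (use assms in simp)
  ultimately show ?thesis by (simp add: s_def)
qed

section \<open>The adjoint operator\<close>

text \<open>With \<open>d = c - div b\<close> this is the formal adjoint of \<open>-\<Delta> + b\<cdot>\<nabla> + c\<close>. Keeping \<open>d\<close> as
  a separate coefficient leaves only local boundedness to be remembered about \<open>c\<close> and \<open>div b\<close>.\<close>
definition adjoint_op ::
  "(real ^ 'n \<Rightarrow> real ^ 'n) \<Rightarrow> (real ^ 'n \<Rightarrow> real) \<Rightarrow> (real ^ 'n \<Rightarrow> real) \<Rightarrow> real ^ 'n \<Rightarrow> real" where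
  "adjoint_op b d \<phi> x = - laplacian \<phi> x - (\<Sum>i\<in>UNIV. b x $ i * partial_deriv i \<phi> x) + d x * \<phi> x"

lemma adjoint_op_cong:
  assumes "open V" "x \<in> V" "\<And>y. y \<in> V \<Longrightarrow> f y = g y"
  shows "adjoint_op b d f x = adjoint_op b d g x"
  using laplacian_cong[OF assms] partial_deriv_cong[OF assms] assms(2,3)
  by (simp add: adjoint_op_def)

lemma adjoint_op_outside:
  assumes "\<phi> \<in> test_functions U" "x \<notin> U"
  shows "adjoint_op b d \<phi> x = 0"
proof -
  let ?S = "closure {x. \<phi> x \<noteq> 0}"
  have "x \<in> - ?S" using assms by (auto simp: test_functions_def)
  moreover have "\<phi> y = 0" if "y \<in> - ?S" for y
    using that subsetD[OF closure_subset, of y "{x. \<phi> x \<noteq> 0}"] by auto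
  moreover have "open (- ?S)" by (rule open_Compl[OF closed_closure])
  ultimately have "adjoint_op b d \<phi> x = adjoint_op b d (\<lambda>x. 0) x"
    by (intro adjoint_op_cong[of "- ?S"])
  then show ?thesis by (simp add: adjoint_op_def laplacian_def partial_deriv_const[abs_def])
qed

lemma adjoint_op_mult:
  assumes V: "open V" "x \<in> V" and w: "Ck_on 2 w V" and \<phi>: "Ck_on 2 \<phi> V"
  shows "adjoint_op b d (\<lambda>y. w y * \<phi> y) x
    = w x * adjoint_op b d \<phi> x + \<phi> x * (- laplacian w x - (\<Sum>i\<in>UNIV. b x $ i * partial_deriv i w x))
      - 2 * (\<Sum>i\<in>UNIV. partial_deriv i w x * partial_deriv i \<phi> x)"
proof -
  have w1: "Ck_on (Suc (Suc 0)) w V" and \<phi>1: "Ck_on (Suc (Suc 0)) \<phi> V"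
    using w \<phi> by (simp_all add: numeral_2_eq_2 del: Ck_on.simps)
  have "partial_deriv i (\<lambda>y. w y * \<phi> y) x = w x * partial_deriv i \<phi> x + partial_deriv i w x * \<phi> x" for i
    by (intro partial_deriv_mult Ck_on_SucD(1)[OF w1 V] Ck_on_SucD(1)[OF \<phi>1 V])
  then have "(\<Sum>i\<in>UNIV. b x $ i * partial_deriv i (\<lambda>y. w y * \<phi> y) x)
      = w x * (\<Sum>i\<in>UNIV. b x $ i * partial_deriv i \<phi> x) + (\<Sum>i\<in>UNIV. b x $ i * partial_deriv i w x) * \<phi> x"
    by (simp add: sum.distrib sum_distrib_left sum_distrib_right distrib_left mult.assoc mult.left_commute)
  then show ?thesis
    unfolding adjoint_op_def laplacian_mult[OF V w \<phi>]
    by (simp add: right_diff_distrib left_diff_distrib distrib_left distrib_right mult.commute mult.left_commute)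
qed

lemma sum_drift_barrier:
  fixes x :: "real ^ 'n"
  assumes "x \<noteq> 0" "0 \<le> \<kappa>" "0 \<le> \<epsilon>" "norm (b x) \<le> B"
  shows "- (\<Sum>i\<in>UNIV. b x $ i * partial_deriv i (barrier \<kappa> \<epsilon>) x)
    \<le> flat_exp 2 (log_profile \<kappa> \<epsilon> x) * (B * ((\<kappa> + \<epsilon> / norm x) / 4))"
proof -
  define p where "p = flat_exp 2 (log_profile \<kappa> \<epsilon> x)"
  define q where "q = log_slope \<kappa> \<epsilon> x"
  have p: "0 \<le> p" by (simp add: p_def flat_exp_nonneg)
  have q: "0 \<le> q" using assms by (simp add: q_def log_slope_def)
  have xq: "norm x * q = (\<kappa> + \<epsilon> / norm x) / 4"
    using assms(1) by (simp add: q_def log_slope_def distrib_left power2_eq_square)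
  have "(\<Sum>i\<in>UNIV. b x $ i * partial_deriv i (barrier \<kappa> \<epsilon>) x) = p * q * (b x \<bullet> x)"
    by (simp add: partial_deriv_barrier[OF assms(1)] p_def q_def inner_vec_def sum_distrib_left
        mult_ac)
  moreover have "- (b x \<bullet> x) \<le> B * norm x"
    using Cauchy_Schwarz_ineq2[of "b x" x] mult_right_mono[OF assms(4) norm_ge_zero[of x]] by linarith
  then have "p * q * (- (b x \<bullet> x)) \<le> p * q * (B * norm x)"
    using p q by (intro mult_left_mono) auto
  ultimately have "- (\<Sum>i\<in>UNIV. b x $ i * partial_deriv i (barrier \<kappa> \<epsilon>) x) \<le> p * (B * (norm x * q))"
    by (simp add: mult.commute mult.left_commute)
  then show ?thesis by (simp add: xq p_def)
qed

lemma sum_cross_barrier: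
  fixes x :: "real ^ 'n"
  assumes "x \<noteq> 0" "0 \<le> \<kappa>" "0 \<le> \<epsilon>" "(\<Sum>i\<in>UNIV. \<bar>partial_deriv i \<phi> x\<bar>) \<le> G"
  shows "- (\<Sum>i\<in>UNIV. partial_deriv i (barrier \<kappa> \<epsilon>) x * partial_deriv i \<phi> x)
    \<le> flat_exp 2 (log_profile \<kappa> \<epsilon> x) * (G * ((\<kappa> + \<epsilon> / norm x) / 4))"
proof -
  define p where "p = flat_exp 2 (log_profile \<kappa> \<epsilon> x)"
  define q where "q = log_slope \<kappa> \<epsilon> x"
  have p: "0 \<le> p" by (simp add: p_def flat_exp_nonneg)
  have q: "0 \<le> q" using assms by (simp add: q_def log_slope_def)
  have xq: "norm x * q = (\<kappa> + \<epsilon> / norm x) / 4"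
    using assms(1) by (simp add: q_def log_slope_def distrib_left power2_eq_square)
  have "- (\<Sum>i\<in>UNIV. partial_deriv i (barrier \<kappa> \<epsilon>) x * partial_deriv i \<phi> x)
      = p * q * (\<Sum>i\<in>UNIV. - (x $ i * partial_deriv i \<phi> x))"
    by (simp add: partial_deriv_barrier[OF assms(1)] p_def q_def sum_distrib_left sum_negf
        mult_ac)
  also have "\<dots> \<le> p * q * (norm x * G)"
  proof (intro mult_left_mono)
    have "(\<Sum>i\<in>UNIV. - (x $ i * partial_deriv i \<phi> x)) \<le> (\<Sum>i\<in>UNIV. norm x * \<bar>partial_deriv i \<phi> x\<bar>)"
    proof (rule sum_mono)
      fix i
      have "- (x $ i * partial_deriv i \<phi> x) \<le> \<bar>x $ i\<bar> * \<bar>partial_deriv i \<phi> x\<bar>"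
        unfolding abs_mult[symmetric] by linarith
      also have "\<dots> \<le> norm x * \<bar>partial_deriv i \<phi> x\<bar>"
        by (intro mult_right_mono component_le_norm_cart) simp
      finally show "- (x $ i * partial_deriv i \<phi> x) \<le> norm x * \<bar>partial_deriv i \<phi> x\<bar>" .
    qed
    also have "\<dots> \<le> norm x * G"
      unfolding sum_distrib_left[symmetric] by (intro mult_left_mono assms(4)) simp
    finally show "(\<Sum>i\<in>UNIV. - (x $ i * partial_deriv i \<phi> x)) \<le> norm x * G" .
  qed (use p q in auto)
  also have "\<dots> = p * (G * (norm x * q))" by simp
  finally show ?thesis by (simp add: xq p_def)
qed

lemma log_profile_le_half:
  fixes x :: "real ^ 'n"
  assumes "x \<noteq> 0" "norm x \<le> 1" "\<kappa> \<le> 1" "0 \<le> \<epsilon>"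
  shows "log_profile \<kappa> \<epsilon> x \<le> 1 / 2"
proof -
  have "\<kappa> * norm x \<le> 1 * norm x" using assms by (intro mult_right_mono) auto
  moreover have "\<epsilon> * ln (norm x) \<le> 0"
    using assms by (intro mult_nonneg_nonpos) auto
  ultimately show ?thesis using assms(2) by (simp add: log_profile_def)
qed

lemma laplacian_log_profile_ge:
  fixes x :: "real ^ 'n"
  assumes "x \<noteq> 0" "0 \<le> \<kappa>" "0 \<le> \<epsilon>" "2 \<le> CARD('n)"
  shows "\<kappa> / (4 * norm x) \<le> laplacian (log_profile \<kappa> \<epsilon>) x"
proof -
  have "1 * \<kappa> / norm x + 0 \<le> (real CARD('n) - 1) * \<kappa> / norm x + (real CARD('n) - 2) * \<epsilon> / (norm x)\<^sup>2"
    using assms by (intro add_mono divide_right_mono mult_right_mono) auto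
  then show ?thesis by (simp add: laplacian_log_profile[OF assms(1)])
qed

text \<open>Since the barrier is subharmonic, its Laplacian only helps. What remains to be paid for are the
  drift and the mixed gradient term, both controlled by the gradient of the barrier, whose norm is at
  most \<open>E (\<kappa> + \<epsilon>/\<bar>x\<bar>)/4\<close>.\<close>
lemma adjoint_op_barrier_mult_le:
  fixes x :: "real ^ 'n"
  assumes x: "x \<noteq> 0" "norm x \<le> 1" and \<kappa>: "0 \<le> \<kappa>" "\<kappa> \<le> 1" and \<epsilon>: "0 \<le> \<epsilon>"
    and dim: "2 \<le> CARD('n)"
    and \<phi>: "Ck_on 2 \<phi> UNIV" "0 \<le> \<phi> x" "\<phi> x \<le> F" "(\<Sum>i\<in>UNIV. \<bar>partial_deriv i \<phi> x\<bar>) \<le> G"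
    and B: "norm (b x) \<le> B" and E: "\<And>s. s \<le> 1 \<Longrightarrow> flat_exp 2 s \<le> E"
  shows "adjoint_op b d (\<lambda>y. barrier \<kappa> \<epsilon> y * \<phi> y) x
    \<le> barrier \<kappa> \<epsilon> x * adjoint_op b d \<phi> x + E * ((F * B + 2 * G) * ((\<kappa> + \<epsilon> / norm x) / 4))"
proof -
  define p where "p = flat_exp 2 (log_profile \<kappa> \<epsilon> x)"
  define r where "r = (\<kappa> + \<epsilon> / norm x) / 4"
  have p: "0 \<le> p" by (simp add: p_def flat_exp_nonneg)
  have half: "log_profile \<kappa> \<epsilon> x \<le> 1 / 2" by (rule log_profile_le_half[OF x \<kappa>(2) \<epsilon>])
  have pE: "p \<le> E" unfolding p_def using half by (intro E) simp
  have r: "0 \<le> r" using \<kappa>(1) \<epsilon> by (simp add: r_def)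
  have B0: "0 \<le> B" using B norm_ge_zero order_trans by blast
  have F0: "0 \<le> F" using \<phi>(2,3) by linarith
  have G0: "0 \<le> G" by (rule order_trans[OF sum_nonneg \<phi>(4)]) simp
  have "0 \<le> \<kappa> / (4 * norm x)" using \<kappa> by simp
  also have "\<dots> \<le> laplacian (log_profile \<kappa> \<epsilon>) x"
    by (rule laplacian_log_profile_ge[OF x(1) \<kappa>(1) \<epsilon> dim])
  finally have "0 \<le> p * laplacian (log_profile \<kappa> \<epsilon>) x" using p by simp
  then have lap: "- laplacian (barrier \<kappa> \<epsilon>) x \<le> 0"
    using laplacian_barrier_ge[OF x(1) half] by (simp add: p_def)
  have drift: "- (\<Sum>i\<in>UNIV. b x $ i * partial_deriv i (barrier \<kappa> \<epsilon>) x) \<le> p * (B * r)"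
    unfolding p_def r_def by (rule sum_drift_barrier[where b = b, OF x(1) \<kappa>(1) \<epsilon> B])
  have "\<phi> x * (- laplacian (barrier \<kappa> \<epsilon>) x - (\<Sum>i\<in>UNIV. b x $ i * partial_deriv i (barrier \<kappa> \<epsilon>) x))
      \<le> \<phi> x * (p * (B * r))"
    using lap drift \<phi>(2) by (intro mult_left_mono) auto
  also have "\<dots> \<le> F * (p * (B * r))"
    using \<phi>(3) p B0 r by (intro mult_right_mono) auto
  finally have 1: "\<phi> x * (- laplacian (barrier \<kappa> \<epsilon>) x
      - (\<Sum>i\<in>UNIV. b x $ i * partial_deriv i (barrier \<kappa> \<epsilon>) x)) \<le> F * (p * (B * r))" .
  have 2: "- (\<Sum>i\<in>UNIV. partial_deriv i (barrier \<kappa> \<epsilon>) x * partial_deriv i \<phi> x) \<le> p * (G * r)"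
    unfolding p_def r_def by (rule sum_cross_barrier[OF x(1) \<kappa>(1) \<epsilon> \<phi>(4)])
  have "p * ((F * B + 2 * G) * r) \<le> E * ((F * B + 2 * G) * r)"
    using pE F0 B0 G0 r by (intro mult_right_mono) auto
  moreover have "F * (p * (B * r)) + 2 * (p * (G * r)) = p * ((F * B + 2 * G) * r)"
    by (simp add: algebra_simps)
  moreover have "adjoint_op b d (\<lambda>y. barrier \<kappa> \<epsilon> y * \<phi> y) x
      = barrier \<kappa> \<epsilon> x * adjoint_op b d \<phi> x
        + \<phi> x * (- laplacian (barrier \<kappa> \<epsilon>) x - (\<Sum>i\<in>UNIV. b x $ i * partial_deriv i (barrier \<kappa> \<epsilon>) x))
        - 2 * (\<Sum>i\<in>UNIV. partial_deriv i (barrier \<kappa> \<epsilon>) x * partial_deriv i \<phi> x)"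
    using x(1) by (intro adjoint_op_mult[OF open_punctured] Ck_on_barrier_punctured Ck_on_subset[OF \<phi>(1)]) auto
  ultimately show ?thesis using 1 2 unfolding r_def by linarith
qed

text \<open>Everything is compared with \<open>p = flat_exp 2 s\<close>, the derivative of \<open>exp (-1/s)\<close> at the
  profile \<open>s\<close>. The Laplacian contributes at least \<open>p/(4\<bar>x\<bar>)\<close>; the gradient has norm at most
  \<open>p (1 + \<epsilon>/\<bar>x\<bar>)/4\<close>, and the barrier itself is \<open>s\<^sup>2 p\<close>, hence at most \<open>p/4\<close>. For small
  \<open>\<bar>x\<bar>\<close> and \<open>\<epsilon>\<close> half of the Laplacian survives.\<close>
lemma adjoint_op_barrier_le:
  fixes x :: "real ^ 'n"
  assumes x: "x \<noteq> 0" "norm x \<le> 1" and \<epsilon>: "0 \<le> \<epsilon>" and dim: "2 \<le> CARD('n)"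
    and B: "norm (b x) \<le> B" and D: "\<bar>d x\<bar> \<le> D"
    and small: "B * (norm x + \<epsilon>) + D * norm x \<le> 1 / 2"
  shows "adjoint_op b d (barrier 1 \<epsilon>) x \<le> - flat_exp 2 (log_profile 1 \<epsilon> x) / (8 * norm x)"
proof -
  define s where "s = log_profile 1 \<epsilon> x"
  define p where "p = flat_exp 2 s"
  have p: "0 \<le> p" by (simp add: p_def flat_exp_nonneg)
  have r: "0 < norm x" using x(1) by simp
  have half: "s \<le> 1 / 2" unfolding s_def by (rule log_profile_le_half[OF x _ \<epsilon>]) simp
  have D0: "0 \<le> D" using D by linarith
  have "p * (1 / (4 * norm x)) \<le> p * laplacian (log_profile 1 \<epsilon>) x"
    using laplacian_log_profile_ge[OF x(1) _ \<epsilon> dim, of 1] p by (intro mult_left_mono) auto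
  then have lap: "p * (1 / (4 * norm x)) \<le> laplacian (barrier 1 \<epsilon>) x"
    using laplacian_barrier_ge[OF x(1) half[unfolded s_def]] by (simp add: p_def s_def)
  have drift: "- (\<Sum>i\<in>UNIV. b x $ i * partial_deriv i (barrier 1 \<epsilon>) x) \<le> p * (B * ((1 + \<epsilon> / norm x) / 4))"
    unfolding p_def s_def by (rule sum_drift_barrier[where b = b, OF x(1) zero_le_one \<epsilon> B])
  have "barrier 1 \<epsilon> x \<le> p / 4"
  proof (cases "s \<le> 0")
    case False
    then have "barrier 1 \<epsilon> x = s\<^sup>2 * p" using x(1) by (simp add: barrier_def flat_exp_def p_def s_def)
    also have "s\<^sup>2 \<le> (1/2)\<^sup>2" using False half by (intro power_mono) auto
    then have "s\<^sup>2 * p \<le> (1/2)\<^sup>2 * p" using p by (rule mult_right_mono)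
    finally show ?thesis by (simp add: power2_eq_square)
  qed (use x(1) p in \<open>simp add: barrier_def s_def flat_exp_def\<close>)
  then have "d x * barrier 1 \<epsilon> x \<le> D * (p / 4)"
    using D D0 barrier_bounds(1)[of 1 \<epsilon> x] by (intro mult_mono) auto
  then have "adjoint_op b d (barrier 1 \<epsilon>) x
      \<le> - (p * (1 / (4 * norm x))) + p * (B * ((1 + \<epsilon> / norm x) / 4)) + D * (p / 4)"
    unfolding adjoint_op_def using lap drift by linarith
  also have "\<dots> = p / (4 * norm x) * (B * (norm x + \<epsilon>) + D * norm x - 1)"
    using r by (simp add: field_simps)
  also have "\<dots> \<le> p / (4 * norm x) * (- 1 / 2)"
    using small p r by (intro mult_left_mono) auto
  finally show ?thesis by (simp add: p_def s_def)
qed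

lemma barrier_mult_test:
  fixes \<phi> :: "real ^ 'n \<Rightarrow> real"
  assumes "\<phi> \<in> test_functions U" "\<kappa> \<le> 1" "0 < \<epsilon>"
  shows "(\<lambda>x. barrier \<kappa> \<epsilon> x * \<phi> x) \<in> test_functions (U - {0})"
proof -
  obtain K where K: "compact K" "K \<subseteq> U" "\<And>x. x \<notin> K \<Longrightarrow> \<phi> x = 0" "\<And>k. Ck_on k \<phi> UNIV"
    using assms(1) by (elim test_functionsE) blast
  let ?\<delta> = "exp (- 2 / \<epsilon>)"
  show ?thesis
  proof (rule test_functionsI[where K = "K - ball 0 ?\<delta>"])
    show "Ck_on k (\<lambda>x. barrier \<kappa> \<epsilon> x * \<phi> x) UNIV" for k
      by (intro Ck_on_mult open_UNIV Ck_on_barrier assms(2,3) K(4))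
    show "compact (K - ball 0 ?\<delta>)" using K(1) by (intro compact_diff open_ball)
    show "K - ball 0 ?\<delta> \<subseteq> U - {0}" using K(2) by auto
    show "barrier \<kappa> \<epsilon> x * \<phi> x = 0" if "x \<notin> K - ball 0 ?\<delta>" for x
      using that K(3)[of x] barrier_eq_0[OF assms(2,3), of x] by auto
  qed
qed

section \<open>Integration against the adjoint operator\<close>

locale adjoint_coefficients =
  fixes b :: "real ^ 'n \<Rightarrow> real ^ 'n" and d :: "real ^ 'n \<Rightarrow> real"
  assumes dim: "2 \<le> CARD('n)"
    and b_cont: "continuous_on (ball 0 1) b"
    and d_meas: "d \<in> borel_measurable (lebesgue_on (ball 0 1))"
    and d_bdd: "\<And>K. compact K \<Longrightarrow> K \<subseteq> ball 0 1 \<Longrightarrow> \<exists>D. \<forall>x\<in>K. \<bar>d x\<bar> \<le> D"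
begin

lemma adjoint_op_measurable_bounded:
  assumes \<phi>: "Ck_on 2 \<phi> UNIV" and K: "compact K" "K \<subseteq> ball 0 1"
  shows "adjoint_op b d \<phi> \<in> borel_measurable (lebesgue_on K)" (is ?meas)
    and "\<exists>C. \<forall>x\<in>K. \<bar>adjoint_op b d \<phi> x\<bar> \<le> C" (is ?bdd)
proof -
  have \<phi>2: "Ck_on (Suc (Suc 0)) \<phi> UNIV"
    using \<phi> by (simp add: numeral_2_eq_2 del: Ck_on.simps)
  note \<phi>1 = Ck_on_SucD(2)[OF \<phi>2 open_UNIV]
  have "continuous_on UNIV (partial_deriv i (partial_deriv i \<phi>))" for i
    by (rule Ck_on_imp_continuous[OF Ck_on_SucD(2)[OF \<phi>1 open_UNIV]])
  then have c2: "continuous_on K (partial_deriv i (partial_deriv i \<phi>))" for i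
    by (rule continuous_on_subset) simp
  have "continuous_on UNIV (partial_deriv i \<phi>)" for i
    by (rule Ck_on_imp_continuous[OF \<phi>1])
  then have c1: "continuous_on K (partial_deriv i \<phi>)" for i
    by (rule continuous_on_subset) simp
  have c0: "continuous_on K \<phi>"
    by (rule continuous_on_subset[OF Ck_on_imp_continuous[OF \<phi>]]) simp
  have bK: "continuous_on K b" using b_cont K(2) by (rule continuous_on_subset)
  define f where "f x = - laplacian \<phi> x - (\<Sum>i\<in>UNIV. b x $ i * partial_deriv i \<phi> x)" for x
  have f: "continuous_on K f"
    unfolding f_def laplacian_def
    by (intro continuous_on_diff continuous_on_minus continuous_on_sum continuous_on_mult c1 c2
        continuous_on_component bK)
  have Kl: "K \<in> sets lebesgue" using K(1) by (simp add: lmeasurable_compact fmeasurableD)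
  have e: "adjoint_op b d \<phi> = (\<lambda>x. f x + d x * \<phi> x)"
    by (rule ext) (simp add: adjoint_op_def f_def)
  have "d \<in> borel_measurable (lebesgue_on K)"
    by (rule measurable_restrict_mono[OF d_meas K(2)])
  then show ?meas
    unfolding e
    by (intro borel_measurable_add borel_measurable_times
        continuous_imp_measurable_on_sets_lebesgue[OF f Kl]
        continuous_imp_measurable_on_sets_lebesgue[OF c0 Kl])
  obtain C1 where C1: "\<And>x. x \<in> K \<Longrightarrow> \<bar>f x\<bar> \<le> C1"
    using compact_imp_bounded[OF compact_continuous_image[OF f K(1)]]
    by (auto simp: bounded_real)
  obtain C2 where C2: "\<And>x. x \<in> K \<Longrightarrow> \<bar>\<phi> x\<bar> \<le> C2"
    using compact_imp_bounded[OF compact_continuous_image[OF c0 K(1)]]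
    by (auto simp: bounded_real)
  obtain D where D: "\<And>x. x \<in> K \<Longrightarrow> \<bar>d x\<bar> \<le> D" using d_bdd[OF K] by blast
  have "\<bar>adjoint_op b d \<phi> x\<bar> \<le> C1 + D * C2" if x: "x \<in> K" for x
  proof -
    have "\<bar>d x * \<phi> x\<bar> \<le> D * C2"
      unfolding abs_mult using D[OF x] C2[OF x] by (intro mult_mono) auto
    then show ?thesis using C1[OF x] unfolding e by linarith
  qed
  then show ?bdd by blast
qed

text \<open>The adjoint operator applied to \<open>\<phi>\<close> is bounded, measurable, and zero off the support of
  \<open>\<phi>\<close>, where \<open>v\<close> is integrable.\<close>
lemma integrable_adjoint:
  assumes \<phi>: "\<phi> \<in> test_functions U" and U: "U \<subseteq> ball 0 1" and v: "v \<in> L1_loc U"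
  shows "integrable lebesgue (\<lambda>x. v x * adjoint_op b d \<phi> x)"
proof -
  obtain K where K: "compact K" "K \<subseteq> U" "\<And>x. x \<notin> K \<Longrightarrow> \<phi> x = 0" "\<And>k. Ck_on k \<phi> UNIV"
    using \<phi> by (elim test_functionsE) blast
  have \<phi>K: "\<phi> \<in> test_functions K" by (rule test_functionsI[OF K(4) K(1) order_refl K(3)])
  have KB: "K \<subseteq> ball 0 1" using K(2) U by (rule order_trans)
  have "bounded (adjoint_op b d \<phi> ` K)"
    using adjoint_op_measurable_bounded(2)[OF K(4,1) KB] unfolding bounded_real by blast
  then have 1: "(\<lambda>x. adjoint_op b d \<phi> x * v x) absolutely_integrable_on K"
    using K v KB
    by (intro absolutely_integrable_bounded_measurable_product[OF bilinear_times]
        adjoint_op_measurable_bounded(1)) (auto simp: L1_loc_def lmeasurable_compact fmeasurableD)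
  have "indicator K x *\<^sub>R (adjoint_op b d \<phi> x * v x) = v x * adjoint_op b d \<phi> x" for x
    using adjoint_op_outside[OF \<phi>K, of x] by (auto simp: indicator_def)
  then have "(\<lambda>x. indicator K x *\<^sub>R (adjoint_op b d \<phi> x * v x)) = (\<lambda>x. v x * adjoint_op b d \<phi> x)"
    by (rule ext)
  then show ?thesis using 1 unfolding set_integrable_def by simp
qed

lemma adjoint_op_add:
  assumes "Ck_on 2 \<phi> UNIV" "Ck_on 2 \<psi> UNIV"
  shows "adjoint_op b d (\<lambda>x. \<phi> x + \<psi> x) x = adjoint_op b d \<phi> x + adjoint_op b d \<psi> x"
proof -
  have "Ck_on (Suc (Suc 0)) \<phi> UNIV" "Ck_on (Suc (Suc 0)) \<psi> UNIV"
    using assms by (simp_all add: numeral_2_eq_2 del: Ck_on.simps)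
  note f1 = Ck_on_SucD[OF this(1) open_UNIV] and g1 = Ck_on_SucD[OF this(2) open_UNIV]
  have 1: "partial_deriv i (\<lambda>x. \<phi> x + \<psi> x) = (\<lambda>x. partial_deriv i \<phi> x + partial_deriv i \<psi> x)" for i
    by (rule ext) (intro partial_deriv_add f1(1)[OF UNIV_I] g1(1)[OF UNIV_I])
  have 2: "partial_deriv i (\<lambda>x. partial_deriv i \<phi> x + partial_deriv i \<psi> x) x
      = partial_deriv i (partial_deriv i \<phi>) x + partial_deriv i (partial_deriv i \<psi>) x" for i
    by (intro partial_deriv_add Ck_on_SucD(1)[OF f1(2) open_UNIV UNIV_I] Ck_on_SucD(1)[OF g1(2) open_UNIV UNIV_I])
  show ?thesis
    unfolding adjoint_op_def laplacian_def 1 2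
    by (simp add: sum.distrib distrib_left)
qed

lemma adjoint_op_cmult:
  assumes "Ck_on 2 \<phi> UNIV"
  shows "adjoint_op b d (\<lambda>x. a * \<phi> x) x = a * adjoint_op b d \<phi> x"
proof -
  have "adjoint_op b d (\<lambda>y. (\<lambda>y. a) y * \<phi> y) x = a * adjoint_op b d \<phi> x"
    by (subst adjoint_op_mult[OF open_UNIV UNIV_I Ck_on_const assms])
      (simp add: laplacian_def partial_deriv_const[abs_def])
  then show ?thesis by simp
qed

end

section \<open>Supersolutions on the punctured ball\<close>

locale punctured_supersolution = adjoint_coefficients +
  fixes u :: "real ^ 'n \<Rightarrow> real"
  assumes u_nonneg: "\<And>x. 0 \<le> u x"
    and u_loc: "u \<in> L1_loc (ball 0 1 - {0})"
    and super: "\<And>\<psi>. \<psi> \<in> test_functions (ball 0 1 - {0}) \<Longrightarrow> (\<And>x. 0 \<le> \<psi> x) \<Longrightarrow>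
      0 \<le> (\<integral>x. u x * adjoint_op b d \<psi> x \<partial>lebesgue)"
begin

lemma u_integrable_away:
  assumes "compact K" "K \<subseteq> ball 0 1" "0 \<notin> K"
  shows "u absolutely_integrable_on K" "(\<lambda>x. u x / norm x) absolutely_integrable_on K"
proof -
  show u: "u absolutely_integrable_on K"
    using assms u_loc by (auto simp: L1_loc_def)
  have c: "continuous_on K (\<lambda>x. inverse (norm x))"
    using assms(3) by (intro continuous_intros) auto
  have Kl: "K \<in> sets lebesgue" using assms(1) by (simp add: lmeasurable_compact fmeasurableD)
  have "(\<lambda>x. inverse (norm x) * u x) absolutely_integrable_on K"
    by (intro absolutely_integrable_bounded_measurable_product[OF bilinear_times]
        continuous_imp_measurable_on_sets_lebesgue[OF c Kl] Kl u
        compact_imp_bounded compact_continuous_image[OF c] assms(1))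
  then show "(\<lambda>x. u x / norm x) absolutely_integrable_on K"
    by (simp add: divide_inverse mult.commute)
qed

text \<open>The test function is the barrier with \<open>\<kappa> = 1\<close> times a fixed cutoff \<open>\<zeta>\<close>. Near the origin
  the adjoint operator maps it to something nonpositive, and below a multiple of \<open>-1/\<bar>x\<bar>\<close> where
  \<open>\<bar>x\<bar> \<ge> \<delta>\<close>; on the outer annulus the result is bounded above independently of \<open>\<delta>\<close>. As its
  integral against \<open>u\<close> is nonnegative, the weighted mass near the origin is controlled by the mass
  of \<open>u\<close> on the annulus.\<close>
lemma weighted_integrals_bounded:
  obtains r M where "0 < r" "r < 1"
    "\<And>\<delta>. 0 < \<delta> \<Longrightarrow> \<delta> \<le> r \<Longrightarrow> (LINT x:(cball 0 r - ball 0 \<delta>)|lebesgue. u x / norm x) \<le> M"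
proof -
  define H :: "(real ^ 'n) set" where "H = cball 0 (1/2)"
  have H: "compact H" "H \<subseteq> ball 0 1" by (auto simp: H_def)
  obtain B where B: "0 \<le> B" "\<And>x. x \<in> H \<Longrightarrow> norm (b x) \<le> B"
  proof -
    have "bounded (b ` H)"
      by (intro compact_imp_bounded compact_continuous_image continuous_on_subset[OF b_cont] H)
    then obtain B where B: "\<And>x. x \<in> H \<Longrightarrow> norm (b x) \<le> B" by (auto simp: bounded_iff)
    have "norm (b x) \<le> max B 0" if "x \<in> H" for x using B[OF that] by simp
    then show thesis using that[of "max B 0"] by simp
  qed
  obtain D where D: "0 \<le> D" "\<And>x. x \<in> H \<Longrightarrow> \<bar>d x\<bar> \<le> D"
  proof -
    obtain D where D: "\<And>x. x \<in> H \<Longrightarrow> \<bar>d x\<bar> \<le> D" using d_bdd[OF H] by blast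
    have "\<bar>d x\<bar> \<le> max D 0" if "x \<in> H" for x using D[OF that] by simp
    then show thesis using that[of "max D 0"] by simp
  qed
  \<comment> \<open>The radius is small enough that drift and zeroth order term use up a quarter of the unit
    gained from the Laplacian; the choice of \<open>\<epsilon>\<close> below allows another quarter.\<close>
  define r where "r = min (1/4) (1 / (4 * (B + D + 1)))"
  have r: "0 < r" "r \<le> 1/4" "(B + D) * r \<le> 1/4"
  proof -
    show "0 < r" "r \<le> 1/4" using B(1) D(1) by (auto simp: r_def)
    have "(B + D) * r \<le> (B + D) * (1 / (4 * (B + D + 1)))"
      using B(1) D(1) by (intro mult_left_mono) (auto simp: r_def)
    also have "\<dots> \<le> 1/4" using B(1) D(1) by (simp add: field_simps)
    finally show "(B + D) * r \<le> 1/4" .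
  qed
  obtain \<zeta> N where z: "\<zeta> \<in> test_functions (ball (0 :: real ^ 'n) (1/2))" "\<And>x. 0 \<le> \<zeta> x" "\<And>x. \<zeta> x \<le> 1"
    "open N" "cball 0 r \<subseteq> N" "\<And>x. x \<in> N \<Longrightarrow> \<zeta> x = 1"
  proof -
    have "cball 0 r \<subseteq> ball (0 :: real ^ 'n) (1/2)" using r(2) by auto
    then show thesis
      using smooth_cutoff_exists[OF compact_cball open_ball] that by blast
  qed
  note zs = test_functions_smooth[OF z(1)]
  have zt: "\<zeta> \<in> test_functions (ball 0 1)" by (rule test_functions_mono[OF z(1)]) auto
  obtain C1 where C1: "\<And>x. x \<in> H \<Longrightarrow> \<bar>adjoint_op b d \<zeta> x\<bar> \<le> C1"
    using adjoint_op_measurable_bounded(2)[OF zs H] by blast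
  obtain G where G: "\<And>x. x \<in> H \<Longrightarrow> (\<Sum>i\<in>UNIV. \<bar>partial_deriv i \<zeta> x\<bar>) \<le> G"
  proof -
    have "continuous_on UNIV (partial_deriv i \<zeta>)" for i
      by (rule Ck_on_imp_continuous[OF Ck_on_SucD(2)[OF zs open_UNIV]])
    then have "continuous_on H (\<lambda>x. \<Sum>i\<in>UNIV. \<bar>partial_deriv i \<zeta> x\<bar>)"
      by (intro continuous_on_sum continuous_on_rabs) (auto intro: continuous_on_subset)
    then have "bounded ((\<lambda>x. \<Sum>i\<in>UNIV. \<bar>partial_deriv i \<zeta> x\<bar>) ` H)"
      by (intro compact_imp_bounded compact_continuous_image H)
    then obtain G where "\<And>x. x \<in> H \<Longrightarrow> \<bar>\<Sum>i\<in>UNIV. \<bar>partial_deriv i \<zeta> x\<bar>\<bar> \<le> G"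
      by (auto simp: bounded_real)
    then show thesis using that[of G] by (meson abs_ge_self order_trans)
  qed
  obtain E where E: "\<And>s. s \<le> 1 \<Longrightarrow> flat_exp 2 s \<le> E" using flat_exp_bounded[of 2] by blast
  have E0: "0 \<le> E" using E[of 0] flat_exp_nonneg[of 2 0] by linarith
  have zero: "(0 :: real ^ 'n) \<in> H" by (simp add: H_def)
  have G0: "0 \<le> G" by (rule order_trans[OF sum_nonneg G[OF zero]]) simp
  have C10: "0 \<le> C1" using C1[OF zero] by linarith
  define C where "C = C1 + E * ((1 * B + 2 * G) * ((1 + 1 / r) / 4))"
  have C0: "0 \<le> C" unfolding C_def using C10 E0 B(1) G0 r(1) by simp
  \<comment> \<open>\<open>exp (-8)\<close> bounds \<open>flat_exp 2\<close> from below on the values of the profile between \<open>1/8\<close> and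
    \<open>1/2\<close>; the other factor is the one in \<open>adjoint_op_barrier_le\<close>.\<close>
  define c where "c = exp (- 8 :: real) / 8"
  have c: "0 < c" by (simp add: c_def)
  define A :: "(real ^ 'n) set" where "A = H - ball 0 r"
  have A: "compact A" "A \<subseteq> ball 0 1" "0 \<notin> A"
    using H r(1) by (auto simp: A_def intro: compact_diff)
  have uA: "integrable lebesgue (\<lambda>x. indicator A x * u x)"
    using u_integrable_away(1)[OF A] by (simp add: set_integrable_def)
  have "(LINT x:(cball 0 r - ball 0 \<delta>)|lebesgue. u x / norm x) \<le> C * (LINT x:A|lebesgue. u x) / c"
    if \<delta>: "0 < \<delta>" "\<delta> \<le> r" for \<delta>
  proof -
    define S :: "(real ^ 'n) set" where "S = cball 0 r - ball 0 \<delta>"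
    have S: "compact S" "S \<subseteq> ball 0 1" "0 \<notin> S"
      using r(2) \<delta>(1) by (auto simp: S_def intro: compact_diff)
    have uS: "integrable lebesgue (\<lambda>x. indicator S x * (u x / norm x))"
      using u_integrable_away(2)[OF S] by (simp add: set_integrable_def)
    \<comment> \<open>The second bound keeps \<open>\<epsilon> ln \<delta>\<close> above \<open>-1/2\<close>, so that the profile is at least
      \<open>1/8\<close> for \<open>\<bar>x\<bar> \<ge> \<delta>\<close>.\<close>
    define \<epsilon> where "\<epsilon> = min (1 / (4 * (B + 1))) (1 / (2 * (1 + \<bar>ln \<delta>\<bar>)))"
    have \<epsilon>: "0 < \<epsilon>" "\<epsilon> \<le> 1" "B * \<epsilon> \<le> 1/4" "\<epsilon> * \<bar>ln \<delta>\<bar> \<le> 1/2"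
    proof -
      have p: "0 < 1 + \<bar>ln \<delta>\<bar>" by (rule add_pos_nonneg) auto
      show "0 < \<epsilon>" using B(1) p by (simp add: \<epsilon>_def)
      have "1 / (4 * (B + 1)) \<le> 1" using B(1) by (simp add: field_simps)
      then show "\<epsilon> \<le> 1" by (simp add: \<epsilon>_def)
      have "B * \<epsilon> \<le> B * (1 / (4 * (B + 1)))" using B(1) by (intro mult_left_mono) (auto simp: \<epsilon>_def)
      also have "\<dots> \<le> 1/4" using B(1) by (simp add: field_simps)
      finally show "B * \<epsilon> \<le> 1/4" .
      have "\<epsilon> * \<bar>ln \<delta>\<bar> \<le> 1 / (2 * (1 + \<bar>ln \<delta>\<bar>)) * \<bar>ln \<delta>\<bar>"
        by (intro mult_right_mono) (auto simp: \<epsilon>_def)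
      also have "\<dots> \<le> 1/2" using p by (simp add: field_simps)
      finally show "\<epsilon> * \<bar>ln \<delta>\<bar> \<le> 1/2" .
    qed
    define \<psi> where "\<psi> x = barrier 1 \<epsilon> x * \<zeta> x" for x
    have \<psi>: "\<psi> \<in> test_functions (ball 0 1 - {0})"
      unfolding \<psi>_def[abs_def] by (rule barrier_mult_test[OF zt _ \<epsilon>(1)]) simp
    have \<psi>H: "\<psi> \<in> test_functions (ball 0 (1/2) - {0})"
      unfolding \<psi>_def[abs_def] by (rule barrier_mult_test[OF z(1) _ \<epsilon>(1)]) simp
    have pos: "0 \<le> (\<integral>x. u x * adjoint_op b d \<psi> x \<partial>lebesgue)"
      by (rule super[OF \<psi>]) (simp add: \<psi>_def z(2) barrier_bounds)
    have le: "u x * adjoint_op b d \<psi> x \<le> - c * (indicator S x * (u x / norm x)) + C * (indicator A x * u x)" for x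
    proof (cases "x = 0 \<or> x \<notin> ball 0 (1/2)")
      case True
      then have "adjoint_op b d \<psi> x = 0" by (intro adjoint_op_outside[OF \<psi>H]) auto
      moreover have "x \<notin> S" using True r(2) S(3) by (auto simp: S_def)
      ultimately show ?thesis using C0 u_nonneg[of x] by (simp add: indicator_def)
    next
      case False
      then have x: "x \<noteq> 0" "norm x \<le> 1" "x \<in> H" by (auto simp: H_def)
      have rx: "0 < norm x" using x(1) by simp
      show ?thesis
      proof (cases "norm x \<le> r")
        case True
        have "adjoint_op b d \<psi> x = adjoint_op b d (barrier 1 \<epsilon>) x"
          by (rule adjoint_op_cong[OF z(4)]) (use z(5,6) True in \<open>auto simp: \<psi>_def\<close>)
        also have "\<dots> \<le> - flat_exp 2 (log_profile 1 \<epsilon> x) / (8 * norm x)"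
        proof (rule adjoint_op_barrier_le[where b = b and d = d, OF x(1,2) _ dim B(2)[OF x(3)] D(2)[OF x(3)]])
          have "(B + D) * norm x \<le> (B + D) * r" using True B(1) D(1) by (intro mult_left_mono) auto
          then show "B * (norm x + \<epsilon>) + D * norm x \<le> 1/2"
            using r(3) \<epsilon>(3) by (simp add: distrib_left distrib_right)
        qed (use \<epsilon>(1) in simp)
        also have "\<dots> \<le> - c * indicator S x / norm x"
        proof (cases "x \<in> S")
          case xS: True
          define s where "s = log_profile 1 \<epsilon> x"
          have "ln \<delta> \<le> ln (norm x)" using xS \<delta>(1) rx by (simp add: S_def)
          then have "\<epsilon> * ln \<delta> \<le> \<epsilon> * ln (norm x)" using \<epsilon>(1) by simp
          moreover have "- (\<epsilon> * ln \<delta>) \<le> \<epsilon> * \<bar>ln \<delta>\<bar>"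
            using mult_left_mono[of "- ln \<delta>" "\<bar>ln \<delta>\<bar>" \<epsilon>] \<epsilon>(1) by simp
          ultimately have "- 1/2 \<le> \<epsilon> * ln (norm x)" using \<epsilon>(4) by linarith
          moreover have "1/8 \<le> (1 + 1 * a + e) / 4" if "- 1/2 \<le> e" "0 < a" for a e :: real
            using that by simp
          ultimately have s: "1/8 \<le> s" unfolding s_def log_profile_def using rx by blast
          have s2: "s \<le> 1/2" unfolding s_def using x \<epsilon>(1) by (intro log_profile_le_half) auto
          have "exp (- 8) \<le> exp (- (1 / s))" using s by (simp add: field_simps)
          also have "\<dots> \<le> exp (- (1 / s)) / s\<^sup>2"
          proof -
            have "s\<^sup>2 \<le> 1" using s s2 by (intro power_le_one) auto
            then show ?thesis using s by (simp add: field_simps)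
          qed
          also have "\<dots> = flat_exp 2 s" using s by (simp add: flat_exp_def)
          finally have "exp (- 8) \<le> flat_exp 2 s" .
          then show ?thesis using xS rx by (simp add: c_def s_def field_simps)
        next
          case False
          then show ?thesis using flat_exp_nonneg[of 2 "log_profile 1 \<epsilon> x"] rx by simp
        qed
        finally have "u x * adjoint_op b d \<psi> x \<le> u x * (- c * indicator S x / norm x)"
          using u_nonneg[of x] by (intro mult_left_mono)
        also have "\<dots> = - c * (indicator S x * (u x / norm x))" by simp
        also have "\<dots> \<le> - c * (indicator S x * (u x / norm x)) + C * (indicator A x * u x)"
          using mult_nonneg_nonneg[OF C0 mult_nonneg_nonneg[OF indicator_pos_le u_nonneg]] by simp
        finally show ?thesis .
      next
        case False
        then have xA: "x \<in> A" and xS: "x \<notin> S" using x(3) by (auto simp: A_def S_def)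
        have "adjoint_op b d \<psi> x \<le> barrier 1 \<epsilon> x * adjoint_op b d \<zeta> x
            + E * ((1 * B + 2 * G) * ((1 + \<epsilon> / norm x) / 4))"
          unfolding \<psi>_def[abs_def]
          using \<epsilon>(1)
          by (intro adjoint_op_barrier_mult_le x dim zs z B(2) G E) auto
        also have "\<dots> \<le> 1 * C1 + E * ((1 * B + 2 * G) * ((1 + 1 / r) / 4))"
        proof (rule add_mono)
          have "barrier 1 \<epsilon> x * adjoint_op b d \<zeta> x \<le> barrier 1 \<epsilon> x * C1"
            using C1[OF x(3)] barrier_bounds(1)[of 1 \<epsilon> x] by (intro mult_left_mono) auto
          also have "\<dots> \<le> 1 * C1"
            using barrier_bounds(2)[of 1 \<epsilon> x] C10 by (rule mult_right_mono)
          finally show "barrier 1 \<epsilon> x * adjoint_op b d \<zeta> x \<le> 1 * C1" .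
          have "\<epsilon> / norm x \<le> 1 / r" using False \<epsilon>(1,2) r(1) by (intro frac_le) auto
          then show "E * ((1 * B + 2 * G) * ((1 + \<epsilon> / norm x) / 4)) \<le> E * ((1 * B + 2 * G) * ((1 + 1 / r) / 4))"
            using E0 B(1) G0 by (intro mult_left_mono divide_right_mono add_left_mono) auto
        qed
        also have "\<dots> = C" by (simp add: C_def)
        finally have "u x * adjoint_op b d \<psi> x \<le> u x * C"
          using u_nonneg[of x] by (intro mult_left_mono)
        then show ?thesis using xA xS by (simp add: mult.commute)
      qed
    qed
    have "(\<integral>x. u x * adjoint_op b d \<psi> x \<partial>lebesgue)
        \<le> (\<integral>x. - c * (indicator S x * (u x / norm x)) + C * (indicator A x * u x) \<partial>lebesgue)"
      using le by (intro integral_mono integrable_adjoint[OF \<psi> _ u_loc] Bochner_Integration.integrable_add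
          integrable_mult_right uS uA) auto
    also have "\<dots> = - c * (LINT x:S|lebesgue. u x / norm x) + C * (LINT x:A|lebesgue. u x)"
      unfolding set_lebesgue_integral_def real_scaleR_def
      by (subst Bochner_Integration.integral_add[OF integrable_mult_right[OF uS] integrable_mult_right[OF uA]])
        (simp only: integral_mult_right_zero)
    finally show ?thesis using pos c by (simp add: S_def field_simps)
  qed
  then show thesis using r(1,2) by (intro that[of r "C * (LINT x:A|lebesgue. u x) / c"]) auto
qed

text \<open>Monotone convergence as the inner radius shrinks to zero.\<close>
lemma weighted_integrable_near:
  obtains r where "0 < r" "r < 1" "(\<lambda>x. u x / norm x) absolutely_integrable_on cball 0 r"
proof -
  obtain r M where r: "0 < r" "r < 1"
    and M: "\<And>\<delta>. 0 < \<delta> \<Longrightarrow> \<delta> \<le> r \<Longrightarrow> (LINT x:(cball 0 r - ball 0 \<delta>)|lebesgue. u x / norm x) \<le> M"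
    using weighted_integrals_bounded by blast
  define S :: "nat \<Rightarrow> (real ^ 'n) set" where "S k = cball 0 r - ball 0 (r / (real k + 1))" for k
  define f where "f k x = indicator (S k) x * (u x / norm x)" for k x
  have \<delta>: "0 < r / (real k + 1)" "r / (real k + 1) \<le> r" for k
    using r(1) by (auto simp: field_simps)
  have S: "compact (S k)" "S k \<subseteq> ball 0 1" "0 \<notin> S k" for k
    using r \<delta>(1)[of k] by (auto simp: S_def intro: compact_diff)
  have int: "integrable lebesgue (f k)" for k
    using u_integrable_away(2)[OF S] by (simp add: f_def[abs_def] set_integrable_def)
  have nn: "0 \<le> f k x" for k x using u_nonneg[of x] by (simp add: f_def)
  have mono: "mono (\<lambda>k. f k x)" for x
  proof (rule monoI)
    fix k l :: nat assume "k \<le> l"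
    then have "r / (real l + 1) \<le> r / (real k + 1)" using r(1) by (intro divide_left_mono) auto
    then have "S k \<subseteq> S l" by (auto simp: S_def)
    then show "f k x \<le> f l x" using u_nonneg[of x] by (auto simp: f_def indicator_def)
  qed
  have lim: "(\<lambda>k. f k x) \<longlonglongrightarrow> indicator (cball 0 r) x * (u x / norm x)" for x
  proof (cases "x \<in> cball 0 r \<and> x \<noteq> 0")
    case True
    then have nx: "0 < norm x" by simp
    obtain k0 :: nat where k0: "r / norm x \<le> real k0" using real_arch_simple by blast
    have "f k x = indicator (cball 0 r) x * (u x / norm x)" if "k0 \<le> k" for k
    proof -
      have "r / norm x \<le> real k + 1" using k0 that by linarith
      then have "r / (real k + 1) \<le> norm x" using nx by (simp add: field_simps)
      then have "x \<in> S k" using True by (auto simp: S_def)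
      then show ?thesis using True by (simp add: f_def)
    qed
    then show ?thesis by (intro tendsto_eventually) (auto simp: eventually_sequentially)
  next
    case False
    then have "f k x = indicator (cball 0 r) x * (u x / norm x)" for k
      by (auto simp: f_def S_def indicator_def)
    then show ?thesis by simp
  qed
  have bd: "integral\<^sup>L lebesgue (f k) \<le> M" for k
    using M[OF \<delta>[of k]]
    unfolding f_def[abs_def] S_def set_lebesgue_integral_def real_scaleR_def .
  have "incseq (\<lambda>k. integral\<^sup>L lebesgue (f k))"
    using mono int by (intro monoI integral_mono) (auto dest: monoD)
  then obtain I where I: "(\<lambda>k. integral\<^sup>L lebesgue (f k)) \<longlonglongrightarrow> I"
    using incseq_convergent[of "\<lambda>k. integral\<^sup>L lebesgue (f k)" M] bd by blast
  have meas: "(\<lambda>x. indicator (cball 0 r) x * (u x / norm x)) \<in> borel_measurable lebesgue"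
    by (rule borel_measurable_LIMSEQ_real[OF lim borel_measurable_integrable[OF int]])
  have "integrable lebesgue (\<lambda>x. indicator (cball 0 r) x * (u x / norm x))"
    by (rule integral_monotone_convergence_nonneg(1)[OF int _ _ _ I meas])
      (use mono nn lim in auto)
  then show thesis using r that by (simp add: set_integrable_def)
qed

text \<open>Near the origin \<open>u\<close> is the product of the bounded function \<open>\<bar>x\<bar>\<close> with \<open>u/\<bar>x\<bar>\<close>, except at
  the origin itself, where division by zero makes that product vanish.\<close>
lemma u_integrable:
  assumes K: "compact K" "K \<subseteq> ball 0 1"
  shows "(\<lambda>x. u x / norm x) absolutely_integrable_on K" "u absolutely_integrable_on K"
proof -
  obtain r where r: "0 < r" "r < 1" "(\<lambda>x. u x / norm x) absolutely_integrable_on cball 0 r"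
    using weighted_integrable_near by blast
  have Kl: "K \<in> sets lebesgue" using K(1) by (simp add: lmeasurable_compact fmeasurableD)
  have "(\<lambda>x. u x / norm x) absolutely_integrable_on (K - ball 0 r)"
    using K r(1) by (intro u_integrable_away(2) compact_diff open_ball) auto
  then have "(\<lambda>x. u x / norm x) absolutely_integrable_on (cball 0 r \<union> (K - ball 0 r))"
    by (rule absolutely_integrable_Un[OF r(3)])
  then show v: "(\<lambda>x. u x / norm x) absolutely_integrable_on K"
    by (rule set_integrable_subset[OF _ Kl]) auto
  have c: "continuous_on K norm" by (intro continuous_intros)
  have "(\<lambda>x. norm x * (u x / norm x)) absolutely_integrable_on K"
    by (intro absolutely_integrable_bounded_measurable_product[OF bilinear_times]
        continuous_imp_measurable_on_sets_lebesgue[OF c Kl] Kl v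
        compact_imp_bounded compact_continuous_image[OF c] K(1))
  then show "u absolutely_integrable_on K"
    by (rule absolutely_integrable_spike[where S = "{0}"]) auto
qed

theorem u_L1_loc: "u \<in> L1_loc (ball 0 1)"
  using u_integrable(2) by (simp add: L1_loc_def)

text \<open>Multiplying \<open>\<phi>\<close> by the barrier with \<open>\<kappa> = 0\<close> makes it an admissible test function, at the
  price of an error \<open>C \<epsilon>/\<bar>x\<bar>\<close>. Against \<open>u\<close> this error is at most \<open>C \<epsilon>\<close> times the integral of
  \<open>u/\<bar>x\<bar>\<close> over the support of \<open>\<phi>\<close>, which tends to zero with \<open>\<epsilon>\<close>. The barriers converge to the
  positive constant \<open>flat_exp 0 (1/4)\<close>, which can be divided out.\<close>
theorem supersolution_across_origin:
  assumes \<phi>: "\<phi> \<in> test_functions (ball 0 1)" "\<And>x. 0 \<le> \<phi> x"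
  shows "0 \<le> (\<integral>x. u x * adjoint_op b d \<phi> x \<partial>lebesgue)"
proof -
  obtain K where K: "compact K" "K \<subseteq> ball 0 1" "\<And>x. x \<notin> K \<Longrightarrow> \<phi> x = 0" "\<And>k. Ck_on k \<phi> UNIV"
    using \<phi>(1) by (elim test_functionsE) blast
  have \<phi>K: "\<phi> \<in> test_functions K" by (rule test_functionsI[OF K(4) K(1) order_refl K(3)])
  obtain B where B: "\<And>x. x \<in> K \<Longrightarrow> norm (b x) \<le> B"
    using compact_imp_bounded[OF compact_continuous_image[OF continuous_on_subset[OF b_cont K(2)] K(1)]]
    by (auto simp: bounded_iff)
  obtain F where F: "\<And>x. x \<in> K \<Longrightarrow> \<bar>\<phi> x\<bar> \<le> F"
    using compact_imp_bounded[OF compact_continuous_image[OF continuous_on_subset[OF Ck_on_imp_continuous[OF K(4)]] K(1)]]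
    by (auto simp: bounded_real)
  obtain G where G: "\<And>x. x \<in> K \<Longrightarrow> \<bar>\<Sum>i\<in>UNIV. \<bar>partial_deriv i \<phi> x\<bar>\<bar> \<le> G"
  proof -
    have "continuous_on UNIV (partial_deriv i \<phi>)" for i
      by (rule Ck_on_imp_continuous[OF Ck_on_SucD(2)[OF K(4) open_UNIV]])
    then have "continuous_on K (\<lambda>x. \<Sum>i\<in>UNIV. \<bar>partial_deriv i \<phi> x\<bar>)"
      by (intro continuous_on_sum continuous_on_rabs) (auto intro: continuous_on_subset)
    then have "bounded ((\<lambda>x. \<Sum>i\<in>UNIV. \<bar>partial_deriv i \<phi> x\<bar>) ` K)"
      by (intro compact_imp_bounded compact_continuous_image K)
    then show thesis using that by (auto simp: bounded_real)
  qed
  obtain E where E: "\<And>s. s \<le> 1 \<Longrightarrow> flat_exp 2 s \<le> E" using flat_exp_bounded[of 2] by blast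
  define C where "C = E * ((F * B + 2 * G) / 4)"
  define h where "h x = u x * adjoint_op b d \<phi> x" for x
  define v where "v x = indicator K x * (u x / norm x)" for x
  define \<epsilon> :: "nat \<Rightarrow> real" where "\<epsilon> k = inverse (real (Suc k))" for k
  have \<epsilon>: "0 < \<epsilon> k" for k by (simp add: \<epsilon>_def)
  have \<epsilon>lim: "\<epsilon> \<longlonglongrightarrow> 0" unfolding \<epsilon>_def by (rule LIMSEQ_inverse_real_of_nat)
  have h: "integrable lebesgue h"
    unfolding h_def[abs_def] by (rule integrable_adjoint[OF \<phi>(1) order_refl u_L1_loc])
  have v: "integrable lebesgue v"
    using u_integrable(1)[OF K(1,2)] by (simp add: v_def[abs_def] set_integrable_def)
  have bm: "barrier 0 e \<in> borel_measurable lebesgue" if "0 < e" for e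
  proof -
    have "barrier 0 e \<in> borel_measurable borel"
      by (intro borel_measurable_continuous_onI Ck_on_imp_continuous[OF Ck_on_barrier] that) simp
    then show ?thesis by (intro measurable_completion) simp
  qed
  have bh: "integrable lebesgue (\<lambda>x. barrier 0 (\<epsilon> k) x * h x)" for k
    by (rule Bochner_Integration.integrable_bound[OF h borel_measurable_times[OF bm[OF \<epsilon>] borel_measurable_integrable[OF h]]])
      (auto simp: abs_mult barrier_bounds intro!: mult_left_le_one_le)
  have step: "0 \<le> (\<integral>x. barrier 0 (\<epsilon> k) x * h x \<partial>lebesgue) + C * \<epsilon> k * (\<integral>x. v x \<partial>lebesgue)" for k
  proof -
    define \<psi> where "\<psi> x = barrier 0 (\<epsilon> k) x * \<phi> x" for x
    have \<psi>: "\<psi> \<in> test_functions (ball 0 1 - {0})"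
      unfolding \<psi>_def[abs_def] by (rule barrier_mult_test[OF \<phi>(1) _ \<epsilon>]) simp
    have \<psi>K: "\<psi> \<in> test_functions (K - {0})"
      unfolding \<psi>_def[abs_def] by (rule barrier_mult_test[OF \<phi>K _ \<epsilon>]) simp
    have "0 \<le> (\<integral>x. u x * adjoint_op b d \<psi> x \<partial>lebesgue)"
      by (rule super[OF \<psi>]) (simp add: \<psi>_def \<phi>(2) barrier_bounds)
    also have "\<dots> \<le> (\<integral>x. barrier 0 (\<epsilon> k) x * h x + C * \<epsilon> k * v x \<partial>lebesgue)"
    proof (rule integral_mono)
      show "integrable lebesgue (\<lambda>x. u x * adjoint_op b d \<psi> x)"
        by (rule integrable_adjoint[OF \<psi> _ u_loc]) auto
      show "integrable lebesgue (\<lambda>x. barrier 0 (\<epsilon> k) x * h x + C * \<epsilon> k * v x)"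
        by (intro Bochner_Integration.integrable_add integrable_mult_right bh v)
      fix x
      show "u x * adjoint_op b d \<psi> x \<le> barrier 0 (\<epsilon> k) x * h x + C * \<epsilon> k * v x"
      proof (cases "x \<in> K - {0}")
        case False
        then have "adjoint_op b d \<psi> x = 0" by (rule adjoint_op_outside[OF \<psi>K])
        moreover have "v x = 0" using False by (auto simp: v_def)
        moreover have "barrier 0 (\<epsilon> k) x * h x = 0"
          using False adjoint_op_outside[OF \<phi>K, of x] by (auto simp: h_def barrier_def)
        ultimately show ?thesis by (simp only: mult_zero_right add_0_right order_refl)
      next
        case True
        then have x: "x \<noteq> 0" "norm x \<le> 1" "x \<in> K" using K(2) by force+
        have "adjoint_op b d \<psi> x \<le> barrier 0 (\<epsilon> k) x * adjoint_op b d \<phi> x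
            + E * ((F * B + 2 * G) * ((0 + \<epsilon> k / norm x) / 4))"
          unfolding \<psi>_def[abs_def]
          using less_imp_le[OF \<epsilon>] F[OF x(3)] G[OF x(3)] B[OF x(3)]
          by (intro adjoint_op_barrier_mult_le x dim K(4) \<phi>(2) E) auto
        then have "u x * adjoint_op b d \<psi> x \<le> u x * (barrier 0 (\<epsilon> k) x * adjoint_op b d \<phi> x
            + E * ((F * B + 2 * G) * ((0 + \<epsilon> k / norm x) / 4)))"
          using u_nonneg[of x] by (intro mult_left_mono)
        also have "\<dots> = barrier 0 (\<epsilon> k) x * h x + C * \<epsilon> k * v x"
        proof -
          have "U * (\<beta> * a + E * ((F * B + 2 * G) * ((0 + e * y) / 4)))
              = \<beta> * (U * a) + E * ((F * B + 2 * G) / 4) * e * (1 * (U * y))" for U \<beta> a e y :: real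
            by (simp add: algebra_simps)
          from this[of "u x" "barrier 0 (\<epsilon> k) x" _ "\<epsilon> k" "inverse (norm x)"] show ?thesis
            using x(3) by (simp only: h_def v_def C_def divide_inverse indicator_simps)
        qed
        finally show ?thesis .
      qed
    qed
    also have "\<dots> = (\<integral>x. barrier 0 (\<epsilon> k) x * h x \<partial>lebesgue) + C * \<epsilon> k * (\<integral>x. v x \<partial>lebesgue)"
      using bh v by (subst Bochner_Integration.integral_add) auto
    finally show ?thesis .
  qed
  have "(\<lambda>k. \<integral>x. barrier 0 (\<epsilon> k) x * h x \<partial>lebesgue) \<longlonglongrightarrow> (\<integral>x. flat_exp 0 (1/4) * h x \<partial>lebesgue)"
  proof (rule integral_dominated_convergence[where w = "\<lambda>x. \<bar>h x\<bar>"])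
    show "(\<lambda>x. flat_exp 0 (1/4) * h x) \<in> borel_measurable lebesgue"
      "(\<lambda>x. barrier 0 (\<epsilon> k) x * h x) \<in> borel_measurable lebesgue" for k
      using h bh by (auto intro: borel_measurable_integrable)
    show "integrable lebesgue (\<lambda>x. \<bar>h x\<bar>)" using h by simp
    show "AE x in lebesgue. norm (barrier 0 (\<epsilon> k) x * h x) \<le> \<bar>h x\<bar>" for k
      by (auto simp: abs_mult barrier_bounds intro!: mult_left_le_one_le)
    show "AE x in lebesgue. (\<lambda>k. barrier 0 (\<epsilon> k) x * h x) \<longlonglongrightarrow> flat_exp 0 (1/4) * h x"
    proof (rule AE_I')
      show "{0 :: real ^ 'n} \<in> null_sets lebesgue"
        using negligible_sing negligible_iff_null_sets by blast
      show "{x \<in> space lebesgue. \<not> (\<lambda>k. barrier 0 (\<epsilon> k) x * h x) \<longlonglongrightarrow> flat_exp 0 (1/4) * h x} \<subseteq> {0}"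
      proof (rule subsetI, rule ccontr)
        fix x :: "real ^ 'n"
        assume x: "x \<in> {x \<in> space lebesgue. \<not> (\<lambda>k. barrier 0 (\<epsilon> k) x * h x) \<longlonglongrightarrow> flat_exp 0 (1/4) * h x}"
          and "x \<notin> {0}"
        then have x0: "x \<noteq> 0" by simp
        have "(\<lambda>k. log_profile 0 (\<epsilon> k) x) \<longlonglongrightarrow> (1 + 0 * norm x + 0 * ln (norm x)) / 4"
          unfolding log_profile_def by (intro tendsto_intros \<epsilon>lim) auto
        then have "(\<lambda>k. log_profile 0 (\<epsilon> k) x) \<longlonglongrightarrow> 1/4" by simp
        then have "(\<lambda>k. flat_exp 0 (log_profile 0 (\<epsilon> k) x)) \<longlonglongrightarrow> flat_exp 0 (1/4)"
          by (rule isCont_tendsto_compose[OF DERIV_isCont[OF flat_exp_has_derivative]])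
        then have "(\<lambda>k. barrier 0 (\<epsilon> k) x * h x) \<longlonglongrightarrow> flat_exp 0 (1/4) * h x"
          using x0 by (intro tendsto_mult tendsto_const) (simp add: barrier_def)
        then show False using x by simp
      qed
    qed
  qed
  moreover have "(\<lambda>k. C * \<epsilon> k * (\<integral>x. v x \<partial>lebesgue)) \<longlonglongrightarrow> C * 0 * (\<integral>x. v x \<partial>lebesgue)"
    by (intro tendsto_intros \<epsilon>lim)
  ultimately have "(\<lambda>k. (\<integral>x. barrier 0 (\<epsilon> k) x * h x \<partial>lebesgue) + C * \<epsilon> k * (\<integral>x. v x \<partial>lebesgue))
      \<longlonglongrightarrow> (\<integral>x. flat_exp 0 (1/4) * h x \<partial>lebesgue) + C * 0 * (\<integral>x. v x \<partial>lebesgue)"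
    by (rule tendsto_add)
  then have "0 \<le> (\<integral>x. flat_exp 0 (1/4) * h x \<partial>lebesgue) + C * 0 * (\<integral>x. v x \<partial>lebesgue)"
    by (rule LIMSEQ_le_const) (use step in blast)
  then have "0 \<le> flat_exp 0 (1/4) * (\<integral>x. h x \<partial>lebesgue)" by simp
  then show ?thesis
    using flat_exp_pos[of "1/4" 0] by (simp add: zero_le_mult_iff h_def)
qed

end

section \<open>Locally finite Borel measures are Radon\<close>

lemma emeasure_density_indicator:
  assumes "sets \<nu> = sets borel" "B \<in> sets borel" "A \<in> sets borel"
  shows "emeasure (density \<nu> (indicator B)) A = emeasure \<nu> (B \<inter> A)"
proof -
  have "emeasure (density \<nu> (indicator B)) A = (\<integral>\<^sup>+ x. indicator B x * indicator A x \<partial>\<nu>)"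
    using assms by (intro emeasure_density borel_measurable_indicator) auto
  also have "\<dots> = (\<integral>\<^sup>+ x. indicator (B \<inter> A) x \<partial>\<nu>)"
    by (intro nn_integral_cong) (auto simp: indicator_def)
  also have "\<dots> = emeasure \<nu> (B \<inter> A)"
    using assms by (intro nn_integral_indicator) auto
  finally show ?thesis .
qed

lemma open_compact_exhaustion:
  fixes U :: "(real ^ 'n) set"
  assumes "open U"
  obtains K :: "nat \<Rightarrow> (real ^ 'n) set" where "\<And>k. compact (K k)" "incseq K" "(\<Union>k. K k) = U"
proof -
  define K where "K k = cball 0 (real k) - (\<Union>y\<in>-U. ball y (1 / (real k + 1)))" for k :: nat
  show thesis
  proof (rule that[of K])
    show "compact (K k)" for k
      unfolding K_def by (intro compact_diff compact_cball open_UN ballI open_ball)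
    show "incseq K"
    proof (rule incseq_SucI)
      fix k
      have "1 / (real (Suc k) + 1) \<le> 1 / (real k + 1)" by (simp add: field_simps)
      then have "ball y (1 / (real (Suc k) + 1)) \<subseteq> ball y (1 / (real k + 1))" for y :: "real ^ 'n"
        by (rule subset_ball)
      then show "K k \<subseteq> K (Suc k)" unfolding K_def by (intro Diff_mono subset_cball UN_mono) auto
    qed
    show "(\<Union>k. K k) = U"
    proof (rule equalityI; rule subsetI)
      fix x assume "x \<in> (\<Union>k. K k)"
      then obtain k where k: "x \<in> K k" by blast
      show "x \<in> U"
      proof (rule ccontr)
        assume "x \<notin> U"
        moreover have "x \<in> ball x (1 / (real k + 1))" by simp
        ultimately show False using k unfolding K_def by blast
      qed
    next
      fix x assume "x \<in> U"
      then obtain e where e: "0 < e" "ball x e \<subseteq> U" using assms open_contains_ball by blast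
      obtain k1 :: nat where k1: "norm x \<le> real k1" using real_arch_simple by blast
      obtain k2 :: nat where k2: "1 / e \<le> real k2" using real_arch_simple by blast
      define k where "k = max k1 k2"
      have ke: "1 / (real k + 1) \<le> e"
      proof -
        have "1 / e \<le> real k + 1" using k2 by (simp add: k_def)
        then show ?thesis using e(1) by (simp add: field_simps)
      qed
      have "x \<notin> ball y (1 / (real k + 1))" if "y \<in> - U" for y
      proof
        assume "x \<in> ball y (1 / (real k + 1))"
        then have "y \<in> ball x e" using ke by (simp add: dist_commute)
        then show False using that e(2) by blast
      qed
      moreover have "x \<in> cball 0 (real k)" using k1 by (simp add: k_def)
      ultimately have "x \<in> K k" unfolding K_def by blast
      then show "x \<in> (\<Union>k. K k)" by blast
    qed
  qed
qed

text \<open>Inner regularity holds for finite Borel measures on the whole space. It is applied to the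
  restrictions of \<open>\<nu>\<close> to the members of a compact exhaustion of \<open>U\<close>.\<close>
lemma radon_measure_on_restrict_space:
  fixes \<nu> :: "(real ^ 'n) measure"
  assumes U: "open U" and s: "sets \<nu> = sets borel"
    and fin: "\<And>K. compact K \<Longrightarrow> K \<subseteq> U \<Longrightarrow> emeasure \<nu> K < \<infinity>"
  shows "radon_measure_on U (restrict_space \<nu> U)"
proof -
  have Us: "U \<inter> space \<nu> \<in> sets \<nu>" using U s sets_eq_imp_space_eq[OF s] by simp
  note em = emeasure_restrict_space[OF Us]
  have sr: "sets (restrict_space \<nu> U) = sets (restrict_space borel U)"
    by (rule sets_restrict_space_cong[OF s])
  have "emeasure (restrict_space \<nu> U) A
      = (SUP K\<in>{K. compact K \<and> K \<subseteq> A}. emeasure (restrict_space \<nu> U) K)"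
    if "A \<in> sets (restrict_space \<nu> U)" for A
  proof -
    have A: "A \<in> sets borel" "A \<subseteq> U"
      using that U unfolding sr by (auto simp: sets_restrict_space_iff)
    obtain K where K: "\<And>k. compact (K k)" "incseq K" "(\<Union>k. K k) = U"
      using open_compact_exhaustion[OF U] by blast
    have KU: "K k \<subseteq> U" for k using K(3) by blast
    have Kb: "K k \<in> sets borel" for k using K(1) by (simp add: borel_compact)
    have le: "emeasure \<nu> (K k \<inter> A) \<le> (SUP L\<in>{L. compact L \<and> L \<subseteq> A}. emeasure \<nu> L)" for k
    proof -
      define N where "N = density \<nu> (indicator (K k))"
      have sN: "sets N = sets borel" using s by (simp add: N_def)
      have N: "emeasure N B = emeasure \<nu> (K k \<inter> B)" if "B \<in> sets borel" for B
        unfolding N_def by (rule emeasure_density_indicator[OF s Kb that])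
      have "emeasure N (space N) = emeasure \<nu> (K k)"
        using N[of UNIV] sets_eq_imp_space_eq[OF sN] by simp
      then have "emeasure N (space N) \<noteq> \<infinity>" using fin[OF K(1) KU, of k] by simp
      then have "emeasure N A = (SUP L\<in>{L. L \<subseteq> A \<and> compact L}. emeasure N L)"
        by (rule inner_regular[OF sN _ A(1)])
      also have "\<dots> \<le> (SUP L\<in>{L. compact L \<and> L \<subseteq> A}. emeasure \<nu> L)"
      proof (rule SUP_mono)
        fix L assume L: "L \<in> {L. L \<subseteq> A \<and> compact L}"
        then have Lb: "L \<in> sets borel" by (simp add: borel_compact)
        have "emeasure N L \<le> emeasure \<nu> L"
          unfolding N[OF Lb] using Lb s by (intro emeasure_mono) auto
        then show "\<exists>L'\<in>{L. compact L \<and> L \<subseteq> A}. emeasure N L \<le> emeasure \<nu> L'" using L by blast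
      qed
      finally show ?thesis by (simp add: N[OF A(1)])
    qed
    have "incseq (\<lambda>k. K k \<inter> A)" using K(2) unfolding incseq_def by blast
    then have "(SUP k. emeasure \<nu> (K k \<inter> A)) = emeasure \<nu> (\<Union>k. K k \<inter> A)"
      using Kb A(1) s by (intro SUP_emeasure_incseq) auto
    moreover have "(\<Union>k. K k \<inter> A) = A" using K(3) A(2) by blast
    ultimately have "emeasure \<nu> A = (SUP k. emeasure \<nu> (K k \<inter> A))" by simp
    also have "\<dots> \<le> (SUP L\<in>{L. compact L \<and> L \<subseteq> A}. emeasure \<nu> L)"
      by (rule SUP_least) (rule le)
    finally have "emeasure \<nu> A \<le> (SUP L\<in>{L. compact L \<and> L \<subseteq> A}. emeasure \<nu> L)" .
    moreover have "(SUP L\<in>{L. compact L \<and> L \<subseteq> A}. emeasure \<nu> L) \<le> emeasure \<nu> A"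
      using A(1) s by (intro SUP_least emeasure_mono) auto
    ultimately have "emeasure \<nu> A = (SUP L\<in>{L. compact L \<and> L \<subseteq> A}. emeasure \<nu> L)" by (rule antisym)
    also have "\<dots> = (SUP L\<in>{L. compact L \<and> L \<subseteq> A}. emeasure (restrict_space \<nu> U) L)"
      using A(2) by (intro SUP_cong refl em[symmetric]) auto
    finally show ?thesis unfolding em[OF A(2)] .
  qed
  then show ?thesis
    unfolding radon_measure_on_def using sr em fin by auto
qed

lemma radon_measure_split_atom:
  fixes \<nu> :: "(real ^ 'n) measure"
  assumes U: "open U" "p \<in> U" and s: "sets \<nu> = sets borel"
    and fin: "\<And>K. compact K \<Longrightarrow> K \<subseteq> U \<Longrightarrow> emeasure \<nu> K < \<infinity>"
  obtains \<mu> where "radon_measure_on U \<mu>" "emeasure \<mu> {p} = 0"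
    "\<And>\<phi>. integrable \<nu> \<phi> \<Longrightarrow> (\<And>x. x \<notin> U \<Longrightarrow> \<phi> x = 0) \<Longrightarrow>
      (\<integral>x. \<phi> x \<partial>\<nu>) = (\<integral>x. \<phi> x \<partial>\<mu>) + measure \<nu> {p} * (\<phi> p :: real)"
proof -
  define \<nu>0 where "\<nu>0 = density \<nu> (indicator (- {p}))"
  have sp: "space \<nu> = UNIV" using sets_eq_imp_space_eq[OF s] by simp
  have s0: "sets \<nu>0 = sets borel" using s by (simp add: \<nu>0_def)
  have sp0: "space \<nu>0 = UNIV" using sets_eq_imp_space_eq[OF s0] by simp
  have pb: "- {p} \<in> sets borel" by simp
  have em: "emeasure \<nu>0 A = emeasure \<nu> (- {p} \<inter> A)" if "A \<in> sets borel" for A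
    unfolding \<nu>0_def by (rule emeasure_density_indicator[OF s pb that])
  have fin0: "emeasure \<nu>0 K < \<infinity>" if K: "compact K" "K \<subseteq> U" for K
  proof -
    have Kb: "K \<in> sets borel" using K(1) by (simp add: borel_compact)
    have "emeasure \<nu>0 K \<le> emeasure \<nu> K"
      unfolding em[OF Kb] using Kb s by (intro emeasure_mono) auto
    then show ?thesis using fin[OF K] by (rule order.strict_trans1)
  qed
  have Us: "U \<inter> space \<nu>0 \<in> sets \<nu>0" using U(1) s0 sp0 by simp
  show thesis
  proof (rule that[of "restrict_space \<nu>0 U"])
    show "radon_measure_on U (restrict_space \<nu>0 U)"
      by (rule radon_measure_on_restrict_space[OF U(1) s0 fin0])
    have "emeasure (restrict_space \<nu>0 U) {p} = emeasure \<nu>0 {p}"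
      using U(2) by (intro emeasure_restrict_space[OF Us]) simp
    also have "\<dots> = 0" by (simp add: em)
    finally show "emeasure (restrict_space \<nu>0 U) {p} = 0" .
    fix \<phi> :: "real ^ 'n \<Rightarrow> real"
    assume \<phi>: "integrable \<nu> \<phi>" "\<And>x. x \<notin> U \<Longrightarrow> \<phi> x = 0"
    have "(\<integral>x. \<phi> x \<partial>restrict_space \<nu>0 U) = (\<integral>x. indicator U x *\<^sub>R \<phi> x \<partial>\<nu>0)"
      by (rule integral_restrict_space[OF Us])
    also have "\<dots> = (\<integral>x. \<phi> x \<partial>\<nu>0)"
      using \<phi>(2) by (intro Bochner_Integration.integral_cong refl) (auto simp: indicator_def)
    also have "\<dots> = (\<integral>x. \<phi> x \<partial>density \<nu> (\<lambda>x. ennreal (indicator (- {p}) x)))"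
      unfolding \<nu>0_def by (simp add: ennreal_indicator)
    also have "\<dots> = (\<integral>x. indicator (- {p}) x *\<^sub>R \<phi> x \<partial>\<nu>)"
      using s by (intro integral_density borel_measurable_integrable[OF \<phi>(1)] borel_measurable_indicator) auto
    finally have \<mu>: "(\<integral>x. \<phi> x \<partial>restrict_space \<nu>0 U) = (\<integral>x. indicator (- {p}) x *\<^sub>R \<phi> x \<partial>\<nu>)" .
    have pf: "emeasure \<nu> {p} < \<infinity>" using U(2) by (intro fin) auto
    have 1: "integrable \<nu> (\<lambda>x. indicator (- {p}) x *\<^sub>R \<phi> x)"
      using s by (intro integrable_mult_indicator \<phi>(1)) simp
    have 2: "integrable \<nu> (\<lambda>x. indicator {p} x *\<^sub>R \<phi> p)"
      using s pf by (intro integrable_scaleR_left) (simp add: integrable_indicator_iff)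
    have "(\<integral>x. \<phi> x \<partial>\<nu>) = (\<integral>x. indicator (- {p}) x *\<^sub>R \<phi> x + indicator {p} x *\<^sub>R \<phi> p \<partial>\<nu>)"
      by (intro Bochner_Integration.integral_cong refl) (auto simp: indicator_def)
    also have "\<dots> = (\<integral>x. indicator (- {p}) x *\<^sub>R \<phi> x \<partial>\<nu>) + measure \<nu> {p} * \<phi> p"
      unfolding Bochner_Integration.integral_add[OF 1 2] using sp by simp
    finally show "(\<integral>x. \<phi> x \<partial>\<nu>) = (\<integral>x. \<phi> x \<partial>restrict_space \<nu>0 U) + measure \<nu> {p} * \<phi> p"
      unfolding \<mu> .
  qed
qed

section \<open>The distribution of a supersolution\<close>

lemma divergence_scaleR:
  assumes "\<phi> differentiable (at x)" "\<And>i. (\<lambda>y. b y $ i) differentiable (at x)"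
  shows "divergence (\<lambda>y. \<phi> y *\<^sub>R b y) x
    = (\<Sum>i\<in>UNIV. b x $ i * partial_deriv i \<phi> x) + \<phi> x * divergence b x"
  unfolding divergence_def
  by (simp add: partial_deriv_mult[OF assms] sum.distrib sum_distrib_left mult.commute)

text \<open>The exceptional null set allows \<open>u\<close> and \<open>c\<close> to be replaced by representatives for which sign
  and bound hold everywhere.\<close>
lemma (in adjoint_coefficients) elliptic_dist_eq_adjoint:
  assumes U: "U \<subseteq> ball 0 1" and \<phi>: "\<phi> \<in> test_functions U" and v: "v \<in> L1_loc U"
    and b: "\<And>i x. x \<in> U \<Longrightarrow> (\<lambda>y. b y $ i) differentiable (at x)"
    and Z: "negligible Z" "\<And>x. x \<in> U - Z \<Longrightarrow> u x = v x \<and> c x = d x + divergence b x"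
  shows "elliptic_dist U b c u \<phi> = (\<integral>x. v x * adjoint_op b d \<phi> x \<partial>lebesgue)"
proof -
  define f where "f x = v x * adjoint_op b d \<phi> x" for x
  define g where "g x = indicator U x *\<^sub>R
    (u x * (- laplacian \<phi> x - divergence (\<lambda>y. \<phi> y *\<^sub>R b y) x + c x * \<phi> x))" for x
  have f: "integrable lebesgue f"
    unfolding f_def[abs_def] by (rule integrable_adjoint[OF \<phi> U v])
  have eq: "g x = f x" if "x \<notin> Z" for x
  proof (cases "x \<in> U")
    case True
    have "\<phi> differentiable (at x)"
      by (rule Ck_on_SucD(1)[OF test_functions_smooth[OF \<phi>, of "Suc 0"] open_UNIV UNIV_I])
    then have "divergence (\<lambda>y. \<phi> y *\<^sub>R b y) x
        = (\<Sum>i\<in>UNIV. b x $ i * partial_deriv i \<phi> x) + \<phi> x * divergence b x"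
      by (rule divergence_scaleR[OF _ b[OF True]])
    then show ?thesis
      using True Z(2)[of x] that by (simp add: f_def g_def adjoint_op_def algebra_simps)
  next
    case False
    then show ?thesis using adjoint_op_outside[OF \<phi>] by (simp add: f_def g_def)
  qed
  have "f absolutely_integrable_on UNIV" using f by (simp add: set_integrable_def)
  then have "g absolutely_integrable_on UNIV"
    by (rule absolutely_integrable_spike[OF _ Z(1)]) (use eq in auto)
  then have g: "integrable lebesgue g" by (simp add: set_integrable_def)
  have "AE x in lebesgue. g x = f x"
    using Z(1) eq by (intro AE_I'[of Z]) (auto simp: negligible_iff_null_sets)
  then have "(\<integral>x. g x \<partial>lebesgue) = (\<integral>x. f x \<partial>lebesgue)"
    by (intro integral_cong_AE borel_measurable_integrable f g)
  then show ?thesis by (simp add: elliptic_dist_def set_lebesgue_integral_def f_def g_def)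
qed

theorem theorem1p2:
  fixes b :: "real ^ 'n \<Rightarrow> real ^ 'n" and c u :: "real ^ 'n \<Rightarrow> real" and M :: real
  assumes dim: "CARD('n) \<ge> 2"
    and b_C1: "\<forall>i. Ck_on 1 (\<lambda>x. b x $ i) (ball 0 1)"
    and c_meas: "c \<in> borel_measurable (lebesgue_on (ball 0 1))"
    and bound: "C1_norm (ball 0 1) b + Linf_norm (ball 0 1) c \<le> ereal M"
    and u_loc: "u \<in> L1_loc (ball 0 1 - {0})"
    and u_nonneg: "AE x in lebesgue_on (ball 0 1 - {0}). 0 \<le> u x"
    and super: "dist_nonneg (ball 0 1 - {0}) (elliptic_dist (ball 0 1 - {0}) b c u)"
  shows "u \<in> L1_loc (ball 0 1) \<and>
    (\<exists>(a::real) \<mu>. 0 \<le> a \<and> radon_measure_on (ball 0 1) \<mu> \<and> emeasure \<mu> {0} = 0 \<and>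
       dist_eq (ball 0 1) (elliptic_dist (ball 0 1) b c u)
         (\<lambda>\<phi>. (LINT x|\<mu>. \<phi> x) + a * dirac 0 \<phi>))"
proof -
  let ?B = "ball 0 1 :: (real ^ 'n) set"
  have b1: "Ck_on (Suc 0) (\<lambda>x. b x $ i) ?B" for i using b_C1 by (simp only: One_nat_def)
  note bd = Ck_on_SucD(1)[OF b1 open_ball] and bp = Ck_on_SucD(2)[OF b1 open_ball]
  have b_cont: "continuous_on ?B b"
  proof -
    have "continuous_on ?B (\<lambda>x. \<chi> i. b x $ i)"
      by (intro continuous_on_vec_lambda Ck_on_imp_continuous[OF b1])
    then show ?thesis by simp
  qed
  have div_cont: "continuous_on ?B (divergence b)"
    unfolding divergence_def[abs_def] by (intro continuous_on_sum Ck_on_imp_continuous[OF bp])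
  have "Linf_norm ?B c \<noteq> \<infinity>" using bound by auto
  then obtain C where C: "Linf_norm ?B c \<le> ereal C"
    by (cases "Linf_norm ?B c") (auto intro: that[of 0])
  have "AE x in lebesgue_on ?B. ereal \<bar>c x\<bar> \<le> Linf_norm ?B c"
    unfolding Linf_norm_def by (rule esssup_AE)
  then have "AE x in lebesgue_on ?B. \<bar>c x\<bar> \<le> C"
    by (rule eventually_mono) (use C in \<open>metis ereal_less_eq(3) order_trans\<close>)
  then have cAE: "AE x in lebesgue. x \<in> ?B \<longrightarrow> \<bar>c x\<bar> \<le> C"
    by (subst (asm) AE_restrict_space_iff) auto
  have uAE: "AE x in lebesgue. x \<in> ?B - {0} \<longrightarrow> 0 \<le> u x"
    using u_nonneg by (subst (asm) AE_restrict_space_iff) auto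
  obtain Z0 where Z0: "Z0 \<in> null_sets lebesgue"
    "{x \<in> space lebesgue. \<not> ((x \<in> ?B \<longrightarrow> \<bar>c x\<bar> \<le> C) \<and> (x \<in> ?B - {0} \<longrightarrow> 0 \<le> u x))} \<subseteq> Z0"
    using eventually_conj[OF cAE uAE] unfolding eventually_ae_filter by blast
  define Z where "Z = insert 0 Z0"
  have Z: "negligible Z" using Z0(1) by (simp add: Z_def negligible_iff_null_sets[symmetric])
  have cZ: "\<bar>c x\<bar> \<le> C" and uZ: "0 \<le> u x" if "x \<in> ?B - Z" for x
    using that Z0(2) by (auto simp: Z_def)
  \<comment> \<open>Sign and bound are known only almost everywhere; the truncated coefficient and the absolute
    value satisfy them at every point and define the same distribution.\<close>
  define c' where "c' x = (if \<bar>c x\<bar> \<le> C then c x else 0)" for x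
  define d where "d x = c' x - divergence b x" for x
  define v where "v x = \<bar>u x\<bar>" for x
  have "c' \<in> borel_measurable (lebesgue_on ?B)"
    unfolding c'_def[abs_def] using c_meas by measurable
  moreover have "divergence b \<in> borel_measurable (lebesgue_on ?B)"
    by (rule continuous_imp_measurable_on_sets_lebesgue[OF div_cont]) simp
  ultimately have d_meas: "d \<in> borel_measurable (lebesgue_on ?B)"
    unfolding d_def[abs_def] by (rule borel_measurable_diff)
  have d_bdd: "\<exists>D. \<forall>x\<in>K. \<bar>d x\<bar> \<le> D" if K: "compact K" "K \<subseteq> ?B" for K
  proof -
    obtain D where D: "\<And>x. x \<in> K \<Longrightarrow> \<bar>divergence b x\<bar> \<le> D"
      using compact_imp_bounded[OF compact_continuous_image[OF continuous_on_subset[OF div_cont K(2)] K(1)]]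
      by (auto simp: bounded_real)
    have "\<bar>d x\<bar> \<le> \<bar>C\<bar> + D" if "x \<in> K" for x
    proof -
      have "\<bar>c' x\<bar> \<le> \<bar>C\<bar>" by (simp add: c'_def)
      then show ?thesis using D[OF that] unfolding d_def by linarith
    qed
    then show ?thesis by blast
  qed
  interpret A: adjoint_coefficients b d
    using dim b_cont d_meas d_bdd by unfold_locales
  have v_loc: "v \<in> L1_loc (?B - {0})"
    using u_loc set_integrable_abs[of lebesgue _ u] by (auto simp: L1_loc_def v_def[abs_def])
  have eqZ: "u x = v x \<and> c x = d x + divergence b x" if "x \<in> ?B - Z" for x
    using cZ[OF that] uZ[OF that] by (simp add: v_def d_def c'_def)
  have rep: "elliptic_dist U b c u \<phi> = (\<integral>x. v x * adjoint_op b d \<phi> x \<partial>lebesgue)"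
    if "U \<subseteq> ?B" "\<phi> \<in> test_functions U" "v \<in> L1_loc U" for U \<phi>
    using that bd eqZ by (intro A.elliptic_dist_eq_adjoint[OF that _ Z]) auto
  interpret S: punctured_supersolution b d v
  proof unfold_locales
    show "0 \<le> v x" for x by (simp add: v_def)
    show "v \<in> L1_loc (?B - {0})" by (rule v_loc)
    fix \<psi> :: "real ^ 'n \<Rightarrow> real"
    assume \<psi>: "\<psi> \<in> test_functions (?B - {0})" "\<And>x. 0 \<le> \<psi> x"
    then have "0 \<le> elliptic_dist (?B - {0}) b c u \<psi>"
      using super by (simp add: dist_nonneg_def)
    also have "\<dots> = (\<integral>x. v x * adjoint_op b d \<psi> x \<partial>lebesgue)"
      by (rule rep[OF _ \<psi>(1) v_loc]) auto
    finally show "0 \<le> (\<integral>x. v x * adjoint_op b d \<psi> x \<partial>lebesgue)" .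
  qed
  define T where "T \<phi> = (\<integral>x. v x * adjoint_op b d \<phi> x \<partial>lebesgue)" for \<phi>
  note int = A.integrable_adjoint[OF _ order_refl S.u_L1_loc]
  interpret P: positive_functional ?B T
  proof unfold_locales
    fix \<phi> \<psi> :: "real ^ 'n \<Rightarrow> real" and a :: real
    assume \<phi>: "\<phi> \<in> test_functions ?B"
    show "T (\<lambda>x. a * \<phi> x) = a * T \<phi>"
      unfolding T_def A.adjoint_op_cmult[OF test_functions_smooth[OF \<phi>]]
      by (simp add: mult.left_commute)
    show "0 \<le> T \<phi>" if "\<And>x. 0 \<le> \<phi> x"
      unfolding T_def using \<phi> that by (rule S.supersolution_across_origin)
    assume \<psi>: "\<psi> \<in> test_functions ?B"
    show "T (\<lambda>x. \<phi> x + \<psi> x) = T \<phi> + T \<psi>"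
      unfolding T_def A.adjoint_op_add[OF test_functions_smooth[OF \<phi>] test_functions_smooth[OF \<psi>]] distrib_left
      by (rule Bochner_Integration.integral_add[OF int[OF \<phi>] int[OF \<psi>]])
  qed simp
  obtain \<nu> where \<nu>: "sets \<nu> = sets borel" "\<And>K. compact K \<Longrightarrow> K \<subseteq> ?B \<Longrightarrow> emeasure \<nu> K < \<infinity>"
    "\<And>\<phi>. \<phi> \<in> test_functions ?B \<Longrightarrow> integrable \<nu> \<phi>"
    "\<And>\<phi>. \<phi> \<in> test_functions ?B \<Longrightarrow> (\<integral>x. \<phi> x \<partial>\<nu>) = T \<phi>"
    using P.riesz_representation by blast
  obtain \<mu> where \<mu>: "radon_measure_on ?B \<mu>" "emeasure \<mu> {0} = 0"
    "\<And>\<phi>. integrable \<nu> \<phi> \<Longrightarrow> (\<And>x. x \<notin> ?B \<Longrightarrow> \<phi> x = 0) \<Longrightarrow>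
      (\<integral>x. \<phi> x \<partial>\<nu>) = (\<integral>x. \<phi> x \<partial>\<mu>) + measure \<nu> {0} * (\<phi> 0 :: real)"
  proof (rule radon_measure_split_atom[of ?B "0 :: real ^ 'n" \<nu>])
    show "emeasure \<nu> K < \<infinity>" if "compact K" "K \<subseteq> ?B" for K using that by (rule \<nu>(2))
  qed (use \<nu>(1) that in auto)
  have "elliptic_dist ?B b c u \<phi> = (\<integral>x. \<phi> x \<partial>\<mu>) + measure \<nu> {0} * dirac 0 \<phi>"
    if \<phi>: "\<phi> \<in> test_functions ?B" for \<phi>
  proof -
    have "elliptic_dist ?B b c u \<phi> = T \<phi>"
      unfolding T_def by (rule rep[OF order_refl \<phi> S.u_L1_loc])
    also have "\<dots> = (\<integral>x. \<phi> x \<partial>\<nu>)" using \<nu>(4)[OF \<phi>] by simp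
    also have "\<dots> = (\<integral>x. \<phi> x \<partial>\<mu>) + measure \<nu> {0} * \<phi> 0"
      by (rule \<mu>(3)[OF \<nu>(3)[OF \<phi>] test_functions_outside[OF \<phi>]])
    finally show ?thesis by (simp add: dirac_def)
  qed
  then have "dist_eq ?B (elliptic_dist ?B b c u) (\<lambda>\<phi>. (LINT x|\<mu>. \<phi> x) + measure \<nu> {0} * dirac 0 \<phi>)"
    by (simp add: dist_eq_def)
  moreover have "u \<in> L1_loc ?B"
    unfolding L1_loc_def
  proof (intro CollectI allI impI, elim conjE)
    fix K assume K: "compact K" "K \<subseteq> ?B"
    have "v absolutely_integrable_on K" by (rule S.u_integrable(2)[OF K])
    then show "u absolutely_integrable_on K"
      by (rule absolutely_integrable_spike[OF _ Z]) (use eqZ K(2) in auto)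
  qed
  ultimately show ?thesis
    using \<mu>(1,2) by (intro conjI exI[of _ "measure \<nu> {0}"] exI[of _ \<mu>]) auto
qed

end
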